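(* Let $N\ge 1$ and $\alpha,\mathsf{s}\in(0,1)$. Assume that $\mathbf{w}\in C_0(\mathbb{R}^N)\cap L^1(\mathbb{R}^N)$ satisfies $\int_{\mathbb{R}^N}\mathbf{w}(x)\,dx>0$. Consider the problem $$\partial_t^\alpha u+(-\Delta)^{\mathsf{s}}u=|u|^p+t^\sigma\mathbf{w}(x)\ \text{ in }(0,\infty)\times\mathbb{R}^N,\qquad u(0,x)=u_0(x)\ge 0\ \text{ in }\mathbb{R}^N.$$ (i) If $-\alpha<\sigma\le 0$, $2\mathsf{s}<N$, and $$1<p<p^*:=\frac{N\alpha-2\mathsf{s}\sigma}{N\alpha-2\mathsf{s}(\alpha+\sigma)},$$ then the problem admits no global weak solution. (ii) If $\sigma>0$, then for every $p>1$ the problem admits no global weak solution.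
   Context: $\partial_t^\alpha$ is the Caputo derivative of order $\alpha$ in time, and $(-\Delta)^{\mathsf{s}}u=\mathcal{F}^{-1}(|\xi|^{2\mathsf{s}}\mathcal{F}u)$ is the fractional Laplacian. $C_0(\mathbb{R}^N)$ denotes the continuous functions vanishing at infinity. The right-sided Riemann–Liouville derivative is $$\mathscr{D}^\alpha_{t|T}v(t)=-\frac{1}{\Gamma(1-\alpha)}\frac{d}{dt}\int_t^T(s-t)^{-\alpha}v(s)\,ds.$$ Global weak solution: given $u_0\in L^1_{\mathrm{loc}}(\mathbb{R}^N)$, $u_0\ge0$, a function $u\in L^p_{\mathrm{loc}}([0,\infty)\times\mathbb{R}^N)$ is a global weak solution if for every $T>0$ and every $\varphi\in C_c^\infty([0,T)\times\mathbb{R}^N)$ all the integrals below converge absolutely and $$\int_0^T\!\!\int_{\mathbb{R}^N}u_0\,\mathscr{D}^\alpha_{t|T}\varphi\,dx\,dt+\int_0^T\!\!\int_{\mathbb{R}^N}|u|^p\varphi\,dx\,dt+\int_0^T\!\!\int_{\mathbb{R}^N}t^\sigma\mathbf{w}\,\varphi\,dx\,dt=\int_0^T\!\!\int_{\mathbb{R}^N}u\,(-\Delta)^{\mathsf{s}}\varphi\,dx\,dt+\int_0^T\!\!\int_{\mathbb{R}^N}u\,\mathscr{D}^\alpha_{t|T}\varphi\,dx\,dt.$$ *)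

theory Defs
  imports "HOL-Analysis.Analysis"
begin

text \<open>
  The space-time domain is a subset of \<open>real \<times> (real ^ 'n)\<close>, with points \<open>(t, x)\<close> and \<open>N = CARD('n)\<close>.
\<close>

section \<open>Smooth functions and test functions\<close>

text \<open>
  \<open>Ck_on k f U\<close> is meant for open \<open>U\<close>. In finite dimension, \<open>f\<close> is \<open>C\<^sup>k\<^sup>+\<^sup>1\<close> iff it is differentiable
  and all its directional derivatives are \<open>C\<^sup>k\<close>.
\<close>
primrec Ck_on :: "nat \<Rightarrow> ('a::euclidean_space \<Rightarrow> 'b::real_normed_vector) \<Rightarrow> 'a set \<Rightarrow> bool" where
  "Ck_on 0 f U \<longleftrightarrow> continuous_on U f"
| "Ck_on (Suc k) f U \<longleftrightarrow>
     (\<forall>x\<in>U. f differentiable (at x)) \<and>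
     (\<forall>v. Ck_on k (\<lambda>x. frechet_derivative f (at x) v) U)"

definition smooth_on :: "('a::euclidean_space \<Rightarrow> 'b::real_normed_vector) \<Rightarrow> 'a set \<Rightarrow> bool" where
  "smooth_on f U \<longleftrightarrow> (\<forall>k. Ck_on k f U)"

text \<open>
  The class of \<open>C\<^sub>c\<^sup>\<infinity>([0,T) \<times> \<real>\<^sup>N)\<close>. The domain is not open in space-time, so smoothness means,
  as usual, that the function has a smooth extension to an open neighbourhood of the domain. The
  support is compact in \<open>[0,T) \<times> \<real>\<^sup>N\<close>, hence may meet \<open>t = 0\<close> but stays away from \<open>t = T\<close>.
  The values of \<open>\<phi>\<close> outside \<open>[0,T) \<times> \<real>\<^sup>N\<close> are irrelevant here and in all integrals below.
\<close>
definition test_function :: "real \<Rightarrow> (real \<times> (real ^ 'n) \<Rightarrow> real) \<Rightarrow> bool" where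
  "test_function T \<phi> \<longleftrightarrow>
     (\<exists>U \<psi>. open U \<and> {0..<T} \<times> UNIV \<subseteq> U \<and> smooth_on \<psi> U \<and>
            (\<forall>z \<in> {0..<T} \<times> UNIV. \<phi> z = \<psi> z)) \<and>
     (\<exists>K. compact K \<and> K \<subseteq> {0..<T} \<times> UNIV \<and> (\<forall>z \<in> {0..<T} \<times> UNIV - K. \<phi> z = 0))"

section \<open>Local Lebesgue spaces\<close>

definition L1_loc :: "(real ^ 'n \<Rightarrow> real) \<Rightarrow> bool" where
  "L1_loc f \<longleftrightarrow> (\<forall>K. compact K \<longrightarrow> set_integrable lebesgue K f)"

text \<open>
  \<open>L\<^sup>p\<^sub>l\<^sub>o\<^sub>c([0,\<infinity>) \<times> \<real>\<^sup>N)\<close>; the compact sets may touch \<open>t = 0\<close>. Measurability of \<open>u\<close> is required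
  separately because integrability of \<open>|u|\<^sup>p\<close> does not imply it.
\<close>
definition Lp_loc_spacetime :: "real \<Rightarrow> (real \<times> (real ^ 'n) \<Rightarrow> real) \<Rightarrow> bool" where
  "Lp_loc_spacetime p u \<longleftrightarrow>
     u \<in> borel_measurable (lebesgue_on ({0..} \<times> UNIV)) \<and>
     (\<forall>K. compact K \<and> K \<subseteq> {0..} \<times> UNIV \<longrightarrow> set_integrable lebesgue K (\<lambda>z. \<bar>u z\<bar> powr p))"

section \<open>Fractional operators\<close>

text \<open>
  The normalisation is the one for which \<open>|\<xi>|\<^sup>2\<close> is the Fourier symbol of \<open>-\<Delta>\<close>, so that
  \<open>|\<xi>|\<^sup>2\<^sup>s\<close> is the symbol of its fractional power, with no factors of \<open>2\<pi>\<close>.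
\<close>
definition fourier :: "(real ^ 'n \<Rightarrow> complex) \<Rightarrow> real ^ 'n \<Rightarrow> complex" where
  "fourier f \<xi> = (LINT x|lborel. cis (- (\<xi> \<bullet> x)) * f x)"

definition inverse_fourier :: "(real ^ 'n \<Rightarrow> complex) \<Rightarrow> real ^ 'n \<Rightarrow> complex" where
  "inverse_fourier g x =
     complex_of_real (1 / (2 * pi) ^ CARD('n)) * (LINT \<xi>|lborel. cis (\<xi> \<bullet> x) * g \<xi>)"

text \<open>
  The symbol is real and even, so for real-valued \<open>f\<close> the inverse transform is real-valued and
  \<open>Re\<close> only changes the type.
\<close>
definition frac_laplacian :: "real \<Rightarrow> (real ^ 'n \<Rightarrow> real) \<Rightarrow> real ^ 'n \<Rightarrow> real" where
  "frac_laplacian s f x =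
     Re (inverse_fourier
           (\<lambda>\<xi>. complex_of_real (norm \<xi> powr (2 * s)) * fourier (\<lambda>y. complex_of_real (f y)) \<xi>) x)"

definition RL_right_deriv :: "real \<Rightarrow> real \<Rightarrow> (real \<Rightarrow> real) \<Rightarrow> real \<Rightarrow> real" where
  "RL_right_deriv \<alpha> T v t =
     - (1 / Gamma (1 - \<alpha>)) *
       deriv (\<lambda>t. LINT r:{t<..<T}|lborel. (r - t) powr (- \<alpha>) * v r) t"

section \<open>Global weak solutions\<close>

text \<open>
  \<open>u\<close> is a global weak solution of \<open>\<partial>\<^sub>t\<^sup>\<alpha> u + (-\<Delta>)\<^sup>s u = |u|\<^sup>p + t\<^sup>\<sigma> w(x)\<close> with initial value \<open>u\<^sub>0\<close>.
\<close>
definition global_weak_solution ::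
    "real \<Rightarrow> real \<Rightarrow> real \<Rightarrow> real \<Rightarrow> (real ^ 'n \<Rightarrow> real) \<Rightarrow> (real ^ 'n \<Rightarrow> real)
      \<Rightarrow> (real \<times> (real ^ 'n) \<Rightarrow> real) \<Rightarrow> bool" where
  "global_weak_solution \<alpha> s p \<sigma> w u0 u \<longleftrightarrow>
     Lp_loc_spacetime p u \<and>
     (\<forall>T>0. \<forall>\<phi>. test_function T \<phi> \<longrightarrow>
       (let Q = {0<..<T} \<times> UNIV;
            D\<phi> = (\<lambda>(t, x). RL_right_deriv \<alpha> T (\<lambda>r. \<phi> (r, x)) t);
            L\<phi> = (\<lambda>(t, x). frac_laplacian s (\<lambda>y. \<phi> (t, y)) x)
        in
          set_integrable lebesgue Q (\<lambda>(t, x). u0 x * D\<phi> (t, x)) \<and>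
          set_integrable lebesgue Q (\<lambda>(t, x). \<bar>u (t, x)\<bar> powr p * \<phi> (t, x)) \<and>
          set_integrable lebesgue Q (\<lambda>(t, x). t powr \<sigma> * w x * \<phi> (t, x)) \<and>
          set_integrable lebesgue Q (\<lambda>(t, x). u (t, x) * L\<phi> (t, x)) \<and>
          set_integrable lebesgue Q (\<lambda>(t, x). u (t, x) * D\<phi> (t, x)) \<and>
          set_lebesgue_integral lebesgue Q (\<lambda>(t, x). u0 x * D\<phi> (t, x))
            + set_lebesgue_integral lebesgue Q (\<lambda>(t, x). \<bar>u (t, x)\<bar> powr p * \<phi> (t, x))
            + set_lebesgue_integral lebesgue Q (\<lambda>(t, x). t powr \<sigma> * w x * \<phi> (t, x))
          = set_lebesgue_integral lebesgue Q (\<lambda>(t, x). u (t, x) * L\<phi> (t, x))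
            + set_lebesgue_integral lebesgue Q (\<lambda>(t, x). u (t, x) * D\<phi> (t, x))))"

end

theory Submission
  imports Defs "HOL-Computational_Algebra.Polynomial" "HOL-Probability.Characteristic_Functions"
    "HOL-Probability.Sinc_Integral" "HOL-Real_Asymp.Real_Asymp"
begin

text \<open>
  Test the equation with \<open>\<phi>(t, x) = v(t/T) \<Phi>(x)\<close>. The \<open>u\<^sub>0\<close> term is nonnegative because \<open>v\<close> is
  nonincreasing. As \<open>u\<close> has no sign and \<open>(-\<Delta>)\<^sup>s \<Phi>\<close> does not vanish outside the support of \<open>\<Phi>\<close>, one
  needs \<open>\<bar>(-\<Delta>)\<^sup>s \<Phi>\<bar> \<le> C \<Phi>\<close>, which no compactly supported \<open>\<Phi>\<close> satisfies. Instead \<open>\<Phi>\<close> is a sum of dilations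
  of a fixed bump \<open>\<eta>\<close> over the scales \<open>2\<^sup>k R\<close>, \<open>k \<le> K\<close>, with weights \<open>2\<^sup>-\<^sup>k\<^sup>(\<^sup>N\<^sup>+\<^sup>2\<^sup>s\<^sup>)\<close>. Since
  \<open>(-\<Delta>)\<^sup>s \<eta>\<close> has size \<open>\<bar>x\<bar>\<^sup>-\<^sup>N\<^sup>-\<^sup>2\<^sup>s\<close> at infinity, one has \<open>R\<^sup>2\<^sup>s \<bar>(-\<Delta>)\<^sup>s \<Phi>\<bar> \<le> C \<omega>\<close>
  for \<open>\<omega>(x) = (1 + \<bar>x\<bar>/R)\<^sup>-\<^sup>N\<^sup>-\<^sup>2\<^sup>s\<close>, and \<open>c \<omega> \<le> \<Phi>\<close> unless \<open>\<bar>x\<bar> > 2\<^sup>K R/2\<close>. The same size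
  bound, from below, shows that \<open>u \<omega>\<close> is integrable, so the contribution of that region vanishes as \<open>K \<rightarrow> \<infinity>\<close>. Young's
  inequality then gives, with \<open>p' = p/(p - 1)\<close>,
  \<open>T\<^sup>\<sigma> \<le> C R\<^sup>N (T\<^sup>-\<^sup>\<alpha>\<^sup>p\<^sup>' + R\<^sup>-\<^sup>2\<^sup>s\<^sup>p\<^sup>')\<close> for all \<open>T > 0\<close> and all large \<open>R\<close>. Taking
  \<open>R = T\<^sup>\<alpha>\<^sup>/\<^sup>2\<^sup>s\<close>, respectively \<open>R\<close> fixed, and \<open>T \<rightarrow> \<infinity>\<close> contradicts \<open>p < p\<^sup>*\<close>, respectively \<open>\<sigma> > 0\<close>.
\<close>

section \<open>Smooth cutoffs\<close>

text \<open>The obstacle is nonlocality: outside the support of a nonnegative bump the fractional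
  Laplacian is strictly negative, so no multiple of the bump controls it there. The weights serve
  two ends. On the shell |x| ~ 2^k R the bump of scale 2^k R has to reproduce \<omega>, which
  dictates 2^(-k(N+2s)); homogeneity then gives the Laplacian of that bump a further factor
  2^(-2sk), so all sums over k are geometric and bounded uniformly in K. The same factor keeps the
  mass of \<Phi> of order R^N. Of the sources only the one at the smallest scale is kept; the others
  are nonnegative because at large scales their sign is that of the integral of w. The behaviour at
  infinity is extracted from the Fourier definition by writing |\<xi>|^(2s) as a superposition of 1
  - exp(-\<tau> |\<xi>|^2), which leaves Gaussian integrals; a product bump makes them
  one-dimensional. The limit K -> infinity is taken at fixed T and R, before T grows.\<close>

lemma poly_times_exp_uminus_tendsto_0:
  fixes Q :: "real poly"
  shows "((\<lambda>y. poly Q y * exp (- y)) \<longlongrightarrow> 0) at_top"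
proof -
  have "((\<lambda>y. \<Sum>i\<le>degree Q. coeff Q i * (y ^ i / exp y)) \<longlongrightarrow> (\<Sum>i\<le>degree Q. coeff Q i * 0)) at_top"
    by (intro tendsto_sum tendsto_mult tendsto_const tendsto_power_div_exp_0)
  moreover have "(\<lambda>y. poly Q y * exp (- y)) = (\<lambda>y. \<Sum>i\<le>degree Q. coeff Q i * (y ^ i / exp y))"
    by (rule ext) (simp add: poly_altdef sum_distrib_right exp_minus divide_inverse mult.assoc)
  ultimately show ?thesis by simp
qed

text \<open>
  Closed under differentiation, so that smoothness at \<open>0\<close> needs only one limit.
\<close>
definition flat_exp :: "real poly \<Rightarrow> real \<Rightarrow> real" where
  "flat_exp P s = (if s > 0 then poly P (1 / s) * exp (- (1 / s)) else 0)"

text \<open>In the variable y = 1/s, differentiation is -y^2 d/dy, which sends P(y) exp(-y) to y^2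
  (P - P')(y) exp(-y); this is the origin of the polynomial on the right.\<close>

lemma flat_exp_has_derivative:
  "(flat_exp P has_real_derivative flat_exp (monom 1 2 * (P - pderiv P)) s) (at s)"
proof -
  consider "s > 0" | "s < 0" | "s = 0" by linarith
  then show ?thesis
  proof cases
    case 1
    have "((\<lambda>s. poly P (1 / s) * exp (- (1 / s))) has_real_derivative
            flat_exp (monom 1 2 * (P - pderiv P)) s) (at s)"
      using 1 by (auto intro!: derivative_eq_intros DERIV_chain2[where f="poly P"]
          simp: flat_exp_def poly_monom algebra_simps power2_eq_square field_simps)
    then show ?thesis
      by (rule has_field_derivative_transform_within_open[where S="{0<..}"])
        (use 1 in \<open>auto simp: flat_exp_def\<close>)
  next
    case 2
    have "((\<lambda>s. 0) has_real_derivative flat_exp (monom 1 2 * (P - pderiv P)) s) (at s)"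
      using 2 by (simp add: flat_exp_def)
    then show ?thesis
      by (rule has_field_derivative_transform_within_open[where S="{..<0}"])
        (use 2 in \<open>auto simp: flat_exp_def\<close>)
  next
    case 3
    \<comment> \<open>The difference quotient at 0 brings one more factor 1/h, hence
      \<open>monom 1 1 * P\<close>.\<close>
    have "((\<lambda>h. poly (monom 1 1 * P) (inverse h) * exp (- inverse h)) \<longlongrightarrow> 0) (at_right 0)"
      using filterlim_compose[OF poly_times_exp_uminus_tendsto_0 filterlim_inverse_at_top_right] .
    then have R: "((\<lambda>h. flat_exp P h / h) \<longlongrightarrow> 0) (at_right 0)"
    proof (rule Lim_transform_eventually)
      show "\<forall>\<^sub>F h in at_right 0. poly (monom 1 1 * P) (inverse h) * exp (- inverse h) = flat_exp P h / h"
        unfolding eventually_at_right_field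
        by (rule exI[of _ 1]) (auto simp: flat_exp_def poly_monom field_simps)
    qed
    have "((\<lambda>h::real. 0::real) \<longlongrightarrow> 0) (at_left 0)" by simp
    then have L: "((\<lambda>h. flat_exp P h / h) \<longlongrightarrow> 0) (at_left 0)"
    proof (rule Lim_transform_eventually)
      show "\<forall>\<^sub>F h in at_left 0. 0 = flat_exp P h / h"
        unfolding eventually_at_left_field
        by (rule exI[of _ "-1"]) (auto simp: flat_exp_def)
    qed
    from L R have "((\<lambda>h. flat_exp P h / h) \<longlongrightarrow> 0) (at 0)"
      by (simp add: filterlim_split_at)
    then show ?thesis
      unfolding 3 has_field_derivative_iff by (simp add: flat_exp_def)
  qed
qed

section \<open>Sums, products and affine compositions of C^k functions\<close>

lemma Ck_on_Suc_imp: "Ck_on (Suc k) f UNIV \<Longrightarrow> Ck_on k f UNIV"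
proof (induction k arbitrary: f)
  case 0
  then show ?case
    by (auto intro!: continuous_at_imp_continuous_on differentiable_imp_continuous_within)
next
  case (Suc k)
  then show ?case by (metis Ck_on.simps(2))
qed

lemma Ck_on_const: "Ck_on k (\<lambda>x. c) UNIV"
  by (induction k arbitrary: c) auto

lemma Ck_on_add: "Ck_on k f UNIV \<Longrightarrow> Ck_on k g UNIV \<Longrightarrow> Ck_on k (\<lambda>x. f x + g x) UNIV"
proof (induction k arbitrary: f g)
  case 0
  then show ?case by (auto intro: continuous_intros)
next
  case (Suc k)
  then have d: "\<And>x. f differentiable (at x)" "\<And>x. g differentiable (at x)" by auto
  then have "frechet_derivative (\<lambda>x. f x + g x) (at x) v
      = frechet_derivative f (at x) v + frechet_derivative g (at x) v" for x v
    using frechet_derivative_at[OF has_derivative_add, of f _ x g, symmetric]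
    by (metis (no_types, lifting) frechet_derivative_works)
  with Suc d show ?case by simp
qed

lemma Ck_on_mult:
  fixes f g :: "'a::euclidean_space \<Rightarrow> real"
  shows "Ck_on k f UNIV \<Longrightarrow> Ck_on k g UNIV \<Longrightarrow> Ck_on k (\<lambda>x. f x * g x) UNIV"
proof (induction k arbitrary: f g)
  case 0
  then show ?case by (auto intro: continuous_intros)
next
  case (Suc k)
  then have d: "\<And>x. f differentiable (at x)" "\<And>x. g differentiable (at x)" by auto
  then have "frechet_derivative (\<lambda>x. f x * g x) (at x) v
      = f x * frechet_derivative g (at x) v + frechet_derivative f (at x) v * g x" for x v
    using frechet_derivative_at[OF has_derivative_mult[of f _ x UNIV g], symmetric]
    by (metis (no_types, lifting) frechet_derivative_works)
  \<comment> \<open>Each summand of the product rule keeps one factor undifferentiated, so the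
    induction hypothesis needs \<open>f\<close> and \<open>g\<close> themselves at the lower order
    k.\<close>
  moreover have "Ck_on k (\<lambda>x. f x * frechet_derivative g (at x) v + frechet_derivative f (at x) v * g x) UNIV" for v
    using Suc.prems by (intro Ck_on_add Suc.IH Ck_on_Suc_imp[of k f] Ck_on_Suc_imp[of k g]) auto
  ultimately show ?case using d by simp
qed

lemma Ck_on_prod:
  fixes f :: "'i \<Rightarrow> 'a::euclidean_space \<Rightarrow> real"
  shows "(\<And>i. i \<in> I \<Longrightarrow> Ck_on k (f i) UNIV) \<Longrightarrow> Ck_on k (\<lambda>x. \<Prod>i\<in>I. f i x) UNIV"
  by (induction I rule: infinite_finite_induct) (auto intro: Ck_on_const Ck_on_mult)

text \<open>The induction runs over all polynomials at once: the derivative in direction v is the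
  constant \<open>l v\<close> times \<open>flat_exp\<close> of another polynomial.\<close>

lemma Ck_on_flat_exp_affine:
  fixes l :: "'a::euclidean_space \<Rightarrow> real"
  assumes l: "bounded_linear l"
  shows "Ck_on k (\<lambda>x. flat_exp P (l x + c)) UNIV"
proof (induction k arbitrary: P)
  case 0
  have "isCont (flat_exp P) y" for y using flat_exp_has_derivative DERIV_isCont by blast
  then have "continuous_on UNIV (flat_exp P)" by (simp add: continuous_on_eq_continuous_at)
  moreover have "continuous_on UNIV l" using l by (rule linear_continuous_on)
  ultimately show ?case
    by (auto intro!: continuous_intros intro: continuous_on_compose2)
next
  case (Suc k)
  let ?Q = "monom 1 2 * (P - pderiv P)"
  have D: "((\<lambda>x. flat_exp P (l x + c)) has_derivative (\<lambda>v. flat_exp ?Q (l x + c) * l v)) (at x)" for x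
  proof -
    have "((\<lambda>x. l x + c) has_derivative l) (at x)"
      using has_derivative_add_const bounded_linear_imp_has_derivative l by blast
    from has_derivative_compose[OF this
        flat_exp_has_derivative[of P "l x + c", unfolded has_field_derivative_def]]
    show ?thesis .
  qed
  then have "frechet_derivative (\<lambda>x. flat_exp P (l x + c)) (at x) v = flat_exp ?Q (l x + c) * l v" for x v
    using frechet_derivative_at by metis
  moreover have "(\<lambda>x. flat_exp P (l x + c)) differentiable (at x)" for x
    using D by (auto simp: differentiable_def)
  ultimately show ?case using Suc[of ?Q] by (auto intro: Ck_on_mult Ck_on_const)
qed

text \<open>Two factors with affine arguments, instead of one function of y^2, make smoothness along
  a linear functional a product of two affine cases.\<close>

definition bump :: "real \<Rightarrow> real" where
  "bump y = flat_exp 1 (1 - y) * flat_exp 1 (1 + y)"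

lemma Ck_on_bump_affine:
  fixes l :: "'a::euclidean_space \<Rightarrow> real"
  assumes "bounded_linear l"
  shows "Ck_on k (\<lambda>x. bump (l x)) UNIV"
  using Ck_on_mult[OF Ck_on_flat_exp_affine[of "\<lambda>x. - l x" k 1 1] Ck_on_flat_exp_affine[of l k 1 1]]
  using bounded_linear_minus[OF assms] assms unfolding bump_def by (simp add: add.commute)

lemma flat_exp_1_nonneg: "0 \<le> flat_exp 1 s"
  and flat_exp_1_le_1: "flat_exp 1 s \<le> 1"
  and flat_exp_1_mono: "r \<le> s \<Longrightarrow> flat_exp 1 r \<le> flat_exp 1 s"
  by (auto simp: flat_exp_def field_simps)

lemma continuous_flat_exp: "continuous_on A (flat_exp P)"
  using flat_exp_has_derivative DERIV_isCont continuous_at_imp_continuous_on by blast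

lemma bump_nonneg: "0 \<le> bump y" and bump_le_1: "bump y \<le> 1"
  by (auto simp: bump_def flat_exp_1_nonneg flat_exp_1_le_1 mult_le_one)

lemma bump_eq_0: "1 < \<bar>y\<bar> \<Longrightarrow> bump y = 0"
  by (auto simp: bump_def flat_exp_def)

lemma continuous_bump: "continuous_on A bump"
  unfolding bump_def
  by (intro continuous_intros continuous_on_compose2[OF continuous_flat_exp[of UNIV]]) auto

lemma bump_ge: "\<bar>y\<bar> \<le> 1/2 \<Longrightarrow> exp (-4) \<le> bump y"
proof -
  assume y: "\<bar>y\<bar> \<le> 1/2"
  have "exp (-2) \<le> flat_exp 1 r" if "1/2 \<le> r" for r
    using that by (auto simp: flat_exp_def field_simps)
  from this[of "1 - y"] this[of "1 + y"] y
  have "exp (-2) * exp (-2) \<le> bump y" unfolding bump_def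
    by (intro mult_mono) (auto simp: flat_exp_1_nonneg)
  then show ?thesis by (simp flip: exp_add)
qed

section \<open>The Riemann--Liouville derivative of the time cutoff\<close>

lemma set_integrable_lborel_powr:
  fixes a c :: real
  assumes "-1 < a" "0 \<le> c"
  shows "set_integrable lborel {0..c} (\<lambda>x. x powr a)"
    and "(LINT x:{0..c}|lborel. x powr a) = c powr (a + 1) / (a + 1)"
proof -
  have "(\<lambda>x. x powr a) absolutely_integrable_on {0..c}"
    by (rule nonnegative_absolutely_integrable_1) (use integrable_on_powr_from_0[OF assms] in auto)
  then show *: "set_integrable lborel {0..c} (\<lambda>x. x powr a)"
    unfolding set_integrable_def by (subst (asm) integrable_completion) auto
  show "(LINT x:{0..c}|lborel. x powr a) = c powr (a + 1) / (a + 1)"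
    using set_borel_integral_eq_integral(2)[OF *] has_integral_powr_from_0[OF assms]
    by (simp add: integral_unique)
qed

text \<open>
  The vanishing to infinite order at \<open>1/2\<close> gives \<open>\<bar>time_cutoff'\<bar> \<le> C time_cutoff\<^sup>1\<^sup>/\<^sup>p\<close>, which is what Young's
  inequality requires of the fractional time derivative.
\<close>
definition time_cutoff :: "real \<Rightarrow> real" where
  "time_cutoff z = flat_exp 1 (1 / 2 - z)"

definition time_cutoff' :: "real \<Rightarrow> real" where
  "time_cutoff' z = - flat_exp (monom 1 2) (1 / 2 - z)"

lemma time_cutoff_deriv: "(time_cutoff has_real_derivative time_cutoff' z) (at z)"
  unfolding time_cutoff_def time_cutoff'_def
  by (rule DERIV_chain2[OF flat_exp_has_derivative, THEN DERIV_cong] derivative_eq_intros)+ auto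

lemma continuous_time_cutoff: "continuous_on A time_cutoff"
  and continuous_time_cutoff': "continuous_on A time_cutoff'"
  unfolding time_cutoff_def time_cutoff'_def
  by (auto intro!: continuous_intros continuous_on_compose2[OF continuous_flat_exp[of UNIV]])

lemma time_cutoff_bounds: "0 \<le> time_cutoff z" "time_cutoff z \<le> 1"
  and time_cutoff_eq_0: "1 / 2 \<le> z \<Longrightarrow> time_cutoff z = 0"
  and time_cutoff_antimono: "y \<le> z \<Longrightarrow> time_cutoff z \<le> time_cutoff y"
  and time_cutoff_ge: "z \<le> 1 / 4 \<Longrightarrow> exp (- 4) \<le> time_cutoff z"
  and time_cutoff'_nonpos: "time_cutoff' z \<le> 0"
  using flat_exp_1_mono[of "1/4" "1/2 - z"] flat_exp_1_mono[of "1/2 - z" "1/2 - y"]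
    flat_exp_1_nonneg[of "1/2 - z"] flat_exp_1_le_1[of "1/2 - z"]
  by (simp_all add: time_cutoff_def time_cutoff'_def) (auto simp: flat_exp_def poly_monom)

lemma time_cutoff'_bound:
  assumes "1 < p"
  obtains C where "0 < C" "\<And>z. \<bar>time_cutoff' z\<bar> \<le> C * time_cutoff z powr (1 / p)"
proof
  \<comment> \<open>With y = 1/(1/2 - z), the power 1/p of the cutoff consumes only exp(-y/p) of
    exp(-y). The remaining exp(-a y) absorbs the factor y^2, and the quadratic Taylor bound for
    exp(a y) gives the constant 2/a^2.\<close>
  define a where "a = 1 - 1 / p"
  have a: "0 < a" using assms by (simp add: a_def)
  show "0 < 2 / a\<^sup>2" using a by simp
  fix z
  show "\<bar>time_cutoff' z\<bar> \<le> 2 / a\<^sup>2 * time_cutoff z powr (1 / p)"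
  proof (cases "z < 1/2")
    case True
    define y where "y = 1 / (1 / 2 - z)"
    have y: "0 < y" using True by (simp add: y_def)
    have "1 + a * y + (a * y)\<^sup>2 / 2 \<le> exp (a * y)"
      using a y by (intro exp_lower_Taylor_quadratic) simp
    then have "(a * y)\<^sup>2 / 2 \<le> exp (a * y)" using a y by (smt (verit) mult_pos_pos)
    then have "y\<^sup>2 \<le> 2 / a\<^sup>2 * exp (a * y)" using a by (simp add: field_simps power_mult_distrib)
    then have "y\<^sup>2 * exp (- y) \<le> 2 / a\<^sup>2 * exp (a * y) * exp (- y)"
      by (rule mult_right_mono) simp
    also have "\<dots> = 2 / a\<^sup>2 * exp (- y / p)"
      by (simp add: a_def mult.assoc flip: exp_add) (simp add: algebra_simps)
    finally show ?thesis using True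
      by (simp add: time_cutoff'_def time_cutoff_def flat_exp_def y_def poly_monom powr_def power_divide mult.commute)
  qed (use a in \<open>auto simp: time_cutoff'_def time_cutoff_def flat_exp_def\<close>)
qed

text \<open>The substitution r = t + q moves t from the singular kernel into the smooth cutoff. The
  derivative then falls on the cutoff, and the kernel times a bound for \<open>time_cutoff'\<close>
  is an integrable majorant. \<open>D\<close> is chosen before \<open>e\<close>, so that a spatial
  factor can be pulled out of the derivative.\<close>

lemma RL_right_deriv_time_cutoff:
  fixes \<alpha> p :: real
  assumes \<alpha>: "0 < \<alpha>" "\<alpha> < 1" and p: "1 < p"
  obtains C where "0 < C"
    "\<And>T t e. 0 < T \<Longrightarrow> 0 < t \<Longrightarrow> t < T \<Longrightarrow>
      \<exists>D. (\<forall>e. RL_right_deriv \<alpha> T (\<lambda>r. time_cutoff (r / T) * e) t = D * e) \<and>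
          0 \<le> D \<and> D \<le> C * T powr (- \<alpha>) * time_cutoff (t / T) powr (1 / p)"
proof -
  obtain M where M: "0 < M" "\<And>z. \<bar>time_cutoff' z\<bar> \<le> M * time_cutoff z powr (1 / p)"
    using time_cutoff'_bound[OF p] by blast
  have M': "\<bar>time_cutoff' z\<bar> \<le> M" for z
  proof -
    have "time_cutoff z powr (1 / p) \<le> 1"
      using p time_cutoff_bounds[of z] by (intro powr_le1) auto
    then show ?thesis using M(2)[of z] M(1) by (smt (verit) mult_left_le)
  qed
  have Gam: "0 < Gamma (1 - \<alpha>)" using \<alpha> by (intro Gamma_real_pos) auto
  define C where "C = M / ((1 - \<alpha>) * Gamma (1 - \<alpha>))"
  have C: "0 < C" using M Gam \<alpha> by (simp add: C_def)
  have [measurable]: "time_cutoff \<in> borel_measurable borel" "time_cutoff' \<in> borel_measurable borel"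
    using continuous_time_cutoff continuous_time_cutoff' by (auto intro: borel_measurable_continuous_onI)
  show ?thesis
  proof (rule that[OF C])
    fix T t :: real assume T: "0 < T" and t: "0 < t" "t < T"
    \<comment> \<open>Integrating over all of [0, T] makes the domain independent of t. The surplus
      q \<ge> T - t is harmless, as the cutoff vanishes there.\<close>
    define k where "k q = indicator {0..T} q * q powr (- \<alpha>)" for q
    have k_int: "integrable lborel k" and k_val: "(LINT q|lborel. k q) = T powr (1 - \<alpha>) / (1 - \<alpha>)"
      using set_integrable_lborel_powr[of "- \<alpha>" T] \<alpha> T
      by (simp_all add: k_def[abs_def] set_integrable_def set_lebesgue_integral_def)
    have k0: "0 \<le> k q" for q by (simp add: k_def)
    have [measurable]: "k \<in> borel_measurable borel" unfolding k_def[abs_def] by measurable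
    define G where "G t = (LINT q|lborel. k q * time_cutoff ((t + q) / T))" for t
    define G' where "G' = (LINT q|lborel. k q * time_cutoff' ((t + q) / T) / T)"
    have k_int2: "integrable lborel (\<lambda>q. k q * time_cutoff ((r + q) / T))" for r
      by (rule Bochner_Integration.integrable_bound[OF k_int])
        (use k0 time_cutoff_bounds in \<open>auto simp: abs_mult mult_left_le\<close>)
    have F: "(LINT r:{t<..<T}|lborel. (r - t) powr (- \<alpha>) * (time_cutoff (r / T) * e)) = G t * e"
      if t: "0 < t" "t < T" for t e
    proof -
      have "(LINT r:{t<..<T}|lborel. (r - t) powr (- \<alpha>) * (time_cutoff (r / T) * e))
          = (LINT q|lborel. indicator {t<..<T} (t + q) * (q powr (- \<alpha>) * (time_cutoff ((t + q) / T) * e)))"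
        unfolding set_lebesgue_integral_def
        by (subst lborel_integral_real_affine[where c=1 and t=t]) auto
      also have "\<dots> = (LINT q|lborel. k q * time_cutoff ((t + q) / T) * e)"
      proof (rule Bochner_Integration.integral_cong[OF refl])
        fix q
        have "time_cutoff ((t + q) / T) = 0" if "T - t \<le> q"
          using that t by (intro time_cutoff_eq_0) (simp add: field_simps)
        \<comment> \<open>The open and the closed interval differ at q = 0, where
          \<open>0 powr (- \<alpha>)\<close> has the default value 0.\<close>
        then show "indicator {t<..<T} (t + q) * (q powr (- \<alpha>) * (time_cutoff ((t + q) / T) * e))
            = k q * time_cutoff ((t + q) / T) * e"
          using t by (cases "q = 0"; cases "q < T - t") (auto simp: k_def indicator_def)
      qed
      finally show ?thesis by (simp add: G_def)
    qed
    have "(G has_real_derivative G') (at t)"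
      unfolding DERIV_def tendsto_at_iff_sequentially
    proof (intro allI impI)
      fix X :: "nat \<Rightarrow> real" assume X: "\<forall>i. X i \<in> UNIV - {0}" "X \<longlonglongrightarrow> 0"
      have "(\<lambda>i. LINT q|lborel. k q * ((time_cutoff ((t + X i + q) / T) - time_cutoff ((t + q) / T)) / X i))
          \<longlonglongrightarrow> G'"
        unfolding G'_def
      proof (rule integral_dominated_convergence[where w="\<lambda>q. k q * (M / T)"])
        show "integrable lborel (\<lambda>q. k q * (M / T))" using k_int by simp
        show "AE q in lborel. (\<lambda>i. k q * ((time_cutoff ((t + X i + q) / T) - time_cutoff ((t + q) / T)) / X i))
            \<longlonglongrightarrow> k q * time_cutoff' ((t + q) / T) / T"
        proof (rule AE_I2)
          fix q
          have "((\<lambda>z. (z + q) / T) has_real_derivative 1 / T) (at t)"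
            using T by (auto intro!: derivative_eq_intros)
          from DERIV_chain2[OF time_cutoff_deriv this]
          have "((\<lambda>z. time_cutoff ((z + q) / T)) has_real_derivative time_cutoff' ((t + q) / T) / T) (at t)"
            by simp
          then have "(\<lambda>i. (time_cutoff ((t + X i + q) / T) - time_cutoff ((t + q) / T)) / X i)
              \<longlonglongrightarrow> time_cutoff' ((t + q) / T) / T"
            unfolding DERIV_def tendsto_at_iff_sequentially using X by (auto simp: o_def)
          from tendsto_mult[OF tendsto_const[of "k q"] this]
          show "(\<lambda>i. k q * ((time_cutoff ((t + X i + q) / T) - time_cutoff ((t + q) / T)) / X i))
            \<longlonglongrightarrow> k q * time_cutoff' ((t + q) / T) / T" by simp
        qed
        show "AE q in lborel. norm (k q * ((time_cutoff ((t + X i + q) / T) - time_cutoff ((t + q) / T)) / X i))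
            \<le> k q * (M / T)" for i
        proof (rule AE_I2)
          fix q
          have "norm (time_cutoff ((t + X i + q) / T) - time_cutoff ((t + q) / T))
              \<le> M * norm ((t + X i + q) / T - (t + q) / T)"
            by (rule field_differentiable_bound[of UNIV _ time_cutoff'])
              (use time_cutoff_deriv M' in auto)
          also have "\<dots> = M / T * \<bar>X i\<bar>" using T by (simp add: field_simps flip: diff_divide_distrib)
          finally have "\<bar>(time_cutoff ((t + X i + q) / T) - time_cutoff ((t + q) / T)) / X i\<bar> \<le> M / T"
            using X by (simp add: divide_le_eq)
          then show "norm (k q * ((time_cutoff ((t + X i + q) / T) - time_cutoff ((t + q) / T)) / X i))
            \<le> k q * (M / T)"
            using k0[of q] by (simp only: real_norm_def abs_mult abs_of_nonneg mult_left_mono)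
        qed
      qed measurable
      moreover have "(LINT q|lborel. k q * ((time_cutoff ((t + X i + q) / T) - time_cutoff ((t + q) / T)) / X i))
          = (G (t + X i) - G t) / X i" for i
      proof -
        have "(G (t + X i) - G t) / X i = (LINT q|lborel. (k q * time_cutoff ((t + X i + q) / T) -
            k q * time_cutoff ((t + q) / T)) / X i)"
          unfolding G_def by (simp add: k_int2)
        also have "\<dots> = (LINT q|lborel. k q * ((time_cutoff ((t + X i + q) / T) - time_cutoff ((t + q) / T)) / X i))"
          by (simp only: right_diff_distrib times_divide_eq_right)
        finally show ?thesis by (rule sym)
      qed
      ultimately show "((\<lambda>h. (G (t + h) - G t) / h) \<circ> X) \<longlonglongrightarrow> G'" by (simp only: o_def)
    qed
    then have dG: "deriv (\<lambda>t. LINT r:{t<..<T}|lborel. (r - t) powr (- \<alpha>) * (time_cutoff (r / T) * e)) t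
        = G' * e" for e
      using F t by (intro DERIV_imp_deriv)
        (rule has_field_derivative_transform_within_open[where S="{0<..<T}" and f="\<lambda>t. G t * e"];
         auto intro!: derivative_eq_intros)
    \<comment> \<open>The cutoff is nonincreasing, so at every later time its derivative is bounded
      by the power of its value at t. This is what makes the resulting bound pointwise in t.\<close>
    have ge: "- (k q * (M * time_cutoff (t / T) powr (1 / p) / T)) \<le> k q * time_cutoff' ((t + q) / T) / T"
      (is "?L \<le> ?R") for q
    proof (cases "q \<in> {0..T}")
      case True
      have "time_cutoff ((t + q) / T) \<le> time_cutoff (t / T)"
        using True T by (intro time_cutoff_antimono) (simp add: divide_right_mono)
      then have "time_cutoff ((t + q) / T) powr (1 / p) \<le> time_cutoff (t / T) powr (1 / p)"
        using p by (intro powr_mono2) (auto simp: time_cutoff_bounds)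
      then have "\<bar>time_cutoff' ((t + q) / T)\<bar> \<le> M * time_cutoff (t / T) powr (1 / p)"
        using M by (meson mult_left_mono order_trans less_imp_le)
      then have "- (M * time_cutoff (t / T) powr (1 / p)) \<le> time_cutoff' ((t + q) / T)" by linarith
      then have "k q * (- (M * time_cutoff (t / T) powr (1 / p)) / T) \<le> k q * (time_cutoff' ((t + q) / T) / T)"
        using T k0 by (intro mult_left_mono divide_right_mono) auto
      then show ?thesis by simp
    qed (simp add: k_def)
    have int': "integrable lborel (\<lambda>q. k q * time_cutoff' ((t + q) / T) / T)"
    proof (rule Bochner_Integration.integrable_bound[OF integrable_mult_left[OF k_int, of "M / T"]])
      show "AE q in lborel. norm (k q * time_cutoff' ((t + q) / T) / T) \<le> norm (k q * (M / T))"
        using k0 M' M(1) T by (auto simp: abs_mult intro!: divide_right_mono mult_left_mono)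
    qed auto
    have "(LINT q|lborel. - (k q * (M * time_cutoff (t / T) powr (1 / p) / T))) \<le> G'"
      unfolding G'_def by (rule integral_mono) (use int' ge in \<open>auto intro!: integrable_mult_left[OF k_int]\<close>)
    then have "- (T powr (1 - \<alpha>) / (1 - \<alpha>) * (M * time_cutoff (t / T) powr (1 / p) / T)) \<le> G'"
      by (simp add: k_val k_int)
    moreover have "T powr (1 - \<alpha>) / T = T powr (- \<alpha>)" using T by (simp add: powr_diff powr_minus field_simps)
    moreover have "T powr (1 - \<alpha>) / (1 - \<alpha>) * (M * time_cutoff (t / T) powr (1 / p) / T)
        = M / (1 - \<alpha>) * (T powr (1 - \<alpha>) / T) * time_cutoff (t / T) powr (1 / p)"
      by simp
    ultimately have "- (M / (1 - \<alpha>) * T powr (- \<alpha>) * time_cutoff (t / T) powr (1 / p)) \<le> G'"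
      by (simp only:)
    then have "- G' \<le> M / (1 - \<alpha>) * T powr (- \<alpha>) * time_cutoff (t / T) powr (1 / p)"
      by linarith
    then have "1 / Gamma (1 - \<alpha>) * (- G') \<le> 1 / Gamma (1 - \<alpha>) * (M / (1 - \<alpha>) * T powr (- \<alpha>) * time_cutoff (t / T) powr (1 / p))"
      using Gam by (intro mult_left_mono) auto
    then have up: "- (1 / Gamma (1 - \<alpha>)) * G' \<le> C * T powr (- \<alpha>) * time_cutoff (t / T) powr (1 / p)"
      by (simp add: C_def field_simps)
    have "0 \<le> (LINT q|lborel. - (k q * time_cutoff' ((t + q) / T) / T))"
      using T k0 time_cutoff'_nonpos
      by (intro Bochner_Integration.integral_nonneg) (simp add: divide_nonpos_pos mult_nonneg_nonpos)
    then have "G' \<le> 0" by (simp add: G'_def)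
    then have "0 \<le> - (1 / Gamma (1 - \<alpha>)) * G'" using Gam by (simp add: divide_nonpos_pos)
    with up show "\<exists>D. (\<forall>e. RL_right_deriv \<alpha> T (\<lambda>r. time_cutoff (r / T) * e) t = D * e) \<and>
          0 \<le> D \<and> D \<le> C * T powr (- \<alpha>) * time_cutoff (t / T) powr (1 / p)"
      by (intro exI[of _ "- (1 / Gamma (1 - \<alpha>)) * G'"]) (simp add: RL_right_deriv_def dG)
  qed
qed

section \<open>The bump function in one dimension: Fourier transform and heat flow\<close>

lemma integrable_lborel_compact_support:
  fixes f :: "real \<Rightarrow> 'b::euclidean_space"
  assumes "continuous_on UNIV f" "\<And>y. b < \<bar>y\<bar> \<Longrightarrow> f y = 0"
  shows "integrable lborel f"
proof -
  have "integrable lborel (\<lambda>x. indicator {-b..b} x *\<^sub>R f x)"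
    by (intro borel_integrable_compact continuous_on_subset[OF assms(1)]) auto
  moreover have "(\<lambda>x. indicator {-b..b} x *\<^sub>R f x) = f"
    using assms(2) by (fastforce simp: indicator_def abs_if)
  ultimately show ?thesis by simp
qed

lemma Ck_on_imp_continuous_on: "Ck_on k f UNIV \<Longrightarrow> continuous_on UNIV f"
  by (cases k) (auto intro!: continuous_at_imp_continuous_on differentiable_imp_continuous_within)

text \<open>Each integration by parts gains one factor \<xi>. The derivative again vanishes outside
  [-1, 1], so the induction closes.\<close>

lemma fourier_transform_decay:
  assumes "Ck_on k h UNIV" "\<And>y. 1 < \<bar>y\<bar> \<Longrightarrow> h y = 0"
  shows "\<exists>C. \<forall>\<xi>. \<bar>\<xi>\<bar> ^ k * norm (LINT z|lborel. cis (- (\<xi> * z)) * complex_of_real (h z)) \<le> C"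
  using assms
proof (induction k arbitrary: h)
  case 0
  have "norm (LINT z|lborel. cis (- (\<xi> * z)) * complex_of_real (h z)) \<le> (LINT z|lborel. \<bar>h z\<bar>)" for \<xi>
    by (rule order_trans[OF integral_norm_bound]) (simp add: norm_mult)
  then show ?case by auto
next
  case (Suc k)
  define h' where "h' z = frechet_derivative h (at z) 1" for z
  have Ck: "Ck_on k h' UNIV" using Suc.prems(1) by (simp add: h'_def[abs_def])
  have d: "(h has_real_derivative h' z) (at z)" for z
  proof -
    have "h differentiable (at z)" using Suc.prems(1) by simp
    then have D: "(h has_derivative frechet_derivative h (at z)) (at z)"
      using frechet_derivative_works by blast
    have "frechet_derivative h (at z) = (\<lambda>v. h' z * v)"
    proof
      fix v
      have "linear (frechet_derivative h (at z))"
        using D has_derivative_linear by blast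
      then have "frechet_derivative h (at z) (v *\<^sub>R 1) = v *\<^sub>R frechet_derivative h (at z) 1"
        by (rule linear_cmul)
      then show "frechet_derivative h (at z) v = h' z * v" by (simp add: h'_def)
    qed
    with D show ?thesis by (simp add: has_field_derivative_def)
  qed
  have h'0: "h' z = 0" if "1 < \<bar>z\<bar>" for z
  proof -
    have "((\<lambda>z. 0) has_real_derivative h' z) (at z)"
    proof (rule has_field_derivative_transform_within_open[OF d, of "{z. 1 < \<bar>z\<bar>}"])
      show "open {z::real. 1 < \<bar>z\<bar>}" by (intro open_Collect_less continuous_intros)
    qed (use that Suc.prems(2) in auto)
    from DERIV_unique[OF this DERIV_const] show ?thesis .
  qed
  have cont: "continuous_on UNIV h" "continuous_on UNIV h'"
    by (rule Ck_on_imp_continuous_on, fact)+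
  obtain C where C: "\<And>\<xi>. \<bar>\<xi>\<bar> ^ k * norm (LINT z|lborel. cis (- (\<xi> * z)) * complex_of_real (h' z)) \<le> C"
    using Suc.IH[OF Ck h'0] by blast
  have eq: "(LINT z|lborel. cis (- (\<xi> * z)) * complex_of_real (h' z))
      = \<i> * \<xi> * (LINT z|lborel. cis (- (\<xi> * z)) * complex_of_real (h z))" for \<xi>
  proof -
    let ?F = "\<lambda>z. cis (- (\<xi> * z)) * complex_of_real (h z)"
    let ?f = "\<lambda>z. cis (- (\<xi> * z)) * complex_of_real (h' z) - \<i> * \<xi> * (cis (- (\<xi> * z)) * complex_of_real (h z))"
    have cf: "continuous_on UNIV (\<lambda>z. cis (- (\<xi> * z)) * complex_of_real (h z))"
      "continuous_on UNIV (\<lambda>z. cis (- (\<xi> * z)) * complex_of_real (h' z))"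
      using cont by (auto intro!: continuous_intros)
    have D: "(?F has_vector_derivative ?f z) (at z within {-2..2})" for z
    proof -
      have "((\<lambda>z. complex_of_real (h z)) has_vector_derivative complex_of_real (h' z)) (at z within {-2..2})"
        using d[of z] has_field_derivative_at_within
        by (intro has_vector_derivative_of_real) (simp add: has_real_derivative_iff_has_vector_derivative has_vector_derivative_at_within)
      moreover have "((\<lambda>z. cis (- (\<xi> * z))) has_vector_derivative (- (\<i> * \<xi>)) * cis (- (\<xi> * z))) (at z within {-2..2})"
      proof -
        have "((\<lambda>w. exp (- (\<i> * \<xi> * w))) has_field_derivative - (\<i> * \<xi>) * exp (- (\<i> * \<xi> * complex_of_real z)))
            (at (complex_of_real z))"
          by (auto intro!: derivative_eq_intros)
        from has_vector_derivative_real_field[OF this]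
        show ?thesis by (simp add: cis_conv_exp mult_ac o_def)
      qed
      ultimately show ?thesis
        using has_vector_derivative_mult by (fastforce simp: algebra_simps)
    qed
    have "(LINT z|lborel. indicator {-2..2} z *\<^sub>R ?f z) = ?F 2 - ?F (-2)"
    proof (rule integral_FTC_atLeastAtMost)
      show "continuous_on {-2..2} ?f"
        by (rule continuous_on_subset[of UNIV]) (use cont in \<open>auto intro!: continuous_intros\<close>)
    qed (use D in auto)
    moreover have "indicator {-2..2} z *\<^sub>R ?f z = ?f z" for z
      using Suc.prems(2)[of z] h'0[of z] by (auto simp: indicator_def)
    moreover have "integrable lborel (\<lambda>z. cis (- (\<xi> * z)) * complex_of_real (h z))"
      "integrable lborel (\<lambda>z. cis (- (\<xi> * z)) * complex_of_real (h' z))"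
      using cf Suc.prems(2) h'0 by (auto intro!: integrable_lborel_compact_support[where b=1])
    ultimately show ?thesis using Suc.prems(2) by simp
  qed
  then have "\<bar>\<xi>\<bar> ^ Suc k * norm (LINT z|lborel. cis (- (\<xi> * z)) * complex_of_real (h z)) \<le> C" for \<xi>
    using C[of \<xi>] by (simp only: eq norm_mult norm_ii norm_of_real) (simp add: mult.assoc mult.left_commute)
  then show ?case by blast
qed

definition bump_hat :: "real \<Rightarrow> complex" where
  "bump_hat y = (LINT z|lborel. cis (- (y * z)) * complex_of_real (bump z))"

lemma bump_measurable [measurable]: "bump \<in> borel_measurable borel"
  using continuous_bump by (rule borel_measurable_continuous_onI)

lemma cis_measurable [measurable]: "cis \<in> borel_measurable borel"
  by (intro borel_measurable_continuous_onI continuous_intros)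

lemma bump_hat_measurable [measurable]: "bump_hat \<in> borel_measurable borel"
  unfolding bump_hat_def[abs_def] by measurable

lemma integrable_bump: "integrable lborel bump"
  using continuous_bump bump_eq_0 by (rule integrable_lborel_compact_support)

text \<open>The weight 1 + y^2 is what the symbol |\<xi>|^(2s) will cost in each coordinate. Decay
  of order 4 still leaves the integrable factor 1/(1 + y^2).\<close>

lemma integrable_bump_hat:
  "integrable lborel (\<lambda>y. (1 + y\<^sup>2) * norm (bump_hat y))" "integrable lborel (\<lambda>y. norm (bump_hat y))"
proof -
  have Ck: "Ck_on k bump UNIV" for k
    using Ck_on_bump_affine[OF bounded_linear_ident] by simp
  obtain C0 C4 where C: "\<And>y. norm (bump_hat y) \<le> C0" "\<And>y. y ^ 4 * norm (bump_hat y) \<le> C4"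
    using fourier_transform_decay[OF Ck[of 0] bump_eq_0] fourier_transform_decay[OF Ck[of 4] bump_eq_0]
    by (auto simp: bump_hat_def)
  have I: "integrable lborel (\<lambda>x::real. inverse (1 + x\<^sup>2))"
    using integrable_inverse_1_plus_square by (simp add: set_integrable_def einterval_def)
  have le: "(1 + y\<^sup>2) * norm (bump_hat y) \<le> 2 * (C0 + C4) * inverse (1 + y\<^sup>2)" for y
  proof -
    have "(1 + y\<^sup>2) * (1 + y\<^sup>2) \<le> 2 * (1 + y ^ 4)"
      using sum_squares_ge_zero[of "1 - y\<^sup>2" 0] by (simp add: power2_eq_square power4_eq_xxxx algebra_simps)
    then have "(1 + y\<^sup>2) * (1 + y\<^sup>2) * norm (bump_hat y) \<le> 2 * (1 + y ^ 4) * norm (bump_hat y)"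
      by (rule mult_right_mono) simp
    also have "\<dots> \<le> 2 * (C0 + C4)" using C[of y] by (simp add: algebra_simps)
    finally have "(1 + y\<^sup>2) * norm (bump_hat y) * (1 + y\<^sup>2) \<le> 2 * (C0 + C4)" by (simp add: mult_ac)
    moreover have "0 < 1 + y\<^sup>2" by (simp add: add_pos_nonneg)
    ultimately show ?thesis by (simp add: pos_le_divide_eq flip: divide_inverse)
  qed
  show 1: "integrable lborel (\<lambda>y. (1 + y\<^sup>2) * norm (bump_hat y))"
  proof (rule Bochner_Integration.integrable_bound[OF integrable_mult_right[OF I, of "2 * (C0 + C4)"]])
    have "norm ((1 + y\<^sup>2) * norm (bump_hat y)) \<le> norm (2 * (C0 + C4) * inverse (1 + y\<^sup>2))" for y
      by (rule order_trans[OF _ order_trans[OF le[of y] abs_ge_self[THEN order_trans]]])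
        (simp_all add: abs_mult add_nonneg_nonneg)
    then show "AE y in lborel. norm ((1 + y\<^sup>2) * norm (bump_hat y)) \<le> norm (2 * (C0 + C4) * inverse (1 + y\<^sup>2))"
      by blast
  qed measurable
  show "integrable lborel (\<lambda>y. norm (bump_hat y))"
    by (rule Bochner_Integration.integrable_bound[OF 1]) (auto simp: algebra_simps)
qed

text \<open>A rescaling of the characteristic function of the standard normal distribution, with
  \<open>c\<close> chosen so that (c y)^2/2 = \<tau> y^2.\<close>

lemma integrable_gaussian: "0 < \<tau> \<Longrightarrow> integrable lborel (\<lambda>y::real. exp (- \<tau> * y\<^sup>2))"
  and fourier_gaussian: "0 < \<tau> \<Longrightarrow> (LINT y|lborel. cis (a * y) * complex_of_real (exp (- \<tau> * y\<^sup>2)))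
     = complex_of_real (sqrt (pi / \<tau>) * exp (- a\<^sup>2 / (4 * \<tau>)))"
proof -
  assume \<tau>: "0 < \<tau>"
  define c where "c = sqrt (2 * \<tau>)"
  have c: "0 < c" "c\<^sup>2 = 2 * \<tau>" using \<tau> by (auto simp: c_def)
  have e: "(c * y)\<^sup>2 / 2 = \<tau> * y\<^sup>2" for y using c by (simp add: power_mult_distrib)
  have "integrable lborel (\<lambda>y. sqrt (2 * pi) * std_normal_density (0 + c * y))"
    using c integrable_normal_density[of 1 0] by (intro integrable_mult_right lborel_integrable_real_affine) auto
  then show "integrable lborel (\<lambda>y::real. exp (- \<tau> * y\<^sup>2))"
    by (simp add: std_normal_density_def e)
  have "complex_of_real (exp (- ((a / c)\<^sup>2) / 2)) = (LINT x|std_normal_distribution. iexp (a / c * x))"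
    using char_std_normal_distribution by (metis char_def)
  also have "\<dots> = (LINT x|lborel. std_normal_density x *\<^sub>R iexp (a / c * x))"
    by (subst integral_density) auto
  also have "\<dots> = c *\<^sub>R (LINT y|lborel. std_normal_density (0 + c * y) *\<^sub>R iexp (a / c * (0 + c * y)))"
    using c by (subst lborel_integral_real_affine[where c=c and t=0]) auto
  also have "(\<lambda>y. std_normal_density (0 + c * y) *\<^sub>R iexp (a / c * (0 + c * y)))
      = (\<lambda>y. complex_of_real (1 / sqrt (2 * pi)) * (cis (a * y) * complex_of_real (exp (- \<tau> * y\<^sup>2))))"
    using c(1) by (simp add: std_normal_density_def e cis_conv_exp scaleR_conv_of_real mult.assoc mult.left_commute) (simp add: mult_ac)
  finally have "complex_of_real (exp (- ((a / c)\<^sup>2) / 2))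
      = complex_of_real (c / sqrt (2 * pi)) * (LINT y|lborel. cis (a * y) * complex_of_real (exp (- \<tau> * y\<^sup>2)))"
    by (simp add: scaleR_conv_of_real)
  then have "(LINT y|lborel. cis (a * y) * complex_of_real (exp (- \<tau> * y\<^sup>2)))
      = complex_of_real (sqrt (2 * pi) / c * exp (- ((a / c)\<^sup>2) / 2))"
    using c(1) by (simp add: field_simps)
  moreover have "sqrt (2 * pi) / c = sqrt (pi / \<tau>)" by (simp add: c_def flip: real_sqrt_divide)
  moreover have "- ((a / c)\<^sup>2) / 2 = - a\<^sup>2 / (4 * \<tau>)" by (simp add: power_divide c(2))
  ultimately show "(LINT y|lborel. cis (a * y) * complex_of_real (exp (- \<tau> * y\<^sup>2)))
     = complex_of_real (sqrt (pi / \<tau>) * exp (- a\<^sup>2 / (4 * \<tau>)))" by simp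
qed

text \<open>This is 2 pi times the heat evolution of \<open>bump\<close> at time \<tau>: the heat
  kernel is (4 pi \<tau>)^(-1/2) exp(-x^2/(4 \<tau>)), and the one-dimensional inverse transforms
  are taken without the factor 1/(2 pi).\<close>

definition heat_bump :: "real \<Rightarrow> real \<Rightarrow> real" where
  "heat_bump \<tau> x = (LINT z|lborel. bump z * (sqrt (pi / \<tau>) * exp (- (x - z)\<^sup>2 / (4 * \<tau>))))"

text \<open>Fourier inversion for the bump smoothed by the heat flow. The Gaussian makes the double
  integral absolutely convergent, and exchanging the integrals leaves the explicit transform of a
  Gaussian.\<close>

lemma inverse_fourier_heat_bump:
  assumes \<tau>: "0 < \<tau>"
  shows "(LINT y|lborel. cis (x * y) * bump_hat y * complex_of_real (exp (- \<tau> * y\<^sup>2)))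
    = complex_of_real (heat_bump \<tau> x)"
proof -
  let ?f = "\<lambda>(y::real) z::real. cis ((x - z) * y) * complex_of_real (exp (- \<tau> * y\<^sup>2)) * complex_of_real (bump z)"
  have "integrable (lborel \<Otimes>\<^sub>M lborel) (\<lambda>(y, z). ?f y z)"
  proof (rule lborel_pair.Fubini_integrable)
    show "integrable lborel (\<lambda>y. LINT z|lborel. norm (case (y, z) of (y, z) \<Rightarrow> ?f y z))"
      using integrable_gaussian[OF \<tau>] by (simp add: norm_mult bump_nonneg)
    show "AE y in lborel. integrable lborel (\<lambda>z. case (y, z) of (y, z) \<Rightarrow> ?f y z)"
    proof (rule AE_I2)
      fix y
      have "integrable lborel (\<lambda>z. ?f y z)"
        by (rule Bochner_Integration.integrable_bound[OF integrable_bump])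
          (auto simp: norm_mult bump_nonneg mult_left_le_one_le \<tau> less_imp_le)
      then show "integrable lborel (\<lambda>z. case (y, z) of (y, z) \<Rightarrow> ?f y z)" by simp
    qed
  qed measurable
  from lborel_pair.Fubini_integral[OF this]
  have "(LINT y|lborel. LINT z|lborel. ?f y z) = (LINT z|lborel. LINT y|lborel. ?f y z)" by simp
  also have "\<dots> = (LINT z|lborel. complex_of_real (bump z * (sqrt (pi / \<tau>) * exp (- (x - z)\<^sup>2 / (4 * \<tau>)))))"
    by (rule Bochner_Integration.integral_cong[OF refl])
      (simp only: integral_mult_right_zero fourier_gaussian[OF \<tau>] of_real_mult mult.commute[of _ "complex_of_real (bump _)"])
  also have "\<dots> = complex_of_real (heat_bump \<tau> x)" by (simp only: integral_complex_of_real heat_bump_def)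
  finally have "(LINT y|lborel. LINT z|lborel. ?f y z) = complex_of_real (heat_bump \<tau> x)" .
  moreover have "(LINT z|lborel. ?f y z) = cis (x * y) * bump_hat y * complex_of_real (exp (- \<tau> * y\<^sup>2))" for y
  proof -
    have "?f y z = cis (x * y) * complex_of_real (exp (- \<tau> * y\<^sup>2)) * (cis (- (y * z)) * complex_of_real (bump z))" for z
    proof -
      have "cis ((x - z) * y) = cis (x * y) * cis (- (y * z))" by (simp add: cis_mult algebra_simps)
      then show ?thesis by (simp only: mult_ac)
    qed
    then have "(LINT z|lborel. ?f y z) = cis (x * y) * complex_of_real (exp (- \<tau> * y\<^sup>2)) * bump_hat y"
      unfolding bump_hat_def by (simp only: integral_mult_right_zero)
    then show ?thesis by (simp only: mult_ac)
  qed
  ultimately show ?thesis by simp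
qed

lemma integrable_heat_bump_kernel:
  assumes "0 < \<tau>"
  shows "integrable lborel (\<lambda>z. bump z * (sqrt (pi / \<tau>) * exp (- (x - z)\<^sup>2 / (4 * \<tau>))))"
proof (rule Bochner_Integration.integrable_bound[OF integrable_mult_left[OF integrable_bump, of "sqrt (pi / \<tau>)"]])
  have "bump z * (sqrt (pi / \<tau>) * exp (- (x - z)\<^sup>2 / (4 * \<tau>))) \<le> bump z * (sqrt (pi / \<tau>) * 1)" for z
    using assms by (intro mult_left_mono) (auto simp: bump_nonneg)
  then show "AE z in lborel. norm (bump z * (sqrt (pi / \<tau>) * exp (- (x - z)\<^sup>2 / (4 * \<tau>))))
      \<le> norm (bump z * sqrt (pi / \<tau>))"
    using assms by (auto simp: abs_mult bump_nonneg)
qed measurable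

lemma heat_bump_nonneg: "0 < \<tau> \<Longrightarrow> 0 \<le> heat_bump \<tau> x"
  unfolding heat_bump_def by (intro Bochner_Integration.integral_nonneg) (auto simp: bump_nonneg)

lemma heat_bump_measurable [measurable]: "(\<lambda>\<tau>. heat_bump \<tau> x) \<in> borel_measurable borel"
  unfolding heat_bump_def[abs_def] by measurable

text \<open>\<open>m\<close> is a lower bound for the squared distance from x to points of the
  support, and the factor 2 is the length of [-1, 1]. A negative \<open>m\<close> is allowed and
  does occur for small coordinates.\<close>

lemma heat_bump_le:
  assumes \<tau>: "0 < \<tau>" and m: "\<And>z. \<bar>z\<bar> \<le> 1 \<Longrightarrow> m \<le> (x - z)\<^sup>2"
  shows "heat_bump \<tau> x \<le> 2 * sqrt (pi / \<tau>) * exp (- m / (4 * \<tau>))"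
proof -
  have "heat_bump \<tau> x \<le> (LINT z|lborel. indicator {-1..1::real} z * (sqrt (pi / \<tau>) * exp (- m / (4 * \<tau>))))"
    unfolding heat_bump_def
  proof (rule integral_mono[OF integrable_heat_bump_kernel[OF \<tau>]])
    fix z
    show "bump z * (sqrt (pi / \<tau>) * exp (- (x - z)\<^sup>2 / (4 * \<tau>)))
        \<le> indicator {-1..1} z * (sqrt (pi / \<tau>) * exp (- m / (4 * \<tau>)))"
    proof (cases "\<bar>z\<bar> \<le> 1")
      case True
      then have "bump z * (sqrt (pi / \<tau>) * exp (- (x - z)\<^sup>2 / (4 * \<tau>)))
          \<le> 1 * (sqrt (pi / \<tau>) * exp (- m / (4 * \<tau>)))"
        using \<tau> m[OF True] by (intro mult_mono) (auto simp: bump_nonneg bump_le_1 divide_right_mono)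
      then show ?thesis using True by (auto simp: indicator_def)
    qed (use \<tau> in \<open>auto simp: bump_eq_0\<close>)
  qed auto
  then show ?thesis by simp
qed

lemma integral_bump_ge: "exp (- 4) \<le> (LINT z|lborel. bump z)"
proof -
  have "(LINT z|lborel. indicator {- (1/2)..1/2::real} z * exp (- 4)) \<le> (LINT z|lborel. bump z)"
    by (rule integral_mono[OF _ integrable_bump])
      (auto simp: bump_nonneg bump_ge split: split_indicator)
  then show ?thesis by simp
qed

lemma heat_bump_ge:
  assumes \<tau>: "0 < \<tau>" and m: "\<And>z. \<bar>z\<bar> \<le> 1 \<Longrightarrow> (x - z)\<^sup>2 \<le> m"
  shows "exp (- 4) * (sqrt (pi / \<tau>) * exp (- m / (4 * \<tau>))) \<le> heat_bump \<tau> x"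
proof -
  have "exp (- 4) * (sqrt (pi / \<tau>) * exp (- m / (4 * \<tau>)))
      \<le> (LINT z|lborel. bump z) * (sqrt (pi / \<tau>) * exp (- m / (4 * \<tau>)))"
    using \<tau> by (intro mult_right_mono integral_bump_ge) auto
  also have "\<dots> = (LINT z|lborel. bump z * (sqrt (pi / \<tau>) * exp (- m / (4 * \<tau>))))"
    by simp
  also have "\<dots> \<le> heat_bump \<tau> x"
    unfolding heat_bump_def
  proof (rule integral_mono[OF _ integrable_heat_bump_kernel[OF \<tau>]])
    fix z
    show "bump z * (sqrt (pi / \<tau>) * exp (- m / (4 * \<tau>)))
        \<le> bump z * (sqrt (pi / \<tau>) * exp (- (x - z)\<^sup>2 / (4 * \<tau>)))"
    proof (cases "\<bar>z\<bar> \<le> 1")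
      case True
      then show ?thesis
        using \<tau> m[OF True] by (intro mult_left_mono) (auto simp: bump_nonneg divide_right_mono)
    qed (auto simp: bump_eq_0)
  qed (auto intro: integrable_mult_left integrable_bump)
  finally show ?thesis .
qed

text \<open>Fourier inversion at a point where \<open>bump\<close> is 0. Damping by exp(-\<tau> y^2)
  turns the integral into \<open>heat_bump \<tau> x\<close>, whose bound contains exp(-d/(4 \<tau>))
  with d > 0 and so tends to 0 with \<tau>.\<close>

lemma inverse_fourier_bump_hat_eq_0:
  assumes x: "1 < \<bar>x\<bar>"
  shows "(LINT y|lborel. cis (x * y) * bump_hat y) = 0"
proof -
  define d where "d = (\<bar>x\<bar> - 1)\<^sup>2"
  have d: "0 < d" using x by (simp add: d_def)
  have d_le: "d \<le> (x - z)\<^sup>2" if "\<bar>z\<bar> \<le> 1" for z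
  proof -
    have "\<bar>\<bar>x\<bar> - 1\<bar> \<le> \<bar>x - z\<bar>" using that x by linarith
    then show ?thesis unfolding d_def by (metis abs_le_square_iff)
  qed
  let ?t = "\<lambda>n. inverse (real (Suc n))"
  have "(\<lambda>n. LINT y|lborel. cis (x * y) * bump_hat y * complex_of_real (exp (- ?t n * y\<^sup>2)))
      \<longlonglongrightarrow> (LINT y|lborel. cis (x * y) * bump_hat y)"
  proof (rule integral_dominated_convergence[where w="\<lambda>y. norm (bump_hat y)"])
    show "AE y in lborel. (\<lambda>n. cis (x * y) * bump_hat y * complex_of_real (exp (- ?t n * y\<^sup>2)))
        \<longlonglongrightarrow> cis (x * y) * bump_hat y"
    proof (rule AE_I2)
      fix y
      have "(\<lambda>n. cis (x * y) * bump_hat y * complex_of_real (exp (- ?t n * y\<^sup>2)))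
        \<longlonglongrightarrow> cis (x * y) * bump_hat y * complex_of_real (exp (- 0 * y\<^sup>2))"
        by (intro tendsto_intros LIMSEQ_inverse_real_of_nat)
      then show "(\<lambda>n. cis (x * y) * bump_hat y * complex_of_real (exp (- ?t n * y\<^sup>2)))
        \<longlonglongrightarrow> cis (x * y) * bump_hat y" by simp
    qed
    show "AE y in lborel. norm (cis (x * y) * bump_hat y * complex_of_real (exp (- ?t n * y\<^sup>2)))
        \<le> norm (bump_hat y)" for n
    proof (rule AE_I2)
      fix y
      have "exp (- ?t n * y\<^sup>2) \<le> 1" by (simp del: of_nat_Suc)
      then show "norm (cis (x * y) * bump_hat y * complex_of_real (exp (- ?t n * y\<^sup>2))) \<le> norm (bump_hat y)"
        by (simp add: norm_mult mult_left_le del: of_nat_Suc)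
    qed
  qed (use integrable_bump_hat in \<open>auto intro!: borel_measurable_times\<close>)
  moreover have "(LINT y|lborel. cis (x * y) * bump_hat y * complex_of_real (exp (- ?t n * y\<^sup>2)))
      = complex_of_real (heat_bump (?t n) x)" for n
    by (rule inverse_fourier_heat_bump) simp
  ultimately have "(\<lambda>n. complex_of_real (heat_bump (?t n) x)) \<longlonglongrightarrow> (LINT y|lborel. cis (x * y) * bump_hat y)"
    by simp
  moreover have "(\<lambda>n. heat_bump (?t n) x) \<longlonglongrightarrow> 0"
  proof (rule tendsto_sandwich[OF _ _ tendsto_const])
    show "(\<lambda>n. 2 * sqrt (pi * real (Suc n)) * exp (- d * real (Suc n) / 4)) \<longlonglongrightarrow> 0"
      using d by real_asymp
    have "heat_bump (?t n) x \<le> 2 * sqrt (pi / ?t n) * exp (- d / (4 * ?t n))" for n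
      by (rule heat_bump_le) (use d_le in auto)
    then show "\<forall>\<^sub>F n in sequentially. heat_bump (?t n) x \<le> 2 * sqrt (pi * real (Suc n)) * exp (- d * real (Suc n) / 4)"
      by (simp add: field_simps)
    show "\<forall>\<^sub>F n in sequentially. 0 \<le> heat_bump (?t n) x"
      by (simp add: heat_bump_nonneg)
  qed
  then have "(\<lambda>n. complex_of_real (heat_bump (?t n) x)) \<longlonglongrightarrow> complex_of_real 0"
    by (rule tendsto_of_real)
  ultimately show ?thesis using LIMSEQ_unique of_real_0 by metis
qed

section \<open>Integrals of the subordination formula\<close>

lemma integrable_powr_at_infinity:
  assumes "a < -1"
  shows "integrable lborel (\<lambda>x::real. indicator {1..} x * x powr a)"
proof -
  have "(\<lambda>x::real. x powr a) absolutely_integrable_on {1..}"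
    by (rule nonnegative_absolutely_integrable_1)
      (use has_integral_powr_to_inf[OF assms, of 1] in \<open>auto simp: integrable_on_def\<close>)
  then show ?thesis unfolding set_integrable_def by (subst (asm) integrable_completion) auto
qed

lemma integrable_powr_near_0:
  assumes "-1 < a"
  shows "integrable lborel (\<lambda>x::real. indicator {0..1} x * x powr a)"
  using set_integrable_lborel_powr(1)[of a 1] assms by (simp add: set_integrable_def)

text \<open>
  The constant \<open>c\<close> in the subordination formula
  \<open>c \<bar>\<xi>\<bar>\<^sup>2\<^sup>s = \<integral>\<^sub>0\<^sup>\<infinity> (1 - exp (- \<tau> \<bar>\<xi>\<bar>\<^sup>2)) \<tau>\<^sup>-\<^sup>1\<^sup>-\<^sup>s d\<tau>\<close>.
\<close>
definition levy_const :: "real \<Rightarrow> real" where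
  "levy_const s = (LINT \<tau>|lborel. indicator {0<..} \<tau> * ((1 - exp (- \<tau>)) * \<tau> powr (- 1 - s)))"

lemma levy_integral_unit:
  assumes s: "0 < s" "s < 1"
  shows "integrable lborel (\<lambda>\<tau>::real. indicator {0<..} \<tau> * ((1 - exp (- \<tau>)) * \<tau> powr (- 1 - s)))"
    and "0 < levy_const s"
proof -
  \<comment> \<open>1 - exp(-\<tau>) is at most \<tau>, used near 0, and at most 1, used at
    infinity; the two majorants are integrable because s < 1 and s > 0 respectively.\<close>
  have bound: "indicator {0<..} \<tau> * ((1 - exp (- \<tau>)) * \<tau> powr (- 1 - s))
      \<le> indicator {0..1} \<tau> * \<tau> powr (- s) + indicator {1..} \<tau> * \<tau> powr (- 1 - s)" for \<tau> :: real
  proof -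
    have "(1 - exp (- \<tau>)) * \<tau> powr (- 1 - s) \<le> \<tau> powr (- s)" if "0 < \<tau>"
    proof -
      have "(1 - exp (- \<tau>)) * \<tau> powr (- 1 - s) \<le> \<tau> * \<tau> powr (- 1 - s)"
        using exp_ge_add_one_self[of "- \<tau>"] by (intro mult_right_mono) auto
      also have "\<dots> = \<tau> powr (- s)"
        using that by (simp add: powr_mult_base)
      finally show ?thesis .
    qed
    moreover have "(1 - exp (- \<tau>)) * \<tau> powr (- 1 - s) \<le> \<tau> powr (- 1 - s)"
      using mult_right_mono[of "1 - exp (- \<tau>)" 1 "\<tau> powr (- 1 - s)"] by simp
    \<comment> \<open>For \<tau> = 1, where both indicators on the right are 1.\<close>
    moreover have "- 1 \<le> exp (- 1 :: real)" using exp_gt_zero[of "- 1 :: real"] by linarith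
    ultimately show ?thesis by (auto simp: indicator_def)
  qed
  have nonneg: "0 \<le> indicator {0<..} \<tau> * ((1 - exp (- \<tau>)) * \<tau> powr (- 1 - s))" for \<tau> :: real
    by (cases "0 < \<tau>") simp_all
  show I: "integrable lborel (\<lambda>\<tau>::real. indicator {0<..} \<tau> * ((1 - exp (- \<tau>)) * \<tau> powr (- 1 - s)))"
  proof (rule Bochner_Integration.integrable_bound)
    show "integrable lborel (\<lambda>\<tau>::real. indicator {0..1} \<tau> * \<tau> powr (- s) + indicator {1..} \<tau> * \<tau> powr (- 1 - s))"
      using s by (intro Bochner_Integration.integrable_add integrable_powr_near_0 integrable_powr_at_infinity) auto
    show "AE \<tau> in lborel. norm (indicator {0<..} \<tau> * ((1 - exp (- \<tau>)) * \<tau> powr (- 1 - s)))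
        \<le> norm (indicator {0..1} \<tau> * \<tau> powr (- s) + indicator {1..} \<tau> * \<tau> powr (- 1 - s))"
      using order_trans[OF bound abs_ge_self] by (intro AE_I2) (simp only: real_norm_def abs_of_nonneg[OF nonneg])
  qed measurable
  have "(LINT \<tau>|lborel. indicator {1..2::real} \<tau> * ((1 - exp (- 1)) * 2 powr (- 1 - s))) \<le> levy_const s" (is "?A \<le> _")
    unfolding levy_const_def
  proof (rule integral_mono[OF _ I])
    fix \<tau> :: real
    have "(1 - exp (- 1)) * 2 powr (- 1 - s) \<le> (1 - exp (- \<tau>)) * \<tau> powr (- 1 - s)" if "1 \<le> \<tau>" "\<tau> \<le> 2"
      using that s by (intro mult_mono powr_mono2') auto
    then show "indicator {1..2::real} \<tau> * ((1 - exp (- 1)) * 2 powr (- 1 - s))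
      \<le> indicator {0<..} \<tau> * ((1 - exp (- \<tau>)) * \<tau> powr (- 1 - s))"
      using nonneg[of \<tau>] by (auto simp: indicator_def)
  qed auto
  moreover have "?A = (1 - exp (- 1 :: real)) * 2 powr (- 1 - s)" by simp
  moreover have "0 < (1 - exp (- 1 :: real)) * 2 powr (- 1 - s)" by simp
  ultimately show "0 < levy_const s" by linarith
qed

text \<open>Replacing \<tau> by r^2 \<tau> reduces to r = 1. For r = 0 both sides are 0, since
  \<open>0 powr (2 * s) = 0\<close>.\<close>

lemma levy_integral:
  fixes r :: real
  assumes s: "0 < s" "s < 1" and r: "0 \<le> r"
  shows "integrable lborel (\<lambda>\<tau>::real. indicator {0<..} \<tau> * ((1 - exp (- \<tau> * r\<^sup>2)) * \<tau> powr (- 1 - s)))"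
    and "(LINT \<tau>|lborel. indicator {0<..} \<tau> * ((1 - exp (- \<tau> * r\<^sup>2)) * \<tau> powr (- 1 - s)))
      = levy_const s * r powr (2 * s)"
proof -
  let ?f = "\<lambda>\<tau>::real. indicator {0<..} \<tau> * ((1 - exp (- \<tau>)) * \<tau> powr (- 1 - s))"
  let ?g = "\<lambda>\<tau>::real. indicator {0<..} \<tau> * ((1 - exp (- \<tau> * r\<^sup>2)) * \<tau> powr (- 1 - s))"
  have "integrable lborel ?g \<and> (LINT \<tau>|lborel. ?g \<tau>) = levy_const s * r powr (2 * s)"
  proof (cases "r = 0")
    case False
    then have r: "0 < r" using r by simp
    have eq: "?f (0 + r\<^sup>2 * \<tau>) = (r\<^sup>2) powr (- 1 - s) * ?g \<tau>" for \<tau>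
      using r by (auto simp: indicator_def powr_mult zero_less_mult_iff mult.commute)
    have "integrable lborel (\<lambda>\<tau>. ?f (0 + r\<^sup>2 * \<tau>))"
      using r levy_integral_unit(1)[OF s] by (intro lborel_integrable_real_affine) auto
    then have I: "integrable lborel ?g" using r by (simp only: eq) simp
    have "levy_const s = \<bar>r\<^sup>2\<bar> *\<^sub>R (LINT \<tau>|lborel. ?f (0 + r\<^sup>2 * \<tau>))"
      unfolding levy_const_def using r by (subst lborel_integral_real_affine[where c="r\<^sup>2" and t=0]) auto
    also have "\<dots> = (r\<^sup>2 * (r\<^sup>2) powr (- 1 - s)) * (LINT \<tau>|lborel. ?g \<tau>)"
      by (simp only: eq integral_mult_right_zero) simp
    also have "r\<^sup>2 * (r\<^sup>2) powr (- 1 - s) = r powr (- 2 * s)"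
      using r by (simp add: powr_powr flip: powr_numeral powr_add)
    finally have "levy_const s = r powr (- 2 * s) * (LINT \<tau>|lborel. ?g \<tau>)" .
    then have "levy_const s * r powr (2 * s) = (r powr (- 2 * s) * r powr (2 * s)) * (LINT \<tau>|lborel. ?g \<tau>)"
      by (simp only: mult_ac)
    also have "r powr (- 2 * s) * r powr (2 * s) = 1"
      using r by (simp flip: powr_add)
    finally have "levy_const s * r powr (2 * s) = (LINT \<tau>|lborel. ?g \<tau>)" by simp
    with I show ?thesis by simp
  qed simp
  then show "integrable lborel ?g" "(LINT \<tau>|lborel. ?g \<tau>) = levy_const s * r powr (2 * s)" by auto
qed

text \<open>The inverse Gamma density without its normalisation. The integral on the right is
  Gamma(a); it serves as a constant that does not depend on k.\<close>

lemma integrable_inverse_gamma_density: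
  assumes a: "0 < a" and k: "0 < k"
  shows "integrable lborel (\<lambda>\<tau>::real. indicator {0<..} \<tau> * (\<tau> powr (- a - 1) * exp (- k / \<tau>)))" (is ?I)
    and "(LINT \<tau>|lborel. indicator {0<..} \<tau> * (\<tau> powr (- a - 1) * exp (- k / \<tau>)))
      = k powr (- a) * (LINT \<tau>|lborel. indicator {0<..} \<tau> * (\<tau> powr (- a - 1) * exp (- 1 / \<tau>)))" (is ?E)
proof -
  let ?f = "\<lambda>\<tau>::real. indicator {0<..} \<tau> * (\<tau> powr (- a - 1) * exp (- 1 / \<tau>))"
  let ?g = "\<lambda>\<tau>::real. indicator {0<..} \<tau> * (\<tau> powr (- a - 1) * exp (- k / \<tau>))"
  \<comment> \<open>The function \<tau>^(-a-1) exp(-1/\<tau>) is largest at \<tau> = 1/(a + 1);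
    \<open>B\<close> is that maximum without its factor exp(-(a + 1)).\<close>
  define B where "B = (a + 1) powr (a + 1)"
  have small: "\<tau> powr (- a - 1) * exp (- 1 / \<tau>) \<le> B" if \<tau>: "0 < \<tau>" for \<tau> :: real
  proof -
    have "ln (1 / (\<tau> * (a + 1))) \<le> 1 / (\<tau> * (a + 1)) - 1"
      using \<tau> a by (intro ln_le_minus_one) auto
    then have "- ln \<tau> - ln (a + 1) \<le> 1 / (\<tau> * (a + 1)) - 1"
      using \<tau> a by (simp add: ln_div ln_mult)
    then have "(a + 1) * (- ln \<tau> - ln (a + 1)) \<le> (a + 1) * (1 / (\<tau> * (a + 1)) - 1)"
      using a by (intro mult_left_mono) auto
    also have "\<dots> \<le> 1 / \<tau>" using \<tau> a by (simp add: field_simps)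
    finally have "(- a - 1) * ln \<tau> - 1 / \<tau> \<le> (a + 1) * ln (a + 1)"
      by (simp add: algebra_simps)
    then have "exp ((- a - 1) * ln \<tau> - 1 / \<tau>) \<le> exp ((a + 1) * ln (a + 1))" by simp
    then show ?thesis using \<tau> a by (simp add: B_def powr_def flip: exp_add)
  qed
  have bound: "norm (?f \<tau>) \<le> norm (indicator {0..1} \<tau> * B + indicator {1..} \<tau> * \<tau> powr (- a - 1))" for \<tau> :: real
  proof -
    have "\<tau> powr (- a - 1) * exp (- 1 / \<tau>) \<le> \<tau> powr (- a - 1)" if "0 < \<tau>"
      using that by (simp add: mult_left_le)
    moreover have "0 \<le> B" by (simp add: B_def)
    ultimately show ?thesis using small[of \<tau>] by (auto simp: indicator_def)
  qed
  have If: "integrable lborel ?f"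
  proof (rule Bochner_Integration.integrable_bound)
    show "integrable lborel (\<lambda>\<tau>. indicator {0..1} \<tau> * B + indicator {1..} \<tau> * \<tau> powr (- a - 1))"
      using a by (intro Bochner_Integration.integrable_add integrable_powr_at_infinity) auto
    show "AE \<tau> in lborel. norm (?f \<tau>) \<le> norm (indicator {0..1} \<tau> * B + indicator {1..} \<tau> * \<tau> powr (- a - 1))"
      using bound by blast
  qed measurable
  have eq: "?g (0 + k * \<tau>) = k powr (- a - 1) * ?f \<tau>" for \<tau>
    using k by (auto simp: indicator_def powr_mult zero_less_mult_iff)
  have "integrable lborel (\<lambda>\<tau>. ?g (0 + k * \<tau>))" using If by (simp only: eq) simp
  then show ?I using k lborel_integrable_real_affine_iff[of k ?g 0] by simp
  have "(LINT \<tau>|lborel. ?g \<tau>) = \<bar>k\<bar> *\<^sub>R (LINT \<tau>|lborel. ?g (0 + k * \<tau>))"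
    using k by (subst lborel_integral_real_affine[where c=k and t=0]) auto
  also have "\<dots> = (k * k powr (- a - 1)) * (LINT \<tau>|lborel. ?f \<tau>)"
    using k by (simp only: eq integral_mult_right_zero) simp
  also have "k * k powr (- a - 1) = k powr (- a)" using k by (simp add: powr_mult_base)
  finally show ?E .
qed

section \<open>The fractional Laplacian of a product bump\<close>

lemma
  fixes f :: "'a::euclidean_space \<Rightarrow> real \<Rightarrow> 'b::{real_normed_field,banach,second_countable_topology}"
  assumes "\<And>b. b \<in> Basis \<Longrightarrow> integrable lborel (f b)"
  shows integrable_lborel_prod: "integrable lborel (\<lambda>x. \<Prod>b\<in>Basis. f b (x \<bullet> b))"
    and integral_lborel_prod: "(LINT x|lborel. (\<Prod>b\<in>Basis. f b (x \<bullet> b))) = (\<Prod>b\<in>Basis. LINT y|lborel. f b y)"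
proof -
  interpret product_sigma_finite "\<lambda>_::'a. lborel :: real measure" ..
  let ?S = "\<lambda>g. \<Sum>b\<in>Basis. g b *\<^sub>R b :: 'a"
  have [measurable]: "\<And>b. b \<in> Basis \<Longrightarrow> f b \<in> borel_measurable borel"
    using assms borel_measurable_integrable by fastforce
  have S [measurable]: "?S \<in> measurable (\<Pi>\<^sub>M b\<in>Basis. lborel) borel" by measurable
  have eq: "(\<Prod>b\<in>Basis. f b (?S g \<bullet> b)) = (\<Prod>b\<in>Basis. f b (g b))" for g by simp
  have m: "(\<lambda>x::'a. \<Prod>b\<in>Basis. f b (x \<bullet> b)) \<in> borel_measurable borel" by measurable
  show "integrable lborel (\<lambda>x. \<Prod>b\<in>Basis. f b (x \<bullet> b))"
    using product_integrable_prod[OF finite_Basis, of f] assms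
    by (subst lborel_eq, subst integrable_distr_eq[OF S m]) (simp only: eq)
  show "(LINT x|lborel. (\<Prod>b\<in>Basis. f b (x \<bullet> b))) = (\<Prod>b\<in>Basis. LINT y|lborel. f b y)"
    using product_integral_prod[OF finite_Basis, of f] assms
    by (subst lborel_eq, subst integral_distr[OF S m]) (simp only: eq)
qed

lemma cis_sum: "finite A \<Longrightarrow> cis (\<Sum>a\<in>A. f a) = (\<Prod>a\<in>A. cis (f a))"
  by (induction A rule: finite_induct) (auto simp flip: cis_mult)

lemma one_plus_sum_le_prod:
  fixes f :: "'a \<Rightarrow> real"
  assumes "\<And>a. a \<in> A \<Longrightarrow> 0 \<le> f a"
  shows "1 + (\<Sum>a\<in>A. f a) \<le> (\<Prod>a\<in>A. 1 + f a)"
  using assms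
proof (induction A rule: infinite_finite_induct)
  case (insert a A)
  then have "0 \<le> f a * (\<Sum>a\<in>A. f a)" by (intro mult_nonneg_nonneg sum_nonneg) auto
  then have "1 + (f a + (\<Sum>a\<in>A. f a)) \<le> (1 + f a) * (1 + (\<Sum>a\<in>A. f a))"
    by (simp add: algebra_simps)
  also have "\<dots> \<le> (1 + f a) * (\<Prod>a\<in>A. 1 + f a)"
    using insert by (intro mult_left_mono insert.IH) (auto simp: add_nonneg_nonneg)
  finally show ?case using insert by simp
qed auto

text \<open>
  The product structure reduces every Fourier integral to one dimension.
\<close>
definition bump_prod :: "'a::euclidean_space \<Rightarrow> real" where
  "bump_prod x = (\<Prod>b\<in>Basis. bump (x \<bullet> b))"

lemma fourier_bump_prod:
  "fourier (\<lambda>y::real^'n. complex_of_real (bump_prod y)) \<xi> = (\<Prod>b\<in>Basis. bump_hat (\<xi> \<bullet> b))"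
proof -
  have "cis (- (\<xi> \<bullet> x)) * complex_of_real (bump_prod x)
      = (\<Prod>b\<in>Basis. cis (- ((\<xi> \<bullet> b) * (x \<bullet> b))) * complex_of_real (bump (x \<bullet> b)))" for x
    by (simp add: bump_prod_def prod.distrib euclidean_inner[of \<xi> x] cis_sum flip: sum_negf)
  then have "fourier (\<lambda>y. complex_of_real (bump_prod y)) \<xi>
      = (LINT x|lborel. (\<Prod>b\<in>Basis. cis (- ((\<xi> \<bullet> b) * (x \<bullet> b))) * complex_of_real (bump (x \<bullet> b))))"
    by (simp add: fourier_def)
  also have "\<dots> = (\<Prod>b\<in>Basis. LINT z|lborel. cis (- ((\<xi> \<bullet> b) * z)) * complex_of_real (bump z))"
  proof (rule integral_lborel_prod[of "\<lambda>b z. cis (- ((\<xi> \<bullet> b) * z)) * complex_of_real (bump z)"])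
    fix b
    show "integrable lborel (\<lambda>z. cis (- ((\<xi> \<bullet> b) * z)) * complex_of_real (bump z))"
      by (rule Bochner_Integration.integrable_bound[OF integrable_bump]) (auto simp: norm_mult)
  qed
  finally show ?thesis by (simp add: bump_hat_def)
qed

lemma power2_norm_eq_sum_Basis: "(norm x)\<^sup>2 = (\<Sum>b\<in>Basis. (x \<bullet> b)\<^sup>2)"
proof -
  have "(norm x)\<^sup>2 = x \<bullet> x" by (rule power2_norm_eq_inner)
  also have "\<dots> = (\<Sum>b\<in>Basis. (x \<bullet> b) * (x \<bullet> b))" by (rule euclidean_inner)
  finally show ?thesis by (simp only: power2_eq_square)
qed

text \<open>A majorant in product form, so that integrability against the transform of
  \<open>bump_prod\<close> becomes a question in one dimension.\<close>

lemma norm_powr_le_prod: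
  fixes \<xi> :: "'a::euclidean_space"
  assumes "0 < s" "s < 1"
  shows "norm \<xi> powr (2 * s) \<le> (\<Prod>b\<in>Basis. 1 + (\<xi> \<bullet> b)\<^sup>2)"
proof -
  have "norm \<xi> powr (2 * s) \<le> 1 + (norm \<xi>)\<^sup>2"
  proof (cases "norm \<xi> \<le> 1")
    case True
    then have "norm \<xi> powr (2 * s) \<le> 1" using assms by (intro powr_le1) auto
    then show ?thesis by (smt (verit) zero_le_power2)
  next
    case False
    then have "norm \<xi> powr (2 * s) \<le> norm \<xi> powr 2" using assms by (intro powr_mono) auto
    then show ?thesis using False by (simp add: powr_numeral)
  qed
  also have "\<dots> = 1 + (\<Sum>b\<in>Basis. (\<xi> \<bullet> b)\<^sup>2)"
    by (simp only: power2_norm_eq_sum_Basis)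
  also have "\<dots> \<le> (\<Prod>b\<in>Basis. 1 + (\<xi> \<bullet> b)\<^sup>2)" by (intro one_plus_sum_le_prod) auto
  finally show ?thesis .
qed

text \<open>The integrand of Fourier inversion for \<open>bump_prod\<close> at x, kept as a product
  over the coordinates.\<close>

definition bump_symbol :: "'a::euclidean_space \<Rightarrow> 'a \<Rightarrow> complex" where
  "bump_symbol x \<xi> = (\<Prod>b\<in>Basis. cis ((x \<bullet> b) * (\<xi> \<bullet> b)) * bump_hat (\<xi> \<bullet> b))"

lemma bump_symbol_measurable [measurable]: "bump_symbol x \<in> borel_measurable borel"
  unfolding bump_symbol_def[abs_def] by measurable

lemma norm_bump_symbol: "norm (bump_symbol x \<xi>) = (\<Prod>b\<in>Basis. norm (bump_hat (\<xi> \<bullet> b)))"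
  by (simp add: bump_symbol_def norm_mult flip: prod_norm)

lemma integrable_bump_symbol: "integrable lborel (bump_symbol x)"
  unfolding bump_symbol_def[abs_def]
proof (rule integrable_lborel_prod[of "\<lambda>b y. cis ((x \<bullet> b) * y) * bump_hat y"])
  fix b
  show "integrable lborel (\<lambda>y. cis ((x \<bullet> b) * y) * bump_hat y)"
    by (rule Bochner_Integration.integrable_bound[OF integrable_bump_hat(2)]) (auto simp: norm_mult)
qed

lemma integrable_weighted_bump_symbol:
  "integrable lborel (\<lambda>\<xi>::'a::euclidean_space. (\<Prod>b\<in>Basis. 1 + (\<xi> \<bullet> b)\<^sup>2) * (\<Prod>b\<in>Basis. norm (bump_hat (\<xi> \<bullet> b))))"
proof -
  have "integrable lborel (\<lambda>\<xi>::'a. \<Prod>b\<in>Basis. (1 + (\<xi> \<bullet> b)\<^sup>2) * norm (bump_hat (\<xi> \<bullet> b)))"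
    by (rule integrable_lborel_prod[of "\<lambda>b y. (1 + y\<^sup>2) * norm (bump_hat y)"]) (rule integrable_bump_hat(1))
  then show ?thesis by (simp add: prod.distrib)
qed

lemma integrable_powr_bump_symbol:
  fixes x :: "'a::euclidean_space"
  assumes "0 < s" "s < 1"
  shows "integrable lborel (\<lambda>\<xi>. norm \<xi> powr (2 * s) * norm (bump_symbol x \<xi>))"
proof (rule Bochner_Integration.integrable_bound[OF integrable_weighted_bump_symbol])
  show "AE \<xi> in lborel. norm (norm \<xi> powr (2 * s) * norm (bump_symbol x \<xi>))
      \<le> norm ((\<Prod>b\<in>Basis. 1 + (\<xi> \<bullet> b)\<^sup>2) * (\<Prod>b\<in>Basis. norm (bump_hat (\<xi> \<bullet> b))))"
    using norm_powr_le_prod[OF assms]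
    by (intro AE_I2) (auto simp: norm_bump_symbol abs_mult abs_prod intro!: mult_right_mono prod_nonneg)
qed measurable

lemma frac_laplacian_bump_prod:
  fixes x :: "real^'n"
  shows "frac_laplacian s bump_prod x =
    Re (LINT \<xi>|lborel. complex_of_real (norm \<xi> powr (2 * s)) * bump_symbol x \<xi>) / (2 * pi) ^ CARD('n)"
proof -
  have "cis (\<xi> \<bullet> x) * (complex_of_real (norm \<xi> powr (2 * s)) * (\<Prod>b\<in>Basis. bump_hat (\<xi> \<bullet> b)))
      = complex_of_real (norm \<xi> powr (2 * s)) * bump_symbol x \<xi>" for \<xi>
    by (simp add: bump_symbol_def prod.distrib euclidean_inner[of \<xi> x] cis_sum mult.commute[of "_ \<bullet> _" "x \<bullet> _"])
  then show ?thesis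
    unfolding frac_laplacian_def inverse_fourier_def fourier_bump_prod
    by (simp only: Re_complex_of_real times_complex.sel Im_complex_of_real) simp
qed

lemma frac_laplacian_bump_prod_bounded:
  fixes x :: "real^'n"
  assumes "0 < s" "s < 1"
  shows "\<bar>frac_laplacian s bump_prod x\<bar> \<le>
    (LINT \<xi>::real^'n|lborel. (\<Prod>b\<in>Basis. 1 + (\<xi> \<bullet> b)\<^sup>2) * (\<Prod>b\<in>Basis. norm (bump_hat (\<xi> \<bullet> b)))) / (2 * pi) ^ CARD('n)"
proof -
  have "\<bar>Re (LINT \<xi>|lborel. complex_of_real (norm \<xi> powr (2 * s)) * bump_symbol x \<xi>)\<bar>
      \<le> norm (LINT \<xi>|lborel. complex_of_real (norm \<xi> powr (2 * s)) * bump_symbol x \<xi>)"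
    by (rule abs_Re_le_cmod)
  also have "\<dots> \<le> (LINT \<xi>|lborel. norm (complex_of_real (norm \<xi> powr (2 * s)) * bump_symbol x \<xi>))"
    by (rule integral_norm_bound)
  also have "\<dots> = (LINT \<xi>|lborel. norm \<xi> powr (2 * s) * norm (bump_symbol x \<xi>))"
    by (simp add: norm_mult)
  also have "\<dots> \<le> (LINT \<xi>::real^'n|lborel. (\<Prod>b\<in>Basis. 1 + (\<xi> \<bullet> b)\<^sup>2) * (\<Prod>b\<in>Basis. norm (bump_hat (\<xi> \<bullet> b))))"
    using norm_powr_le_prod[OF assms]
    by (intro integral_mono integrable_powr_bump_symbol integrable_weighted_bump_symbol assms)
      (auto simp: norm_bump_symbol intro!: mult_right_mono prod_nonneg)
  finally show ?thesis unfolding frac_laplacian_bump_prod by (simp add: divide_right_mono)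
qed

text \<open>
  Outside the support of \<open>bump_prod\<close>, subordination turns the fractional Laplacian into the negative
  \<open>\<tau>\<close>-integral of this function, which can be bounded from both sides.
\<close>
definition heat_profile :: "real \<Rightarrow> 'a::euclidean_space \<Rightarrow> real \<Rightarrow> real" where
  "heat_profile s x \<tau> = indicator {0<..} \<tau> * (\<tau> powr (- 1 - s) * (\<Prod>b\<in>Basis. heat_bump \<tau> (x \<bullet> b)))"

text \<open>The two terms of 1 - exp(-\<tau> |\<xi>|^2) have divergent \<tau>-integrals separately,
  so the integrals are exchanged first and the difference is split at fixed \<tau>. The term 1 then
  vanishes by Fourier inversion off the support, and the other one gives the product of the heat
  evolutions.\<close>

lemma far_frac_laplacian_bump_prod:
  fixes x :: "real^'n"
  assumes s: "0 < s" "s < 1" and x: "\<exists>b\<in>Basis. 1 < \<bar>x \<bullet> b\<bar>"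
  shows "integrable lborel (heat_profile s x)"
    and "frac_laplacian s bump_prod x = - (LINT \<tau>|lborel. heat_profile s x \<tau>) / (levy_const s * (2 * pi) ^ CARD('n))"
proof -
  let ?k = "\<lambda>\<xi>::real^'n. \<lambda>\<tau>::real. indicator {0<..} \<tau> * ((1 - exp (- \<tau> * (norm \<xi>)\<^sup>2)) * \<tau> powr (- 1 - s))"
  let ?f = "\<lambda>\<xi> \<tau>. bump_symbol x \<xi> * complex_of_real (?k \<xi> \<tau>)"
  have k0: "0 \<le> ?k \<xi> \<tau>" for \<xi> \<tau> by (cases "0 < \<tau>") auto
  have I: "integrable (lborel \<Otimes>\<^sub>M lborel) (\<lambda>(\<xi>, \<tau>). ?f \<xi> \<tau>)"
  proof (rule lborel_pair.Fubini_integrable)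
    have "(LINT \<tau>|lborel. norm (?f \<xi> \<tau>)) = levy_const s * (norm \<xi> powr (2 * s) * norm (bump_symbol x \<xi>))" for \<xi>
    proof -
      have "(LINT \<tau>|lborel. norm (?f \<xi> \<tau>)) = (LINT \<tau>|lborel. norm (bump_symbol x \<xi>) * ?k \<xi> \<tau>)"
        by (rule Bochner_Integration.integral_cong[OF refl]) (simp only: norm_mult norm_of_real abs_of_nonneg[OF k0])
      then show ?thesis using levy_integral(2)[OF s, of "norm \<xi>"] by simp
    qed
    then show "integrable lborel (\<lambda>\<xi>. LINT \<tau>|lborel. norm (case (\<xi>, \<tau>) of (\<xi>, \<tau>) \<Rightarrow> ?f \<xi> \<tau>))"
      using integrable_powr_bump_symbol[OF s, of x] by simp
    show "AE \<xi> in lborel. integrable lborel (\<lambda>\<tau>. case (\<xi>, \<tau>) of (\<xi>, \<tau>) \<Rightarrow> ?f \<xi> \<tau>)"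
      using levy_integral(1)[OF s] by (intro AE_I2) (simp only: prod.case integrable_of_real integrable_mult_right norm_ge_zero)
  qed measurable
  have L: "(LINT \<tau>|lborel. ?f \<xi> \<tau>) = complex_of_real (levy_const s) * (complex_of_real (norm \<xi> powr (2 * s)) * bump_symbol x \<xi>)" for \<xi>
  proof -
    have "(LINT \<tau>|lborel. ?f \<xi> \<tau>) = bump_symbol x \<xi> * complex_of_real (LINT \<tau>|lborel. ?k \<xi> \<tau>)"
      by (simp only: integral_mult_right_zero integral_complex_of_real)
    also have "(LINT \<tau>|lborel. ?k \<xi> \<tau>) = levy_const s * norm \<xi> powr (2 * s)"
      by (rule levy_integral(2)[OF s norm_ge_zero])
    finally show ?thesis by (simp add: mult_ac)
  qed
  have R: "(LINT \<xi>|lborel. ?f \<xi> \<tau>) = complex_of_real (- heat_profile s x \<tau>)" for \<tau>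
  proof (cases "0 < \<tau>")
    case True
    have Ib: "integrable lborel (\<lambda>y. cis ((x \<bullet> b) * y) * bump_hat y)"
      "integrable lborel (\<lambda>y. cis ((x \<bullet> b) * y) * bump_hat y * complex_of_real (exp (- \<tau> * y\<^sup>2)))" for b
      by (rule Bochner_Integration.integrable_bound[OF integrable_bump_hat(2)];
        use True in \<open>auto simp: norm_mult mult_left_le\<close>)+
    have "(LINT \<xi>|lborel. bump_symbol x \<xi>) = (\<Prod>b\<in>Basis. LINT y|lborel. cis ((x \<bullet> b) * y) * bump_hat y)"
      unfolding bump_symbol_def using Ib
      by (intro integral_lborel_prod[of "\<lambda>b y. cis ((x \<bullet> b) * y) * bump_hat y"])
    \<comment> \<open>Some coordinate of x lies outside [-1, 1], and its factor alone is already
      0.\<close>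
    also have "\<dots> = 0"
      using x inverse_fourier_bump_hat_eq_0 by (auto intro!: prod_zero)
    finally have 0: "(LINT \<xi>|lborel. bump_symbol x \<xi>) = 0" .
    have e: "bump_symbol x \<xi> * complex_of_real (exp (- \<tau> * (norm \<xi>)\<^sup>2))
        = (\<Prod>b\<in>Basis. cis ((x \<bullet> b) * (\<xi> \<bullet> b)) * bump_hat (\<xi> \<bullet> b) * complex_of_real (exp (- \<tau> * (\<xi> \<bullet> b)\<^sup>2)))" for \<xi>
    proof -
      have "exp (- \<tau> * (norm \<xi>)\<^sup>2) = (\<Prod>b\<in>Basis. exp (- \<tau> * (\<xi> \<bullet> b)\<^sup>2))"
        by (simp add: power2_norm_eq_sum_Basis sum_distrib_left flip: exp_sum sum_negf)
      then show ?thesis by (simp add: bump_symbol_def prod.distrib)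
    qed
    have 1: "integrable lborel (\<lambda>\<xi>. bump_symbol x \<xi> * complex_of_real (exp (- \<tau> * (norm \<xi>)\<^sup>2)))"
      unfolding e using Ib
      by (intro integrable_lborel_prod[of "\<lambda>b y. cis ((x \<bullet> b) * y) * bump_hat y * complex_of_real (exp (- \<tau> * y\<^sup>2))"])
    have "(LINT \<xi>|lborel. bump_symbol x \<xi> * complex_of_real (exp (- \<tau> * (norm \<xi>)\<^sup>2)))
        = (\<Prod>b\<in>Basis. LINT y|lborel. cis ((x \<bullet> b) * y) * bump_hat y * complex_of_real (exp (- \<tau> * y\<^sup>2)))"
      unfolding e using Ib
      by (intro integral_lborel_prod[of "\<lambda>b y. cis ((x \<bullet> b) * y) * bump_hat y * complex_of_real (exp (- \<tau> * y\<^sup>2))"])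
    also have "\<dots> = complex_of_real (\<Prod>b\<in>Basis. heat_bump \<tau> (x \<bullet> b))"
      by (simp only: inverse_fourier_heat_bump[OF True] of_real_prod)
    finally have 2: "(LINT \<xi>|lborel. bump_symbol x \<xi> * complex_of_real (exp (- \<tau> * (norm \<xi>)\<^sup>2)))
        = complex_of_real (\<Prod>b\<in>Basis. heat_bump \<tau> (x \<bullet> b))" .
    have "(LINT \<xi>|lborel. ?f \<xi> \<tau>) = (LINT \<xi>|lborel. complex_of_real (\<tau> powr (- 1 - s)) *
        (bump_symbol x \<xi> - bump_symbol x \<xi> * complex_of_real (exp (- \<tau> * (norm \<xi>)\<^sup>2))))"
      using True by (intro Bochner_Integration.integral_cong[OF refl]) (simp add: algebra_simps)
    also have "\<dots> = complex_of_real (\<tau> powr (- 1 - s)) * (0 - complex_of_real (\<Prod>b\<in>Basis. heat_bump \<tau> (x \<bullet> b)))"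
      by (simp only: integral_mult_right_zero Bochner_Integration.integral_diff[OF integrable_bump_symbol 1] 0 2)
    finally show ?thesis using True by (simp add: heat_profile_def)
  qed (simp add: heat_profile_def)
  have "integrable lborel (\<lambda>\<tau>. LINT \<xi>|lborel. ?f \<xi> \<tau>)"
    using lborel_pair.integrable_snd[OF I] by simp
  then have "integrable lborel (\<lambda>\<tau>. Re (complex_of_real (- heat_profile s x \<tau>)))"
    unfolding R by (rule integrable_Re)
  then show "integrable lborel (heat_profile s x)" by simp
  have "complex_of_real (levy_const s) * (LINT \<xi>|lborel. complex_of_real (norm \<xi> powr (2 * s)) * bump_symbol x \<xi>)
      = (LINT \<xi>|lborel. LINT \<tau>|lborel. ?f \<xi> \<tau>)"
    unfolding L by (rule integral_mult_right_zero[symmetric])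
  also have "\<dots> = (LINT \<tau>|lborel. LINT \<xi>|lborel. ?f \<xi> \<tau>)"
    using lborel_pair.Fubini_integral[OF I] by simp
  also have "\<dots> = complex_of_real (- (LINT \<tau>|lborel. heat_profile s x \<tau>))"
    by (simp only: R integral_complex_of_real Bochner_Integration.integral_minus)
  finally have "Re (complex_of_real (levy_const s) * (LINT \<xi>|lborel. complex_of_real (norm \<xi> powr (2 * s)) * bump_symbol x \<xi>))
      = - (LINT \<tau>|lborel. heat_profile s x \<tau>)" by simp
  then have "levy_const s * Re (LINT \<xi>|lborel. complex_of_real (norm \<xi> powr (2 * s)) * bump_symbol x \<xi>)
      = - (LINT \<tau>|lborel. heat_profile s x \<tau>)"
    by simp
  then show "frac_laplacian s bump_prod x = - (LINT \<tau>|lborel. heat_profile s x \<tau>) / (levy_const s * (2 * pi) ^ CARD('n))"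
    using levy_integral_unit(2)[OF s] unfolding frac_laplacian_bump_prod by (simp add: field_simps)
qed

lemma bump_prod_measurable [measurable]: "bump_prod \<in> borel_measurable borel"
  unfolding bump_prod_def[abs_def] by measurable

section \<open>Behaviour under dilations\<close>

lemma lborel_integral_scaleR:
  fixes f :: "'a::euclidean_space \<Rightarrow> 'b::{banach,second_countable_topology}"
  assumes c: "0 < c" and [measurable]: "f \<in> borel_measurable borel"
  shows "(LINT x|lborel. f x) = c ^ DIM('a) *\<^sub>R (LINT x|lborel. f (c *\<^sub>R x))"
proof -
  have "(LINT x|lborel. f x)
      = (LINT x|density (distr lborel borel (\<lambda>x. 0 + c *\<^sub>R x)) (\<lambda>_. \<bar>c\<bar> ^ DIM('a)). f x)"
    using c by (subst lborel_affine[of c 0]) auto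
  also have "\<dots> = c ^ DIM('a) *\<^sub>R (LINT x|lborel. f (c *\<^sub>R x))"
    using c by (subst integral_density) (auto simp: integral_distr)
  finally show ?thesis .
qed

lemma fourier_measurable [measurable]:
  fixes f :: "real^'n \<Rightarrow> complex"
  assumes [measurable]: "f \<in> borel_measurable borel"
  shows "fourier f \<in> borel_measurable borel"
  unfolding fourier_def[abs_def] by measurable

text \<open>The factor \<rho>^N of the transform cancels against the Jacobian of the inverse
  transform, and homogeneity of the symbol leaves \<rho>^(-2s). The change of variables also
  respects the default value 0 of divergent integrals, so measurability is enough.\<close>

lemma frac_laplacian_scale:
  fixes f :: "real^'n \<Rightarrow> real"
  assumes \<rho>: "0 < \<rho>" and [measurable]: "f \<in> borel_measurable borel"
  shows "frac_laplacian s (\<lambda>y. e * f ((1 / \<rho>) *\<^sub>R y)) x = e * \<rho> powr (- 2 * s) * frac_laplacian s f ((1 / \<rho>) *\<^sub>R x)"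
proof -
  let ?F = "fourier (\<lambda>y. complex_of_real (f y))"
  have F: "fourier (\<lambda>y. complex_of_real (e * f ((1 / \<rho>) *\<^sub>R y))) \<xi>
      = complex_of_real (e * \<rho> ^ CARD('n)) * ?F (\<rho> *\<^sub>R \<xi>)" for \<xi>
  proof -
    have "fourier (\<lambda>y. complex_of_real (e * f ((1 / \<rho>) *\<^sub>R y))) \<xi>
        = complex_of_real e * (LINT y|lborel. cis (- (\<xi> \<bullet> y)) * complex_of_real (f ((1 / \<rho>) *\<^sub>R y)))"
      unfolding fourier_def by (simp only: of_real_mult mult.left_commute integral_mult_right_zero)
    also have "\<dots> = complex_of_real e * (\<rho> ^ CARD('n) *\<^sub>R (LINT y|lborel. cis (- (\<xi> \<bullet> (\<rho> *\<^sub>R y))) * complex_of_real (f ((1 / \<rho>) *\<^sub>R \<rho> *\<^sub>R y))))"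
      using \<rho> by (subst lborel_integral_scaleR[where c=\<rho>]) auto
    finally show ?thesis using \<rho> by (simp add: fourier_def scaleR_conv_of_real[where 'a=complex])
  qed
  define H where "H \<zeta> = cis (\<zeta> \<bullet> ((1 / \<rho>) *\<^sub>R x)) * (complex_of_real (norm \<zeta> powr (2 * s)) * ?F \<zeta>)" for \<zeta>
  have [measurable]: "H \<in> borel_measurable borel" unfolding H_def[abs_def] by measurable
  have H: "cis (\<xi> \<bullet> x) * (complex_of_real (norm \<xi> powr (2 * s)) *
      fourier (\<lambda>y. complex_of_real (e * f ((1 / \<rho>) *\<^sub>R y))) \<xi>)
      = complex_of_real (e * \<rho> ^ CARD('n) * \<rho> powr (- 2 * s)) * H (\<rho> *\<^sub>R \<xi>)" for \<xi>
  proof -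
    have "norm \<xi> powr (2 * s) = \<rho> powr (- 2 * s) * norm (\<rho> *\<^sub>R \<xi>) powr (2 * s)"
      using \<rho> by (simp add: powr_mult powr_minus)
    moreover have "\<xi> \<bullet> x = (\<rho> *\<^sub>R \<xi>) \<bullet> ((1 / \<rho>) *\<^sub>R x)" using \<rho> by simp
    ultimately show ?thesis unfolding F H_def by (simp only: of_real_mult mult_ac)
  qed
  have "(LINT \<xi>|lborel. cis (\<xi> \<bullet> x) * (complex_of_real (norm \<xi> powr (2 * s)) *
      fourier (\<lambda>y. complex_of_real (e * f ((1 / \<rho>) *\<^sub>R y))) \<xi>))
      = complex_of_real (e * \<rho> powr (- 2 * s)) * (\<rho> ^ CARD('n) *\<^sub>R (LINT \<xi>|lborel. H (\<rho> *\<^sub>R \<xi>)))"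
    unfolding H by (simp add: scaleR_conv_of_real[where 'a=complex])
  also have "\<dots> = complex_of_real (e * \<rho> powr (- 2 * s)) * (LINT \<xi>|lborel. H \<xi>)"
    using lborel_integral_scaleR[OF \<rho>, of H] by simp
  finally show ?thesis
    unfolding frac_laplacian_def inverse_fourier_def H_def
    by (simp only: mult.left_commute[of "complex_of_real (1 / _)"] Re_complex_of_real times_complex.sel Im_complex_of_real)
qed

section \<open>Two-sided bounds for the fractional Laplacian at infinity\<close>

lemma power2_powr: "0 < x \<Longrightarrow> x\<^sup>2 powr b = x powr (2 * b)" for x b :: real
  using powr_powr[of x 2 b] by (simp add: powr_numeral)

lemma exists_large_coordinate:
  fixes x :: "'a::euclidean_space"
  assumes "real DIM('a) < (norm x)\<^sup>2"
  shows "\<exists>b\<in>Basis. 1 < \<bar>x \<bullet> b\<bar>"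
proof (rule ccontr)
  assume "\<not> ?thesis"
  then have "(x \<bullet> b)\<^sup>2 \<le> 1" if "b \<in> Basis" for b
    using that by (auto simp: abs_square_le_1)
  then have "(norm x)\<^sup>2 \<le> (\<Sum>b\<in>(Basis::'a set). 1)"
    unfolding power2_norm_eq_sum_Basis by (intro sum_mono)
  with assms show False by simp
qed

lemma prod_sqrt_exp:
  assumes "0 < \<tau>"
  shows "(\<Prod>b\<in>(Basis::'a::euclidean_space set). c * (sqrt (pi / \<tau>) * exp (f b)))
    = (c * sqrt pi) ^ DIM('a) * (\<tau> powr (- (real DIM('a) / 2)) * exp (\<Sum>b\<in>Basis. f b))"
proof -
  have "sqrt (pi / \<tau>) = sqrt pi * \<tau> powr (- (1 / 2))"
    unfolding real_sqrt_divide powr_minus powr_half_sqrt[OF less_imp_le[OF assms]] by (rule divide_inverse)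
  moreover have "(\<tau> powr (- (1 / 2))) ^ DIM('a) = \<tau> powr (- (real DIM('a) / 2))"
    using assms by (subst powr_power) auto
  ultimately show ?thesis
    by (simp only: prod.distrib exp_sum[OF finite_Basis] power_mult_distrib prod_constant mult_ac)
qed

lemma heat_profile_nonneg: "0 \<le> heat_profile s x \<tau>"
  unfolding heat_profile_def
  by (cases "0 < \<tau>") (simp_all add: mult_nonneg_nonneg prod_nonneg heat_bump_nonneg del: zero_le_mult_iff)

lemma heat_profile_le:
  fixes x :: "'a::euclidean_space"
  assumes x: "4 * real DIM('a) \<le> (norm x)\<^sup>2"
  shows "heat_profile s x \<tau> \<le> (2 * sqrt pi) ^ DIM('a) *
    (indicator {0<..} \<tau> * (\<tau> powr (- (real DIM('a) / 2 + s) - 1) * exp (- ((norm x)\<^sup>2 / 16) / \<tau>)))"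
proof (cases "0 < \<tau>")
  case True
  \<comment> \<open>The bound (y - z)^2 \<ge> y^2/2 - 1 is quadratic in each coordinate, so its
    exponents add up to |x|^2/2 - N. For |x|^2 \<ge> 4 N this is at least |x|^2/4, hence the 16
    after division by 4 \<tau>.\<close>
  have "heat_bump \<tau> (x \<bullet> b) \<le> 2 * (sqrt (pi / \<tau>) * exp (- ((x \<bullet> b)\<^sup>2 / 2 - 1) / (4 * \<tau>)))" for b
  proof -
    have "(y\<^sup>2 / 2 - 1) \<le> (y - z)\<^sup>2" if "\<bar>z\<bar> \<le> 1" for y z :: real
    proof -
      have "z\<^sup>2 \<le> 1" using that by (simp add: abs_square_le_1)
      moreover have "0 \<le> (y - 2 * z)\<^sup>2" by simp
      ultimately show ?thesis by (simp add: power2_eq_square algebra_simps)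
    qed
    from heat_bump_le[OF True this] show ?thesis by (simp add: mult.assoc)
  qed
  then have "(\<Prod>b\<in>Basis. heat_bump \<tau> (x \<bullet> b))
      \<le> (\<Prod>b\<in>(Basis::'a set). 2 * (sqrt (pi / \<tau>) * exp (- ((x \<bullet> b)\<^sup>2 / 2 - 1) / (4 * \<tau>))))"
    by (intro prod_mono) (simp add: heat_bump_nonneg True)
  also have "\<dots> = (2 * sqrt pi) ^ DIM('a) * (\<tau> powr (- (real DIM('a) / 2)) *
      exp (\<Sum>b\<in>(Basis::'a set). - ((x \<bullet> b)\<^sup>2 / 2 - 1) / (4 * \<tau>)))"
    by (rule prod_sqrt_exp[OF True])
  also have "(\<Sum>b\<in>(Basis::'a set). - ((x \<bullet> b)\<^sup>2 / 2 - 1) / (4 * \<tau>)) = - ((norm x)\<^sup>2 / 2 - real DIM('a)) / (4 * \<tau>)"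
    by (simp add: power2_norm_eq_sum_Basis sum_subtractf sum_negf flip: sum_divide_distrib)
  finally have "(\<Prod>b\<in>Basis. heat_bump \<tau> (x \<bullet> b))
      \<le> (2 * sqrt pi) ^ DIM('a) * (\<tau> powr (- (real DIM('a) / 2)) * exp (- ((norm x)\<^sup>2 / 2 - real DIM('a)) / (4 * \<tau>)))" .
  also have "\<dots> \<le> (2 * sqrt pi) ^ DIM('a) * (\<tau> powr (- (real DIM('a) / 2)) * exp (- ((norm x)\<^sup>2 / 16) / \<tau>))"
    using x True by (intro mult_left_mono iffD2[OF exp_le_cancel_iff]) (auto simp: field_simps)
  finally have "\<tau> powr (- 1 - s) * (\<Prod>b\<in>Basis. heat_bump \<tau> (x \<bullet> b)) \<le> \<tau> powr (- 1 - s) *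
      ((2 * sqrt pi) ^ DIM('a) * (\<tau> powr (- (real DIM('a) / 2)) * exp (- ((norm x)\<^sup>2 / 16) / \<tau>)))"
    by (rule mult_left_mono) simp
  also have "\<dots> = (2 * sqrt pi) ^ DIM('a) * ((\<tau> powr (- 1 - s) * \<tau> powr (- (real DIM('a) / 2))) * exp (- ((norm x)\<^sup>2 / 16) / \<tau>))"
    by (simp only: mult_ac)
  also have "\<tau> powr (- 1 - s) * \<tau> powr (- (real DIM('a) / 2)) = \<tau> powr (- (real DIM('a) / 2 + s) - 1)"
    unfolding powr_add[symmetric] by (rule arg_cong[where f="\<lambda>e. \<tau> powr e"]) simp
  finally show ?thesis using True by (simp add: heat_profile_def)
qed (simp add: heat_profile_def)

text \<open>For \<tau> of order |x|^2 the Gaussian is not small: its exponent (2 |x|^2 + 2 N)/(4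
  \<tau>) is at most 1. Integrated over this window of length |x|^2, the bound has the order
  |x|^(-N-2s).\<close>

lemma heat_profile_ge:
  fixes x :: "'a::euclidean_space"
  assumes x: "real DIM('a) \<le> (norm x)\<^sup>2" and s: "0 < s"
    and \<tau>: "(norm x)\<^sup>2 \<le> \<tau>" "\<tau> \<le> 2 * (norm x)\<^sup>2"
  shows "(exp (- 4) * sqrt pi) ^ DIM('a) * exp (- 1) * (2 * (norm x)\<^sup>2) powr (- (real DIM('a) / 2 + s) - 1) \<le> heat_profile s x \<tau>"
proof -
  have n: "0 < (norm x)\<^sup>2" using x by (smt (verit) DIM_positive of_nat_0_less_iff)
  then have True: "0 < \<tau>" using \<tau> by linarith
  have "exp (- 4) * (sqrt (pi / \<tau>) * exp (- (2 * (x \<bullet> b)\<^sup>2 + 2) / (4 * \<tau>))) \<le> heat_bump \<tau> (x \<bullet> b)" for b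
  proof -
    have "(y - z)\<^sup>2 \<le> 2 * y\<^sup>2 + 2" if "\<bar>z\<bar> \<le> 1" for y z :: real
    proof -
      have "z\<^sup>2 \<le> 1" using that by (simp add: abs_square_le_1)
      moreover have "0 \<le> (y + z)\<^sup>2" by simp
      ultimately show ?thesis by (simp add: power2_eq_square algebra_simps)
    qed
    from heat_bump_ge[OF True this] show ?thesis .
  qed
  then have "(\<Prod>b\<in>(Basis::'a set). exp (- 4) * (sqrt (pi / \<tau>) * exp (- (2 * (x \<bullet> b)\<^sup>2 + 2) / (4 * \<tau>))))
      \<le> (\<Prod>b\<in>Basis. heat_bump \<tau> (x \<bullet> b))"
    using True by (intro prod_mono) auto
  also have "(\<Prod>b\<in>(Basis::'a set). exp (- 4) * (sqrt (pi / \<tau>) * exp (- (2 * (x \<bullet> b)\<^sup>2 + 2) / (4 * \<tau>))))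
      = (exp (- 4) * sqrt pi) ^ DIM('a) * (\<tau> powr (- (real DIM('a) / 2)) *
      exp (\<Sum>b\<in>(Basis::'a set). - (2 * (x \<bullet> b)\<^sup>2 + 2) / (4 * \<tau>)))"
    by (rule prod_sqrt_exp[OF True])
  also have "(\<Sum>b\<in>(Basis::'a set). - (2 * (x \<bullet> b)\<^sup>2 + 2) / (4 * \<tau>)) = - (2 * (norm x)\<^sup>2 + 2 * real DIM('a)) / (4 * \<tau>)"
    by (simp add: power2_norm_eq_sum_Basis sum.distrib sum_negf sum_subtractf sum_distrib_left flip: sum_divide_distrib)
  finally have le: "(exp (- 4) * sqrt pi) ^ DIM('a) * (\<tau> powr (- (real DIM('a) / 2)) * exp (- (2 * (norm x)\<^sup>2 + 2 * real DIM('a)) / (4 * \<tau>)))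
      \<le> (\<Prod>b\<in>Basis. heat_bump \<tau> (x \<bullet> b))" .
  have "(exp (- 4) * sqrt pi) ^ DIM('a) * (\<tau> powr (- (real DIM('a) / 2)) * exp (- 1))
      \<le> (exp (- 4) * sqrt pi) ^ DIM('a) * (\<tau> powr (- (real DIM('a) / 2)) * exp (- (2 * (norm x)\<^sup>2 + 2 * real DIM('a)) / (4 * \<tau>)))"
    using x \<tau> True by (intro mult_left_mono iffD2[OF exp_le_cancel_iff]) (auto simp: field_simps)
  from mult_left_mono[OF order_trans[OF this le], of "\<tau> powr (- 1 - s)"]
  have "(exp (- 4) * sqrt pi) ^ DIM('a) * exp (- 1) * (\<tau> powr (- 1 - s) * \<tau> powr (- (real DIM('a) / 2)))
      \<le> \<tau> powr (- 1 - s) * (\<Prod>b\<in>Basis. heat_bump \<tau> (x \<bullet> b))"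
    by (simp only: mult_ac powr_ge_zero)
  also have "\<dots> = heat_profile s x \<tau>" using True by (simp add: heat_profile_def)
  also have "\<tau> powr (- 1 - s) * \<tau> powr (- (real DIM('a) / 2)) = \<tau> powr (- (real DIM('a) / 2 + s) - 1)"
    unfolding powr_add[symmetric] by (rule arg_cong[where f="\<lambda>e. \<tau> powr e"]) simp
  finally have "(exp (- 4) * sqrt pi) ^ DIM('a) * exp (- 1) * \<tau> powr (- (real DIM('a) / 2 + s) - 1) \<le> heat_profile s x \<tau>" .
  moreover have "(2 * (norm x)\<^sup>2) powr (- (real DIM('a) / 2 + s) - 1) \<le> \<tau> powr (- (real DIM('a) / 2 + s) - 1)"
    using True \<tau> s by (intro powr_mono2') auto
  then have "(exp (- 4) * sqrt pi) ^ DIM('a) * exp (- 1) * (2 * (norm x)\<^sup>2) powr (- (real DIM('a) / 2 + s) - 1)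
    \<le> (exp (- 4) * sqrt pi) ^ DIM('a) * exp (- 1) * \<tau> powr (- (real DIM('a) / 2 + s) - 1)"
    by (rule mult_left_mono) simp
  ultimately show ?thesis by linarith
qed

text \<open>For |x| \<ge> r the upper bound integrates \<open>heat_profile_le\<close> to a multiple
  of k^(-a) with k = |x|^2/16, and the lower bound keeps only \<tau> between |x|^2 and 2 |x|^2. Both
  are of order |x|^(-2a) = |x|^(-N-2s).\<close>

lemma frac_laplacian_bump_prod_bounds:
  assumes s: "0 < s" "s < 1"
  obtains C c r where "0 < C" "0 < c"
    "\<And>x::real^'n. \<bar>frac_laplacian s bump_prod x\<bar> \<le> C * (1 + norm x) powr (- (real CARD('n) + 2 * s))"
    "\<And>x::real^'n. r \<le> norm x \<Longrightarrow> c * (1 + norm x) powr (- (real CARD('n) + 2 * s)) \<le> \<bar>frac_laplacian s bump_prod x\<bar>"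
proof -
  let ?N = "real CARD('n)"
  define d where "d = ?N + 2 * s"
  define a where "a = ?N / 2 + s"
  have a: "0 < a" and da: "d = 2 * a" using s by (simp_all add: a_def d_def add_nonneg_pos)
  have d: "0 < d" using a da by simp
  define K where "K = levy_const s * (2 * pi) ^ CARD('n)"
  have K: "0 < K" using levy_integral_unit(2)[OF s] by (simp add: K_def)
  \<comment> \<open>Gives 4 N \<le> |x|^2 for |x| \<ge> r, which covers the hypotheses of both heat
    bounds and places x off the support.\<close>
  define r where "r = 2 * sqrt ?N"
  have N1: "1 \<le> ?N" by (simp add: Suc_leI)
  have r1: "1 \<le> r" unfolding r_def using real_sqrt_ge_one[OF N1] by linarith
  have rN: "4 * ?N \<le> (norm x)\<^sup>2" if "r \<le> norm x" for x :: "real^'n"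
  proof -
    have "r\<^sup>2 \<le> (norm x)\<^sup>2" using that r1 by (intro power_mono) auto
    then show ?thesis by (simp add: r_def power_mult_distrib)
  qed
  define E where "E = (LINT \<tau>|lborel. indicator {0<..} \<tau> * (\<tau> powr (- a - 1) * exp (- 1 / \<tau>)))"
  have E0: "0 \<le> E" unfolding E_def by (intro Bochner_Integration.integral_nonneg) simp
  define C1 where "C1 = (2 * sqrt pi) ^ CARD('n) * 16 powr a * E * 2 powr d / K"
  define c where "c = (exp (- 4) * sqrt pi) ^ CARD('n) * exp (- 1) * 2 powr (- a - 1) / K"
  have c: "0 < c" using K by (simp add: c_def)
  have C1: "0 \<le> C1" using E0 K by (simp add: C1_def)
  have far: "\<bar>frac_laplacian s bump_prod x\<bar> = (LINT \<tau>|lborel. heat_profile s x \<tau>) / K"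
    "integrable lborel (heat_profile s x)" if "r \<le> norm x" for x :: "real^'n"
  proof -
    have "\<exists>b\<in>Basis. 1 < \<bar>x \<bullet> b\<bar>"
    proof (rule exists_large_coordinate)
      have "?N < (norm x)\<^sup>2" using rN[OF that] N1 by linarith
      then show "real DIM(real^'n) < (norm x)\<^sup>2" by simp
    qed
    note f = far_frac_laplacian_bump_prod[OF s this]
    have "0 \<le> (LINT \<tau>|lborel. heat_profile s x \<tau>)"
      by (intro Bochner_Integration.integral_nonneg) (rule heat_profile_nonneg)
    then show "\<bar>frac_laplacian s bump_prod x\<bar> = (LINT \<tau>|lborel. heat_profile s x \<tau>) / K"
      using f(2) K by (simp add: K_def)
    show "integrable lborel (heat_profile s x)" by (rule f(1))
  qed
  have up: "\<bar>frac_laplacian s bump_prod x\<bar> \<le> C1 * (1 + norm x) powr (- d)" if x: "r \<le> norm x" for x :: "real^'n"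
  proof -
    have x0: "0 < norm x" using x r1 by linarith
    have k: "0 < (norm x)\<^sup>2 / 16" using x0 by simp
    have "(LINT \<tau>|lborel. heat_profile s x \<tau>) \<le> (LINT \<tau>|lborel. (2 * sqrt pi) ^ CARD('n) *
        (indicator {0<..} \<tau> * (\<tau> powr (- a - 1) * exp (- ((norm x)\<^sup>2 / 16) / \<tau>))))"
      using heat_profile_le[of x s] rN[OF x]
      by (intro integral_mono far(2)[OF x] integrable_mult_right integrable_inverse_gamma_density(1)[OF a k]) (simp add: a_def)
    also have "\<dots> = (2 * sqrt pi) ^ CARD('n) * (((norm x)\<^sup>2 / 16) powr (- a) * E)"
      using integrable_inverse_gamma_density(2)[OF a k] by (simp only: integral_mult_right_zero E_def)
    also have "((norm x)\<^sup>2 / 16) powr (- a) = 16 powr a * norm x powr (- d)"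
    proof -
      have "((norm x)\<^sup>2 / 16) powr (- a) = (norm x)\<^sup>2 powr (- a) / 16 powr (- a)"
        by (rule powr_divide)
      also have "\<dots> = norm x powr (- d) * 16 powr a"
        unfolding power2_powr[OF x0] powr_minus[of 16] da by (simp add: divide_inverse)
      finally show ?thesis by (simp only: mult.commute)
    qed
    \<comment> \<open>As |x| \<ge> 1, passing from |x| to 1 + |x| costs a factor
      \<open>2 powr d\<close>.\<close>
    also have "norm x powr (- d) \<le> 2 powr d * (1 + norm x) powr (- d)"
    proof -
      have "norm x powr (- d) \<le> ((1 + norm x) / 2) powr (- d)"
        using x r1 d by (intro powr_mono2') auto
      then show ?thesis unfolding powr_divide powr_minus[of 2]
        by (simp only: divide_inverse inverse_inverse_eq mult.commute)
    qed
    finally have "(LINT \<tau>|lborel. heat_profile s x \<tau>) \<le> (2 * sqrt pi) ^ CARD('n) *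
        (16 powr a * (2 powr d * (1 + norm x) powr (- d)) * E)"
      using E0 by (simp add: mult_left_mono mult_right_mono)
    then have "(LINT \<tau>|lborel. heat_profile s x \<tau>) / K \<le> (2 * sqrt pi) ^ CARD('n) *
        (16 powr a * (2 powr d * (1 + norm x) powr (- d)) * E) / K"
      using K by (intro divide_right_mono) auto
    then show ?thesis unfolding far(1)[OF x] C1_def by (simp add: mult_ac)
  qed
  have low: "c * (1 + norm x) powr (- d) \<le> \<bar>frac_laplacian s bump_prod x\<bar>" if x: "r \<le> norm x" for x :: "real^'n"
  proof -
    have x0: "0 < norm x" using x r1 by linarith
    let ?h = "(exp (- 4) * sqrt pi) ^ CARD('n) * exp (- 1) * (2 * (norm x)\<^sup>2) powr (- a - 1)"
    have "(LINT \<tau>|lborel. indicator {(norm x)\<^sup>2..2 * (norm x)\<^sup>2} \<tau> * ?h) \<le> (LINT \<tau>|lborel. heat_profile s x \<tau>)"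
    proof (rule integral_mono[OF _ far(2)[OF x]])
      fix \<tau>
      show "indicator {(norm x)\<^sup>2..2 * (norm x)\<^sup>2} \<tau> * ?h \<le> heat_profile s x \<tau>"
        using heat_profile_ge[of x s \<tau>] rN[OF x] N1 s heat_profile_nonneg[of s x \<tau>]
        by (cases "\<tau> \<in> {(norm x)\<^sup>2..2 * (norm x)\<^sup>2}") (simp_all add: a_def)
    qed auto
    then have "(norm x)\<^sup>2 * ?h \<le> (LINT \<tau>|lborel. heat_profile s x \<tau>)" by simp
    also have "(norm x)\<^sup>2 * ?h = c * K * ((norm x)\<^sup>2 * (norm x)\<^sup>2 powr (- a - 1))"
      using K x0 by (simp add: c_def powr_mult)
    also have "(norm x)\<^sup>2 * (norm x)\<^sup>2 powr (- a - 1) = norm x powr (- d)"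
    proof -
      have "(norm x)\<^sup>2 * (norm x)\<^sup>2 powr (- a - 1) = (norm x)\<^sup>2 powr (- a)"
        using powr_mult_base[of "(norm x)\<^sup>2" "- a - 1"] by simp
      then show ?thesis using power2_powr[OF x0, of "- a"] by (simp add: da)
    qed
    finally have "c * norm x powr (- d) \<le> (LINT \<tau>|lborel. heat_profile s x \<tau>) / K"
      using K by (simp add: pos_le_divide_eq mult_ac)
    moreover have "c * (1 + norm x) powr (- d) \<le> c * norm x powr (- d)"
      using c x0 d by (intro mult_left_mono powr_mono2') auto
    ultimately show ?thesis unfolding far(1)[OF x] by linarith
  qed
  define B where "B = (LINT \<xi>::real^'n|lborel. (\<Prod>b\<in>Basis. 1 + (\<xi> \<bullet> b)\<^sup>2) * (\<Prod>b\<in>Basis. norm (bump_hat (\<xi> \<bullet> b)))) / (2 * pi) ^ CARD('n)"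
  have B: "\<bar>frac_laplacian s bump_prod x\<bar> \<le> B" for x :: "real^'n"
    unfolding B_def by (rule frac_laplacian_bump_prod_bounded[OF s])
  have B0: "0 \<le> B" using B[of 0] by linarith
  \<comment> \<open>The first summand serves |x| < r, where boundedness is used; the last one makes
    the constant positive.\<close>
  define C where "C = B * (1 + r) powr d + C1 + 1"
  have C: "0 < C" using B0 C1 by (simp add: C_def add_nonneg_pos)
  have "\<bar>frac_laplacian s bump_prod x\<bar> \<le> C * (1 + norm x) powr (- d)" for x :: "real^'n"
  proof (cases "r \<le> norm x")
    case True
    have "C1 * (1 + norm x) powr (- d) \<le> C * (1 + norm x) powr (- d)"
      using B0 by (intro mult_right_mono) (auto simp: C_def)
    with up[OF True] show ?thesis by linarith
  next
    case False
    have "\<bar>frac_laplacian s bump_prod x\<bar> \<le> B * ((1 + r) powr d * (1 + r) powr (- d))"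
      using B r1 by (simp flip: powr_add)
    also have "\<dots> \<le> B * ((1 + r) powr d * (1 + norm x) powr (- d))"
      using False d B0 by (intro mult_left_mono powr_mono2') (auto simp: add_pos_nonneg)
    also have "\<dots> \<le> C * (1 + norm x) powr (- d)"
      unfolding mult.assoc[symmetric] using C1 by (intro mult_right_mono) (auto simp: C_def)
    finally show ?thesis .
  qed
  with C c low show ?thesis by (intro that[of C c r]) (auto simp: d_def)
qed

section \<open>Dyadic sums and integrability of the weight\<close>

text \<open>Either A \<le> c y^(p-1), and the first term suffices, or y \<le> (A/c)^(1/(p-1)), and
  the second one does. The result is not sharp, but the coefficient of y^p can be prescribed, as its
  later absorption demands.\<close>

lemma young_with_small_constant:
  fixes p c :: real
  assumes p: "1 < p" and c: "0 < c" and A: "0 \<le> A" and y: "0 \<le> y"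
  shows "A * y \<le> c * y powr p + c powr (- (1 / (p - 1))) * A powr (p / (p - 1))"
proof (cases "A \<le> c * y powr (p - 1)")
  case True
  have "A * y \<le> c * y powr (p - 1) * y" using True y by (rule mult_right_mono)
  also have "\<dots> = c * y powr p" using y powr_mult_base[of y "p - 1"] by (simp add: mult.commute)
  finally show ?thesis by (smt (verit) c mult_nonneg_nonneg powr_ge_zero)
next
  case False
  define q where "q = 1 / (p - 1)"
  have q: "0 < q" using p by (simp add: q_def)
  have "0 < A" using False c by (smt (verit) mult_nonneg_nonneg powr_ge_zero)
  have "y powr (p - 1) \<le> A / c" using False c by (simp add: field_simps)
  then have "(y powr (p - 1)) powr q \<le> (A / c) powr q" using q by (intro powr_mono2) auto
  moreover have "(y powr (p - 1)) powr q = y" using p y by (simp add: powr_powr q_def)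
  ultimately have "y \<le> (A / c) powr q" by simp
  then have "A * y \<le> A * (A / c) powr q" using A by (rule mult_left_mono)
  also have "\<dots> = c powr (- q) * (A * A powr q)"
    unfolding powr_divide powr_minus by (simp add: divide_inverse)
  also have "A * A powr q = A powr (p / (p - 1))"
  proof -
    have "1 + q = p / (p - 1)" using p by (simp add: q_def field_simps)
    then show ?thesis using powr_mult_base[OF A, of q] by simp
  qed
  finally show ?thesis using c by (simp add: q_def add_increasing)
qed

lemma integrable_one_plus_abs_powr:
  assumes "1 < \<beta>"
  shows "integrable lborel (\<lambda>y::real. (1 + \<bar>y\<bar>) powr (- \<beta>))"
proof (rule Bochner_Integration.integrable_bound)
  let ?g = "\<lambda>y::real. indicator {1..} y * y powr (- \<beta>)"
  have 1: "integrable lborel ?g" using assms by (intro integrable_powr_at_infinity) simp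
  then have "integrable lborel (\<lambda>y. ?g (0 + (- 1) * y))" by (intro lborel_integrable_real_affine) auto
  then show "integrable lborel (\<lambda>y::real. indicator {-1..1} y + ?g y + ?g (0 + (- 1) * y))"
    using 1 by (intro Bochner_Integration.integrable_add) auto
  have le: "(1 + \<bar>y\<bar>) powr (- \<beta>) \<le> indicator {-1..1} y + ?g y + ?g (0 + (- 1) * y)" for y
  proof -
    consider "\<bar>y\<bar> \<le> 1" | "1 < y" | "1 < - y" by linarith
    then show ?thesis
    proof cases
      case 1
      then have "(1 + \<bar>y\<bar>) powr (- \<beta>) \<le> 1" using assms powr_mono2'[of "- \<beta>" 1 "1 + \<bar>y\<bar>"] by simp
      moreover have "0 \<le> ?g y" "0 \<le> ?g (0 + (- 1) * y)" by auto
      ultimately show ?thesis using 1 by (auto simp: indicator_def)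
    next
      case 2
      then show ?thesis using assms powr_mono2'[of "- \<beta>" y "1 + \<bar>y\<bar>"] by simp
    next
      case 3
      then show ?thesis using assms powr_mono2'[of "- \<beta>" "- y" "1 + \<bar>y\<bar>"] by simp
    qed
  qed
  show "AE y in lborel. norm ((1 + \<bar>y\<bar>) powr (- \<beta>)) \<le> norm (indicator {-1..1} y + ?g y + ?g (0 + (- 1) * y))"
    using order_trans[OF le abs_ge_self] by (intro AE_I2) (simp only: real_norm_def abs_of_nonneg powr_ge_zero)
qed measurable

text \<open>1 + |x| dominates 1 + |x_b| for every coordinate, so the exponent d can be shared
  equally, each coordinate receiving d/N > 1.\<close>

lemma integrable_one_plus_norm_powr:
  assumes d: "real DIM('a) < d"
  shows "integrable lborel (\<lambda>x::'a::euclidean_space. (1 + norm x) powr (- d))"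
proof (rule Bochner_Integration.integrable_bound)
  define \<beta> where "\<beta> = d / real DIM('a)"
  have \<beta>: "1 < \<beta>" using d by (simp add: \<beta>_def)
  show "integrable lborel (\<lambda>x::'a. \<Prod>b\<in>Basis. (1 + \<bar>x \<bullet> b\<bar>) powr (- \<beta>))"
    using integrable_one_plus_abs_powr[OF \<beta>]
    by (intro integrable_lborel_prod[of "\<lambda>b y. (1 + \<bar>y\<bar>) powr (- \<beta>)"])
  have "(1 + norm x) powr (- d) \<le> (\<Prod>b\<in>Basis. (1 + \<bar>x \<bullet> b\<bar>) powr (- \<beta>))" for x :: 'a
  proof -
    have "(1 + norm x) powr (- d) = (\<Prod>b\<in>(Basis::'a set). (1 + norm x) powr (- \<beta>))"
    proof -
      have "1 + norm x \<noteq> 0" by (smt (verit) norm_ge_zero)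
      from powr_power[OF this, of "- \<beta>" "DIM('a)"]
      have "((1 + norm x) powr (- \<beta>)) ^ DIM('a) = (1 + norm x) powr (real DIM('a) * - \<beta>)" .
      then show ?thesis by (simp add: \<beta>_def)
    qed
    also have "\<dots> \<le> (\<Prod>b\<in>Basis. (1 + \<bar>x \<bullet> b\<bar>) powr (- \<beta>))"
      using \<beta> by (intro prod_mono conjI powr_mono2') (auto simp: Basis_le_norm add_pos_nonneg)
    finally show ?thesis .
  qed
  then show "AE x::'a in lborel. norm ((1 + norm x) powr (- d)) \<le> norm (\<Prod>b\<in>Basis. (1 + \<bar>x \<bullet> b\<bar>) powr (- \<beta>))"
    by (intro AE_I2) (simp add: abs_of_nonneg prod_nonneg)
qed measurable

lemma
  fixes f :: "real \<Rightarrow> real" and g :: "'a::euclidean_space \<Rightarrow> real"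
  assumes f: "integrable lborel f" and g: "integrable lborel g"
  shows integrable_lborel_Times: "integrable lebesgue (\<lambda>(t, x). f t * g x)"
    and integral_lborel_Times: "(LINT z|lebesgue. (case z of (t, x) \<Rightarrow> f t * g x)) = (LINT t|lborel. f t) * (LINT x|lborel. g x)"
proof -
  have [measurable]: "f \<in> borel_measurable borel" "g \<in> borel_measurable borel"
    using f g borel_measurable_integrable by fastforce+
  have m: "(\<lambda>(t, x). f t * g x) \<in> borel_measurable (lborel :: (real \<times> 'a) measure)"
    by (simp add: borel_prod[symmetric])
  have I: "integrable (lborel \<Otimes>\<^sub>M lborel) (\<lambda>(t, x). f t * g x)"
  proof (rule lborel_pair.Fubini_integrable)
    show "integrable lborel (\<lambda>t. LINT x|lborel. norm (case (t, x) of (t, x) \<Rightarrow> f t * g x))"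
      using f by (simp add: abs_mult integrable_abs)
  qed (use g in auto)
  then show "integrable lebesgue (\<lambda>(t, x). f t * g x)"
    unfolding integrable_completion[OF m] by (simp only: lborel_prod)
  have "(LINT t|lborel. LINT x|lborel. f t * g x) = (LINT z|(lborel \<Otimes>\<^sub>M lborel). (case z of (t, x) \<Rightarrow> f t * g x))"
    using lborel_pair.integral_fst'[OF I] by simp
  then show "(LINT z|lebesgue. (case z of (t, x) \<Rightarrow> f t * g x)) = (LINT t|lborel. f t) * (LINT x|lborel. g x)"
    unfolding integral_completion[OF m] by (simp add: lborel_prod)
qed

lemma AE_lebesgue_snd:
  assumes "AE x in lebesgue. P (x :: 'a::euclidean_space)"
  shows "AE z in (lebesgue :: (real \<times> 'a) measure). P (snd z)"
proof -
  from assms obtain N where N: "{x. \<not> P x} \<subseteq> N" "N \<in> null_sets lborel"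
    unfolding AE_completion_iff by (auto elim!: AE_E simp: null_sets_def)
  then have "UNIV \<times> N \<in> null_sets (lborel \<Otimes>\<^sub>M lborel :: (real \<times> 'a) measure)"
    by (intro lborel.times_in_null_sets2) auto
  then have "AE z in (lborel :: (real \<times> 'a) measure). P (snd z)"
    using N(1) by (intro AE_I'[of "UNIV \<times> N"]) (auto simp: lborel_prod)
  then show ?thesis by (rule AE_completion)
qed

lemma bump_prod_bounds: "0 \<le> bump_prod x" "bump_prod x \<le> 1"
  by (auto simp: bump_prod_def bump_nonneg bump_le_1 intro: prod_nonneg prod_le_1)

lemma bump_prod_ge:
  fixes x :: "'a::euclidean_space"
  assumes "norm x \<le> 1 / 2"
  shows "exp (- 4) ^ DIM('a) \<le> bump_prod x"
proof -
  have "\<bar>x \<bullet> b\<bar> \<le> 1 / 2" if "b \<in> Basis" for b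
    using Basis_le_norm[OF that, of x] assms by linarith
  then have "(\<Prod>b\<in>(Basis::'a set). exp (- 4)) \<le> bump_prod x"
    unfolding bump_prod_def by (intro prod_mono conjI bump_ge) auto
  then show ?thesis by simp
qed

lemma bump_prod_eq_0:
  fixes x :: "'a::euclidean_space"
  assumes "real DIM('a) < norm x"
  shows "bump_prod x = 0"
proof -
  have "1 \<le> real DIM('a)" by (simp add: Suc_leI)
  then have "real DIM('a) \<le> (real DIM('a))\<^sup>2" by (simp add: power2_eq_square)
  also have "\<dots> < (norm x)\<^sup>2" using assms by (intro power_strict_mono) auto
  finally obtain b where "b \<in> Basis" "1 < \<bar>x \<bullet> b\<bar>" using exists_large_coordinate by blast
  then have "\<exists>b\<in>Basis. bump (x \<bullet> b) = 0" using bump_eq_0 by blast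
  then show ?thesis by (simp add: bump_prod_def)
qed

lemma integrable_bump_prod: "integrable lborel (bump_prod :: 'a::euclidean_space \<Rightarrow> real)"
  unfolding bump_prod_def[abs_def] using integrable_bump
  by (intro integrable_lborel_prod[of "\<lambda>b. bump"])

lemma bump_prod_0_pos: "0 < bump_prod (0 :: 'a::euclidean_space)"
  using bump_prod_ge[of "0 :: 'a"] by (smt (verit) exp_gt_zero norm_zero zero_less_power divide_nonneg_nonneg)

lemma
  fixes f :: "'a::euclidean_space \<Rightarrow> real"
  assumes "0 < \<rho>" "integrable lborel f"
  shows integrable_lborel_dilation: "integrable lborel (\<lambda>x. f ((1 / \<rho>) *\<^sub>R x))"
    and integral_lborel_dilation: "(LINT x|lborel. f ((1 / \<rho>) *\<^sub>R x)) = \<rho> ^ DIM('a) * (LINT x|lborel. f x)"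
proof -
  have [measurable]: "f \<in> borel_measurable borel" using assms borel_measurable_integrable by fastforce
  have "(LINT x|lborel. f ((1 / \<rho>) *\<^sub>R x)) = \<rho> ^ DIM('a) *\<^sub>R (LINT x|lborel. f ((1 / \<rho>) *\<^sub>R \<rho> *\<^sub>R x))"
    using assms by (subst lborel_integral_scaleR[of \<rho>]) auto
  then show "(LINT x|lborel. f ((1 / \<rho>) *\<^sub>R x)) = \<rho> ^ DIM('a) * (LINT x|lborel. f x)"
    using assms by simp
  have "integrable (density (distr lborel borel (\<lambda>x. 0 + \<rho> *\<^sub>R x)) (\<lambda>_. \<bar>\<rho>\<bar> ^ DIM('a))) (\<lambda>x. f ((1 / \<rho>) *\<^sub>R x))"
    using assms by (subst integrable_density) (auto simp: integrable_distr_eq)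
  then show "integrable lborel (\<lambda>x. f ((1 / \<rho>) *\<^sub>R x))"
    using assms by (subst lborel_affine[of \<rho> 0]) auto
qed

text \<open>Since (2^k)^(-d) (1 + y/2^k)^(-d) = (2^k + y)^(-d) \<le> (1 + y)^(-d), the weight of
  scale k compensates the later onset of decay of the dilated function. What remains is a geometric
  series in 2^(-2s).\<close>

lemma dyadic_sum_decay:
  fixes y :: real
  assumes s: "0 < s" and d: "0 < d" and y: "0 \<le> y"
  shows "(\<Sum>k\<le>K. (2 ^ k) powr (- d) * ((2 ^ k) powr (- 2 * s) * (1 + y / 2 ^ k) powr (- d)))
    \<le> 1 / (1 - 2 powr (- 2 * s)) * (1 + y) powr (- d)"
    and "(\<Sum>k\<le>K. (2 ^ k) powr (- 2 * s)) \<le> 1 / (1 - 2 powr (- 2 * s))"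
proof -
  define q :: real where "q = 2 powr (- 2 * s)"
  have q: "0 < q" "q < 1" using s powr_less_one[of 2 "- 2 * s"] by (auto simp: q_def)
  have e: "(2 ^ k) powr (- 2 * s) = q ^ k" for k
    using powr_powr_swap[of 2 "real k" "- 2 * s"] by (simp add: q_def powr_realpow)
  have geo: "(\<Sum>k\<le>K. q ^ k) \<le> 1 / (1 - q)"
    using sum_le_suminf[OF summable_geometric, of q "{..K}"] suminf_geometric[of q] q by simp
  then show "(\<Sum>k\<le>K. (2 ^ k) powr (- 2 * s)) \<le> 1 / (1 - 2 powr (- 2 * s))"
    unfolding e q_def by simp
  have "(2 ^ k) powr (- d) * ((2 ^ k) powr (- 2 * s) * (1 + y / 2 ^ k) powr (- d)) \<le> q ^ k * (1 + y) powr (- d)" for k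
  proof -
    have "(2 ^ k) powr (- d) * (1 + y / 2 ^ k) powr (- d) = (2 ^ k + y) powr (- d)"
    proof -
      have "2 ^ k * (1 + y / 2 ^ k) = 2 ^ k + y" by (simp add: field_simps)
      moreover have "((2::real) ^ k * (1 + y / 2 ^ k)) powr (- d) = (2 ^ k) powr (- d) * (1 + y / 2 ^ k) powr (- d)"
        using y by (intro powr_mult)
      ultimately show ?thesis by simp
    qed
    also have "\<dots> \<le> (1 + y) powr (- d)"
      using y d by (intro powr_mono2') auto
    finally have "q ^ k * ((2 ^ k) powr (- d) * (1 + y / 2 ^ k) powr (- d)) \<le> q ^ k * (1 + y) powr (- d)"
      using q by (intro mult_left_mono) auto
    then show ?thesis unfolding e by (simp only: mult.left_commute)
  qed
  then have "(\<Sum>k\<le>K. (2 ^ k) powr (- d) * ((2 ^ k) powr (- 2 * s) * (1 + y / 2 ^ k) powr (- d)))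
      \<le> (\<Sum>k\<le>K. q ^ k * (1 + y) powr (- d))" by (intro sum_mono)
  also have "\<dots> = (\<Sum>k\<le>K. q ^ k) * (1 + y) powr (- d)" by (simp add: sum_distrib_right)
  also have "\<dots> \<le> 1 / (1 - q) * (1 + y) powr (- d)" using geo by (rule mult_right_mono) simp
  finally show "(\<Sum>k\<le>K. (2 ^ k) powr (- d) * ((2 ^ k) powr (- 2 * s) * (1 + y / 2 ^ k) powr (- d)))
    \<le> 1 / (1 - 2 powr (- 2 * s)) * (1 + y) powr (- d)" by (simp add: q_def)
qed

text \<open>One term is enough: the smallest k with |x| \<le> 2^k R/2. There the bump is bounded
  below, and minimality yields 2^k \<le> 4 (1 + |x|/R), the source of
  \<open>4 powr (- d)\<close>.\<close>

lemma dyadic_bump_sum_ge: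
  fixes x :: "'a::euclidean_space"
  assumes d: "0 < d" and R: "0 < R" and x: "norm x \<le> 2 ^ K * R / 2"
  shows "exp (- 4) ^ DIM('a) * 4 powr (- d) * (1 + norm x / R) powr (- d)
    \<le> (\<Sum>k\<le>K. (2 ^ k) powr (- d) * bump_prod ((1 / (2 ^ k * R)) *\<^sub>R x))"
proof -
  define k where "k = (LEAST k. norm x \<le> 2 ^ k * R / 2)"
  have k: "norm x \<le> 2 ^ k * R / 2" unfolding k_def using x by (rule LeastI)
  have kK: "k \<le> K" unfolding k_def using x by (rule Least_le)
  have "2 ^ k \<le> 4 * (1 + norm x / R)"
  proof (cases k)
    case 0
    have "0 \<le> norm x / R" using R by simp
    then show ?thesis using 0 by simp
  next
    case (Suc j)
    then have "\<not> norm x \<le> 2 ^ j * R / 2" unfolding k_def using not_less_Least lessI by metis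
    then show ?thesis using Suc R by (simp add: field_simps)
  qed
  then have "(4 * (1 + norm x / R)) powr (- d) \<le> (2 ^ k) powr (- d)"
    using d by (intro powr_mono2') auto
  moreover have "(4 * (1 + norm x / R)) powr (- d) = 4 powr (- d) * (1 + norm x / R) powr (- d)"
    by (rule powr_mult)
  ultimately have 1: "4 powr (- d) * (1 + norm x / R) powr (- d) \<le> (2 ^ k) powr (- d)" by simp
  have "norm ((1 / (2 ^ k * R)) *\<^sub>R x) \<le> 1 / 2" using k R by (simp add: field_simps)
  from bump_prod_ge[OF this] 1
  have "4 powr (- d) * (1 + norm x / R) powr (- d) * exp (- 4) ^ DIM('a)
      \<le> (2 ^ k) powr (- d) * bump_prod ((1 / (2 ^ k * R)) *\<^sub>R x)"
    by (intro mult_mono) auto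
  also have "\<dots> \<le> (\<Sum>k\<le>K. (2 ^ k) powr (- d) * bump_prod ((1 / (2 ^ k * R)) *\<^sub>R x))"
    using kK by (intro member_le_sum[of k "{..K}"]) (auto simp: bump_prod_bounds)
  finally show ?thesis by (simp only: mult_ac)
qed

section \<open>The weak formulation with product test functions\<close>

definition test_fun :: "real \<Rightarrow> real \<Rightarrow> real \<times> (real^'n) \<Rightarrow> real" where
  "test_fun T \<rho> = (\<lambda>(t, x). time_cutoff (t / T) * bump_prod ((1 / \<rho>) *\<^sub>R x))"

lemma test_function_test_fun:
  assumes T: "0 < T" and \<rho>: "0 < \<rho>"
  shows "test_function T (test_fun T \<rho> :: real \<times> (real^'n) \<Rightarrow> real)"
proof -
  have eq: "(test_fun T \<rho> :: real \<times> (real^'n) \<Rightarrow> real) =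
      (\<lambda>z. flat_exp 1 (- (fst z / T) + 1 / 2) * (\<Prod>b\<in>Basis. bump (((1 / \<rho>) *\<^sub>R snd z) \<bullet> b)))"
    by (rule ext) (simp add: test_fun_def time_cutoff_def bump_prod_def case_prod_beta)
  have "Ck_on k (test_fun T \<rho> :: real \<times> (real^'n) \<Rightarrow> real) UNIV" for k
    unfolding eq
    by (intro Ck_on_mult Ck_on_prod Ck_on_flat_exp_affine Ck_on_bump_affine bounded_linear_minus bounded_linear_intros
        bounded_linear_compose[OF bounded_linear_divide[of T] bounded_linear_fst])
  then have smooth: "smooth_on (test_fun T \<rho> :: real \<times> (real^'n) \<Rightarrow> real) UNIV"
    by (simp add: smooth_on_def)
  \<comment> \<open>The time cutoff vanishes from T/2 on, and the cube of half-side \<rho> lies in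
    the ball of radius \<rho> N.\<close>
  let ?K = "{0..T / 2} \<times> cball (0::real^'n) (\<rho> * real CARD('n))"
  have "compact ?K" by (intro compact_Times compact_Icc compact_cball)
  moreover have "?K \<subseteq> {0..<T} \<times> UNIV" using T by auto
  moreover have "test_fun T \<rho> z = 0" if "z \<in> {0..<T} \<times> UNIV - ?K" for z :: "real \<times> (real^'n)"
  proof (cases "fst z \<le> T / 2")
    case True
    with that have "\<rho> * real CARD('n) < norm (snd z)" by (auto simp: mem_Times_iff)
    then have "real DIM(real^'n) < norm ((1 / \<rho>) *\<^sub>R snd z)"
      using \<rho> by (simp add: field_simps)
    from bump_prod_eq_0[OF this] show ?thesis by (simp add: test_fun_def case_prod_beta)
  next
    case False
    then have "time_cutoff (fst z / T) = 0" using T by (intro time_cutoff_eq_0) (simp add: field_simps)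
    then show ?thesis by (simp add: test_fun_def case_prod_beta)
  qed
  ultimately show ?thesis
    unfolding test_function_def using smooth by (intro conjI exI[of _ UNIV] exI[of _ "test_fun T \<rho>"] exI[of _ ?K]) auto
qed

text \<open>Common ground of both cases of the theorem: -1 < \<sigma> makes t^\<sigma> integrable at
  0, and the critical exponent enters only when \<open>source_exponent_le\<close> is
  applied.\<close>

locale weak_solution =
  fixes \<alpha> s p \<sigma> :: real and w u0 :: "real^'n \<Rightarrow> real" and u :: "real \<times> (real^'n) \<Rightarrow> real"
  assumes \<alpha>: "0 < \<alpha>" "\<alpha> < 1" and s: "0 < s" "s < 1" and p: "1 < p" and \<sigma>: "- 1 < \<sigma>"
    and w_cont: "continuous_on UNIV w" and w_int: "integrable lebesgue w" and w_pos: "0 < (LINT x|lebesgue. w x)"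
    and u0_nonneg: "AE x in lebesgue. 0 \<le> u0 x"
    and sol: "global_weak_solution \<alpha> s p \<sigma> w u0 u"
begin

abbreviation "Q T \<equiv> {0<..<T::real} \<times> (UNIV :: (real^'n) set)"

definition "time_deriv T t = RL_right_deriv \<alpha> T (\<lambda>r. time_cutoff (r / T)) t"

definition "\<eta> \<rho> x = bump_prod ((1 / \<rho>) *\<^sub>R x)" for \<rho> and x :: "real^'n"

text \<open>The fractional Laplacian of \<open>\<eta> \<rho>\<close>, in the form that
  \<open>frac_laplacian_scale\<close> gives.\<close>

definition "L\<eta> \<rho> x = \<rho> powr (- 2 * s) * frac_laplacian s bump_prod ((1 / \<rho>) *\<^sub>R x)" for \<rho> and x :: "real^'n"

definition "source T \<rho> = (LINT z:Q T|lebesgue. (case z of (t, x) \<Rightarrow> t powr \<sigma> * w x * (time_cutoff (t / T) * \<eta> \<rho> x)))"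

text \<open>By the weak formulation its integral is the source term plus the term with
  \<open>u0\<close>. It is linear in the test function, which later permits summation over
  scales.\<close>

definition "excess T \<rho> z = (case z of (t, x) \<Rightarrow> u (t, x) * (time_cutoff (t / T) * L\<eta> \<rho> x)
    + u (t, x) * (time_deriv T t * \<eta> \<rho> x) - \<bar>u (t, x)\<bar> powr p * (time_cutoff (t / T) * \<eta> \<rho> x))"

lemma Q_lebesgue [measurable]: "Q T \<in> sets lebesgue"
proof -
  have "open (Q T)" by (intro open_Times) auto
  then show ?thesis by (intro sets_completionI_sets) simp
qed

lemma time_deriv_bounds:
  obtains C where "0 < C"
    "\<And>T t. 0 < T \<Longrightarrow> 0 < t \<Longrightarrow> t < T \<Longrightarrow> 0 \<le> time_deriv T t"
    "\<And>T t. 0 < T \<Longrightarrow> 0 < t \<Longrightarrow> t < T \<Longrightarrow> time_deriv T t \<le> C * T powr (- \<alpha>) * time_cutoff (t / T) powr (1 / p)"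
    "\<And>T t e. 0 < T \<Longrightarrow> 0 < t \<Longrightarrow> t < T \<Longrightarrow> RL_right_deriv \<alpha> T (\<lambda>r. time_cutoff (r / T) * e) t = time_deriv T t * e"
proof -
  obtain C where C: "0 < C" and *: "\<And>T t. 0 < T \<Longrightarrow> 0 < t \<Longrightarrow> t < T \<Longrightarrow>
      \<exists>D. (\<forall>e. RL_right_deriv \<alpha> T (\<lambda>r. time_cutoff (r / T) * e) t = D * e) \<and>
          0 \<le> D \<and> D \<le> C * T powr (- \<alpha>) * time_cutoff (t / T) powr (1 / p)"
    using RL_right_deriv_time_cutoff[OF \<alpha> p] by metis
  show ?thesis
  proof (rule that[OF C])
    fix T t :: real assume T: "0 < T" "0 < t" "t < T"
    from *[OF T] obtain D where D: "\<And>e. RL_right_deriv \<alpha> T (\<lambda>r. time_cutoff (r / T) * e) t = D * e"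
      and D2: "0 \<le> D" "D \<le> C * T powr (- \<alpha>) * time_cutoff (t / T) powr (1 / p)" by blast
    have "time_deriv T t = D" using D[of 1] by (simp add: time_deriv_def)
    with D D2 show "0 \<le> time_deriv T t" "time_deriv T t \<le> C * T powr (- \<alpha>) * time_cutoff (t / T) powr (1 / p)"
      "\<And>e. RL_right_deriv \<alpha> T (\<lambda>r. time_cutoff (r / T) * e) t = time_deriv T t * e" by auto
  qed
qed

lemma weak_inequality:
  assumes T: "0 < T" and \<rho>: "0 < \<rho>"
  shows "set_integrable lebesgue (Q T) (\<lambda>(t, x). t powr \<sigma> * w x * (time_cutoff (t / T) * \<eta> \<rho> x))"
    and "set_integrable lebesgue (Q T) (\<lambda>(t, x). u (t, x) * (time_cutoff (t / T) * L\<eta> \<rho> x))"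
    and "set_integrable lebesgue (Q T) (excess T \<rho>)"
    and "source T \<rho> \<le> (LINT z:Q T|lebesgue. excess T \<rho> z)"
proof -
  obtain C where nonneg: "\<And>T t. 0 < T \<Longrightarrow> 0 < t \<Longrightarrow> t < T \<Longrightarrow> 0 \<le> time_deriv T t"
    and RL: "\<And>T t e. 0 < T \<Longrightarrow> 0 < t \<Longrightarrow> t < T \<Longrightarrow> RL_right_deriv \<alpha> T (\<lambda>r. time_cutoff (r / T) * e) t = time_deriv T t * e"
    using time_deriv_bounds by metis
  have L: "frac_laplacian s (\<lambda>y. time_cutoff (t / T) * \<eta> \<rho> y) x = time_cutoff (t / T) * L\<eta> \<rho> x" for t x
    using frac_laplacian_scale[OF \<rho> bump_prod_measurable, of s "time_cutoff (t / T)" x]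
    by (simp add: \<eta>_def L\<eta>_def)
  let ?U = "\<lambda>(t, x). u0 x * (time_deriv T t * \<eta> \<rho> x)"
  let ?P = "\<lambda>(t, x). \<bar>u (t, x)\<bar> powr p * (time_cutoff (t / T) * \<eta> \<rho> x)"
  let ?W = "\<lambda>(t, x). t powr \<sigma> * w x * (time_cutoff (t / T) * \<eta> \<rho> x)"
  let ?L = "\<lambda>(t, x). u (t, x) * (time_cutoff (t / T) * L\<eta> \<rho> x)"
  let ?D = "\<lambda>(t, x). u (t, x) * (time_deriv T t * \<eta> \<rho> x)"
  have e: "test_fun T \<rho> (t, x) = time_cutoff (t / T) * \<eta> \<rho> x" for t x
    by (simp add: test_fun_def \<eta>_def)
  note weak = sol[unfolded global_weak_solution_def, THEN conjunct2, rule_format, OF T test_function_test_fun[OF T \<rho>],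
      unfolded Let_def prod.case e L]
  \<comment> \<open>The Riemann-Liouville derivative is known to factor for 0 < t < T, so the
    replacement is made inside integrals over \<open>Q T\<close>.\<close>
  have cU: "set_integrable lebesgue (Q T) (\<lambda>(t, x). u0 x * RL_right_deriv \<alpha> T (\<lambda>r. time_cutoff (r / T) * \<eta> \<rho> x) t) \<longleftrightarrow> set_integrable lebesgue (Q T) ?U"
    "(LINT z:Q T|lebesgue. (case z of (t, x) \<Rightarrow> u0 x * RL_right_deriv \<alpha> T (\<lambda>r. time_cutoff (r / T) * \<eta> \<rho> x) t)) = (LINT z:Q T|lebesgue. ?U z)"
    by (rule set_integrable_cong[OF refl refl]; use RL[OF T] in auto)
      (rule set_lebesgue_integral_cong; use RL[OF T] in auto)
  have cD: "set_integrable lebesgue (Q T) (\<lambda>(t, x). u (t, x) * RL_right_deriv \<alpha> T (\<lambda>r. time_cutoff (r / T) * \<eta> \<rho> x) t) \<longleftrightarrow> set_integrable lebesgue (Q T) ?D"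
    "(LINT z:Q T|lebesgue. (case z of (t, x) \<Rightarrow> u (t, x) * RL_right_deriv \<alpha> T (\<lambda>r. time_cutoff (r / T) * \<eta> \<rho> x) t)) = (LINT z:Q T|lebesgue. ?D z)"
    by (rule set_integrable_cong[OF refl refl]; use RL[OF T] in auto)
      (rule set_lebesgue_integral_cong; use RL[OF T] in auto)
  from weak have I: "set_integrable lebesgue (Q T) ?P" "set_integrable lebesgue (Q T) ?W"
      "set_integrable lebesgue (Q T) ?L" "set_integrable lebesgue (Q T) ?D"
    and eq: "(LINT z:Q T|lebesgue. ?U z) + (LINT z:Q T|lebesgue. ?P z) + (LINT z:Q T|lebesgue. ?W z)
       = (LINT z:Q T|lebesgue. ?L z) + (LINT z:Q T|lebesgue. ?D z)"
    unfolding cU cD by blast+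
  show "set_integrable lebesgue (Q T) ?W" "set_integrable lebesgue (Q T) ?L" by (rule I)+
  have ex: "excess T \<rho> = (\<lambda>z. ?L z + ?D z - ?P z)"
    by (rule ext) (simp add: excess_def case_prod_beta)
  show "set_integrable lebesgue (Q T) (excess T \<rho>)"
    unfolding ex by (intro set_integral_diff set_integral_add I)
  have "(LINT z:Q T|lebesgue. excess T \<rho> z)
      = (LINT z:Q T|lebesgue. ?L z) + (LINT z:Q T|lebesgue. ?D z) - (LINT z:Q T|lebesgue. ?P z)"
    unfolding ex by (simp only: set_integral_diff set_integral_add I)
  moreover have "0 \<le> (LINT z:Q T|lebesgue. ?U z)"
    unfolding set_lebesgue_integral_def
  proof (rule integral_nonneg_AE)
    show "AE z in lebesgue. 0 \<le> indicat_real (Q T) z *\<^sub>R ?U z"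
      using AE_lebesgue_snd[OF u0_nonneg]
    proof eventually_elim
      case (elim z)
      then show ?case
        using nonneg[OF T, of "fst z"]
        by (cases "z \<in> Q T") (auto simp: case_prod_beta \<eta>_def bump_prod_bounds intro!: mult_nonneg_nonneg)
    qed
  qed
  ultimately show "source T \<rho> \<le> (LINT z:Q T|lebesgue. excess T \<rho> z)"
    using eq unfolding source_def by linarith
qed

lemma \<eta>_bounds: "0 \<le> \<eta> \<rho> x" "\<eta> \<rho> x \<le> 1"
  by (simp_all add: \<eta>_def bump_prod_bounds)

lemma \<eta>_measurable [measurable]: "\<eta> \<rho> \<in> borel_measurable borel"
  unfolding \<eta>_def[abs_def] by measurable

text \<open>\<open>w\<close> may change sign, so its integral against a given bump need not be
  positive. At large scales the bump approaches the constant \<open>bump_prod 0\<close>, and the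
  integral of \<open>w\<close> decides the sign; hence the restriction to large R.\<close>

lemma space_source_tendsto:
  "((\<lambda>\<rho>. LINT x|lborel. w x * \<eta> \<rho> x) \<longlongrightarrow> (LINT x|lborel. w x * bump_prod (0 :: real^'n))) at_top"
proof (rule integral_dominated_convergence_at_top[where w="\<lambda>x. norm (w x)"])
  have [measurable]: "w \<in> borel_measurable borel" using w_cont by (rule borel_measurable_continuous_onI)
  show "(\<lambda>x. w x * \<eta> \<rho> x) \<in> borel_measurable lborel" for \<rho> by measurable
  show "(\<lambda>x. w x * bump_prod (0 :: real^'n)) \<in> borel_measurable lborel" by measurable
  show "integrable lborel (\<lambda>x. norm (w x))"
    using w_int by (subst (asm) integrable_completion) auto
  show "\<forall>\<^sub>F \<rho> in at_top. AE x in lborel. norm (w x * \<eta> \<rho> x) \<le> norm (w x)"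
    using \<eta>_bounds by (intro always_eventually allI AE_I2) (simp add: abs_mult mult_left_le)
  show "AE x in lborel. ((\<lambda>\<rho>. w x * \<eta> \<rho> x) \<longlongrightarrow> w x * bump_prod (0 :: real^'n)) at_top"
  proof (rule AE_I2)
    fix x :: "real^'n"
    have "continuous_on UNIV (bump_prod :: real^'n \<Rightarrow> real)"
      unfolding bump_prod_def[abs_def]
      by (intro continuous_on_prod continuous_on_compose2[OF continuous_bump[of UNIV]] continuous_intros) auto
    then have "isCont (bump_prod :: real^'n \<Rightarrow> real) 0"
      by (simp add: continuous_on_eq_continuous_at)
    moreover have "((\<lambda>\<rho>::real. 1 / \<rho>) \<longlongrightarrow> 0) at_top" by real_asymp
    from tendsto_scaleR[OF this tendsto_const, of x]
    have "((\<lambda>\<rho>::real. (1 / \<rho>) *\<^sub>R x) \<longlongrightarrow> 0) at_top" by simp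
    ultimately have "((\<lambda>\<rho>. \<eta> \<rho> x) \<longlongrightarrow> bump_prod (0 :: real^'n)) at_top"
      unfolding \<eta>_def by (rule isCont_tendsto_compose)
    then show "((\<lambda>\<rho>. w x * \<eta> \<rho> x) \<longlongrightarrow> w x * bump_prod (0 :: real^'n)) at_top"
      by (intro tendsto_mult tendsto_const)
  qed
qed

lemma time_source_ge:
  obtains c where "0 < c" "\<And>T. 0 < T \<Longrightarrow> integrable lborel (\<lambda>t. indicator {0<..<T} t * (t powr \<sigma> * time_cutoff (t / T)))"
    "\<And>T. 0 < T \<Longrightarrow> c * T powr (\<sigma> + 1) \<le> (LINT t|lborel. indicator {0<..<T} t * (t powr \<sigma> * time_cutoff (t / T)))"
proof
  \<comment> \<open>On [T/8, T/4] the cutoff is at least exp(-4), and (t/T)^\<sigma> is at least the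
    smaller of its endpoint values, whatever the sign of \<sigma>. The length T/8 supplies the extra
    power of T.\<close>
  define m where "m = min ((1 / 8) powr \<sigma>) ((1 / 4) powr \<sigma>) * exp (- 4)"
  have m: "0 < m" by (simp add: m_def)
  then show "0 < m / 8" by simp
  have [measurable]: "time_cutoff \<in> borel_measurable borel"
    using continuous_time_cutoff by (auto intro: borel_measurable_continuous_onI)
  fix T :: real assume T: "0 < T"
  show I: "integrable lborel (\<lambda>t. indicator {0<..<T} t * (t powr \<sigma> * time_cutoff (t / T)))"
  proof (rule Bochner_Integration.integrable_bound)
    show "integrable lborel (\<lambda>t. indicator {0..T} t * t powr \<sigma>)"
      using set_integrable_lborel_powr(1)[OF \<sigma>, of T] T by (simp add: set_integrable_def)
    show "AE t in lborel. norm (indicator {0<..<T} t * (t powr \<sigma> * time_cutoff (t / T))) \<le> norm (indicator {0..T} t * t powr \<sigma>)"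
      by (intro AE_I2) (auto simp: indicator_def abs_mult time_cutoff_bounds mult_left_le)
  qed measurable
  have "(LINT t|lborel. indicator {T / 8..T / 4} t * (m * T powr \<sigma>))
      \<le> (LINT t|lborel. indicator {0<..<T} t * (t powr \<sigma> * time_cutoff (t / T)))"
  proof (rule integral_mono[OF _ I])
    fix t
    show "indicator {T / 8..T / 4} t * (m * T powr \<sigma>) \<le> indicator {0<..<T} t * (t powr \<sigma> * time_cutoff (t / T))"
    proof (cases "t \<in> {T / 8..T / 4}")
      case True
      define z where "z = t / T"
      have z: "1 / 8 \<le> z" "z \<le> 1 / 4" using True T by (auto simp: z_def field_simps)
      have "min ((1 / 8) powr \<sigma>) ((1 / 4) powr \<sigma>) \<le> z powr \<sigma>"
      proof (cases "0 \<le> \<sigma>")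
        case True
        then have "(1 / 8) powr \<sigma> \<le> z powr \<sigma>" using z by (intro powr_mono2) auto
        then show ?thesis by (rule min.coboundedI1)
      next
        case False
        then have "(1 / 4) powr \<sigma> \<le> z powr \<sigma>" using z by (intro powr_mono2') auto
        then show ?thesis by (rule min.coboundedI2)
      qed
      then have "m \<le> z powr \<sigma> * time_cutoff z"
        unfolding m_def using time_cutoff_ge[OF z(2)] by (intro mult_mono) auto
      then have "m * T powr \<sigma> \<le> z powr \<sigma> * time_cutoff z * T powr \<sigma>" by (rule mult_right_mono) simp
      also have "\<dots> = (z * T) powr \<sigma> * time_cutoff z" by (simp only: powr_mult mult_ac)
      also have "z * T = t" using T by (simp add: z_def)
      finally show ?thesis using True T by (auto simp: z_def indicator_def)
    qed (auto simp: indicator_def time_cutoff_bounds)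
  qed (simp add: integrable_indicator_iff emeasure_lborel_Icc_eq)
  moreover have "(LINT t|lborel. indicator {T / 8..T / 4} t * (m * T powr \<sigma>)) = m / 8 * T powr (\<sigma> + 1)"
    using T by (simp add: powr_add)
  ultimately show "m / 8 * T powr (\<sigma> + 1) \<le> (LINT t|lborel. indicator {0<..<T} t * (t powr \<sigma> * time_cutoff (t / T)))"
    by linarith
qed

text \<open>The integrand is a product of a time factor and a space factor. The threshold for \<rho>
  comes from the space factor and is therefore independent of T.\<close>

lemma source_ge:
  obtains W \<rho>0 where "0 < W" "0 < \<rho>0" "\<And>T \<rho>. 0 < T \<Longrightarrow> \<rho>0 \<le> \<rho> \<Longrightarrow> W * T powr (\<sigma> + 1) \<le> source T \<rho>"
proof -
  have [measurable]: "w \<in> borel_measurable borel" using w_cont by (rule borel_measurable_continuous_onI)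
  have w_int': "integrable lborel w" and w_pos': "0 < (LINT x|lborel. w x)"
    using w_int w_pos by (simp_all add: integrable_completion integral_completion)
  obtain c where c: "0 < c" and f_int: "\<And>T. 0 < T \<Longrightarrow> integrable lborel (\<lambda>t. indicator {0<..<T} t * (t powr \<sigma> * time_cutoff (t / T)))"
    and f_ge: "\<And>T. 0 < T \<Longrightarrow> c * T powr (\<sigma> + 1) \<le> (LINT t|lborel. indicator {0<..<T} t * (t powr \<sigma> * time_cutoff (t / T)))"
    by (rule time_source_ge) blast
  define b where "b = (LINT x|lborel. w x * bump_prod (0 :: real^'n))"
  have b: "0 < b" using w_pos' bump_prod_0_pos[where 'a="real^'n"] by (simp add: b_def)
  have "\<forall>\<^sub>F \<rho> in at_top. b / 2 < (LINT x|lborel. w x * \<eta> \<rho> x)"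
    using space_source_tendsto b unfolding b_def[symmetric] by (intro order_tendstoD(1)[where a="b / 2"]) auto
  then obtain \<rho>1 where \<rho>1: "\<And>\<rho>. \<rho>1 \<le> \<rho> \<Longrightarrow> b / 2 < (LINT x|lborel. w x * \<eta> \<rho> x)"
    by (auto simp: eventually_at_top_linorder)
  show ?thesis
  proof (rule that[of "c * (b / 2)" "max 1 \<rho>1"])
    show "0 < c * (b / 2)" using b c by simp
    fix T \<rho> :: real assume T: "0 < T" and \<rho>: "max 1 \<rho>1 \<le> \<rho>"
    have g_int: "integrable lborel (\<lambda>x. w x * \<eta> \<rho> x)"
      by (rule Bochner_Integration.integrable_bound[OF w_int'])
        (use \<eta>_bounds in \<open>auto simp: abs_mult mult_left_le\<close>)
    have "source T \<rho> = (LINT z|lebesgue. (case z of (t, x) \<Rightarrow>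
        (indicator {0<..<T} t * (t powr \<sigma> * time_cutoff (t / T))) * (w x * \<eta> \<rho> x)))"
      unfolding source_def set_lebesgue_integral_def
      by (rule Bochner_Integration.integral_cong[OF refl]) (auto simp: indicator_def)
    also have "\<dots> = (LINT t|lborel. indicator {0<..<T} t * (t powr \<sigma> * time_cutoff (t / T))) * (LINT x|lborel. w x * \<eta> \<rho> x)"
      by (rule integral_lborel_Times[OF f_int[OF T] g_int])
    finally have eq: "source T \<rho> = (LINT t|lborel. indicator {0<..<T} t * (t powr \<sigma> * time_cutoff (t / T))) * (LINT x|lborel. w x * \<eta> \<rho> x)" .
    have "c * T powr (\<sigma> + 1) * (b / 2) \<le> source T \<rho>"
      unfolding eq using f_ge[OF T] \<rho>1[of \<rho>] \<rho> b c by (intro mult_mono order_trans[OF _ f_ge[OF T]]) auto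
    then show "c * (b / 2) * T powr (\<sigma> + 1) \<le> source T \<rho>" by (simp add: mult_ac)
  qed simp
qed

text \<open>
  A weak solution makes \<open>u (-\<Delta>)\<^sup>s \<phi>\<close> integrable by definition, and \<open>(-\<Delta>)\<^sup>s \<phi>\<close> decays no faster than
  \<open>\<bar>x\<bar>\<^sup>-\<^sup>N\<^sup>-\<^sup>2\<^sup>s\<close>.
\<close>
lemma weighted_u_integrable:
  assumes T: "0 < T"
  shows "set_integrable lebesgue (Q T) (\<lambda>(t, x). \<bar>u (t, x)\<bar> * (1 + norm x) powr (- (real CARD('n) + 2 * s)))"
proof -
  define d where "d = real CARD('n) + 2 * s"
  have d: "0 < d" using s by (simp add: d_def add_nonneg_pos)
  obtain c r where c: "0 < c"
    and L: "\<And>x::real^'n. r \<le> norm x \<Longrightarrow> c * (1 + norm x) powr (- d) \<le> \<bar>frac_laplacian s bump_prod x\<bar>"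
    using frac_laplacian_bump_prod_bounds[OF s, where 'n='n] unfolding d_def by metis
  have u_meas: "(\<lambda>z. indicator ({0..} \<times> UNIV) z *\<^sub>R u z) \<in> borel_measurable lebesgue"
  proof -
    have "closed ({0::real..} \<times> (UNIV :: (real^'n) set))" by (intro closed_Times) auto
    then have "{0::real..} \<times> (UNIV :: (real^'n) set) \<in> sets lebesgue" by (intro sets_completionI_sets) simp
    moreover have "u \<in> borel_measurable (lebesgue_on ({0..} \<times> UNIV))"
      using sol by (simp add: global_weak_solution_def Lp_loc_spacetime_def)
    ultimately show ?thesis by (subst (asm) borel_measurable_restrict_space_iff) auto
  qed
  \<comment> \<open>For |x| < r no lower bound on the Laplacian is at hand; that part rests on local
    integrability and |u| \<le> 1 + |u|^p.\<close>
  let ?K = "{0..T} \<times> cball (0::real^'n) r"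
  have K: "compact ?K" by (intro compact_Times compact_Icc compact_cball)
  have "?K \<subseteq> {0..} \<times> UNIV" by auto
  with K have I1: "set_integrable lebesgue ?K (\<lambda>z. \<bar>u z\<bar> powr p)"
    using sol by (simp add: global_weak_solution_def Lp_loc_spacetime_def)
  have "?K \<in> lmeasurable" using K by (rule lmeasurable_compact)
  then have I2: "integrable lebesgue (indicat_real ?K)"
    by (intro integrable_real_indicator) (auto simp: fmeasurable_def)
  \<comment> \<open>With the time horizon 4 T the cutoff is at least exp(-4) on all of (0, T),
    whereas the one for T vanishes from T/2 on.\<close>
  let ?F = "\<lambda>z. case z of (t, x) \<Rightarrow> u (t, x) * (time_cutoff (t / (4 * T)) * L\<eta> 1 x)"
  have I3: "set_integrable lebesgue (Q (4 * T)) ?F"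
    using weak_inequality(2)[of "4 * T" 1] T by simp
  have W: "(\<lambda>z::real \<times> (real^'n). (1 + norm (snd z)) powr (- d)) \<in> borel_measurable lebesgue"
  proof (rule measurable_completion)
    have "continuous_on UNIV (\<lambda>z::real \<times> (real^'n). (1 + norm (snd z)) powr (- d))"
      by (intro continuous_intros) (smt (verit) norm_ge_zero)
    then show "(\<lambda>z::real \<times> (real^'n). (1 + norm (snd z)) powr (- d)) \<in> borel_measurable lborel"
      by (simp add: borel_measurable_continuous_onI)
  qed
  show ?thesis
    unfolding set_integrable_def d_def[symmetric]
  proof (rule Bochner_Integration.integrable_bound)
    show "integrable lebesgue (\<lambda>z. (indicat_real ?K z + indicator ?K z *\<^sub>R \<bar>u z\<bar> powr p)
        + exp 4 / c * norm (indicator (Q (4 * T)) z *\<^sub>R ?F z))"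
      using I1 I2 I3 unfolding set_integrable_def
      by (intro Bochner_Integration.integrable_add integrable_mult_right integrable_norm)
    have "(\<lambda>z. indicat_real (Q T) z *\<^sub>R (case z of (t, x) \<Rightarrow> \<bar>u (t, x)\<bar> * (1 + norm x) powr - d))
        = (\<lambda>z. indicat_real (Q T) z * (\<bar>indicator ({0..} \<times> UNIV) z *\<^sub>R u z\<bar> * (1 + norm (snd z)) powr (- d)))"
      by (rule ext) (auto simp: indicator_def)
    then show "(\<lambda>z. indicat_real (Q T) z *\<^sub>R (case z of (t, x) \<Rightarrow> \<bar>u (t, x)\<bar> * (1 + norm x) powr - d)) \<in> borel_measurable lebesgue"
      using W u_meas Q_lebesgue by (auto intro!: borel_measurable_times borel_measurable_abs borel_measurable_indicator)
    show "AE z in lebesgue. norm (indicat_real (Q T) z *\<^sub>R (case z of (t, x) \<Rightarrow> \<bar>u (t, x)\<bar> * (1 + norm x) powr - d))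
        \<le> norm ((indicat_real ?K z + indicator ?K z *\<^sub>R \<bar>u z\<bar> powr p) + exp 4 / c * norm (indicator (Q (4 * T)) z *\<^sub>R ?F z))"
    proof (rule AE_I2)
      fix z :: "real \<times> (real^'n)"
      obtain t x where z: "z = (t, x)" by (cases z)
      let ?B = "(indicat_real ?K z + indicator ?K z *\<^sub>R \<bar>u z\<bar> powr p) + exp 4 / c * norm (indicator (Q (4 * T)) z *\<^sub>R ?F z)"
      have nonneg: "0 \<le> indicat_real ?K z + indicator ?K z *\<^sub>R \<bar>u z\<bar> powr p"
        "0 \<le> exp 4 / c * norm (indicator (Q (4 * T)) z *\<^sub>R ?F z)"
        using c by auto
      have "indicat_real (Q T) z * (\<bar>u z\<bar> * (1 + norm x) powr (- d)) \<le> ?B"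
      proof (cases "z \<in> Q T")
        case True
        then have t: "0 < t" "t < T" by (auto simp: z)
        show ?thesis
        proof (cases "r \<le> norm x")
          case True
          have "exp (- 4) * (c * (1 + norm x) powr (- d)) \<le> time_cutoff (t / (4 * T)) * \<bar>frac_laplacian s bump_prod x\<bar>"
            using t T c L[OF True] by (intro mult_mono time_cutoff_ge) (auto simp: field_simps time_cutoff_bounds)
          then have "\<bar>u z\<bar> * (exp (- 4) * (c * (1 + norm x) powr (- d))) \<le> norm (?F z)"
            by (simp add: z abs_mult time_cutoff_bounds L\<eta>_def mult_left_mono)
          then have "exp 4 / c * (\<bar>u z\<bar> * (exp (- 4) * (c * (1 + norm x) powr (- d)))) \<le> exp 4 / c * norm (?F z)"
            using c by (intro mult_left_mono) auto
          also have "exp 4 / c * (\<bar>u z\<bar> * (exp (- 4) * (c * (1 + norm x) powr (- d)))) = \<bar>u z\<bar> * (1 + norm x) powr (- d)"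
            using c by (simp add: exp_minus field_simps)
          also have "exp 4 / c * norm (?F z) = exp 4 / c * norm (indicator (Q (4 * T)) z *\<^sub>R ?F z)"
            using t by (simp add: z)
          finally have le: "\<bar>u z\<bar> * (1 + norm x) powr (- d) \<le> exp 4 / c * norm (indicator (Q (4 * T)) z *\<^sub>R ?F z)" .
          have "indicat_real (Q T) z = 1" using \<open>z \<in> Q T\<close> by simp
          then show ?thesis using le nonneg(1) by (simp only: mult_1)
        next
          case False
          have "(1 + norm x) powr (- d) \<le> 1" using d powr_mono2'[of "- d" 1 "1 + norm x"] by simp
          then have "\<bar>u z\<bar> * (1 + norm x) powr (- d) \<le> \<bar>u z\<bar>" by (simp add: mult_left_le)
          also have "\<bar>u z\<bar> \<le> 1 + \<bar>u z\<bar> powr p"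
          proof (cases "\<bar>u z\<bar> \<le> 1")
            case False
            then have "\<bar>u z\<bar> powr 1 \<le> \<bar>u z\<bar> powr p" using p by (intro powr_mono) auto
            then show ?thesis by simp
          qed (simp add: add_increasing2)
          also have "\<dots> = indicat_real ?K z + indicator ?K z *\<^sub>R \<bar>u z\<bar> powr p"
            using False t by (simp add: z)
          finally show ?thesis using nonneg(2) \<open>z \<in> Q T\<close> by simp
        qed
      qed (use nonneg in simp)
      then show "norm (indicat_real (Q T) z *\<^sub>R (case z of (t, x) \<Rightarrow> \<bar>u (t, x)\<bar> * (1 + norm x) powr - d)) \<le> norm ?B"
        using nonneg by (simp add: z abs_mult)
    qed
  qed
qed

section \<open>Young's inequality and the limit over dyadic scales\<close>

lemma L\<eta>_sum_bound:
  obtains C where "0 < C" "\<And>R K x. 0 < R \<Longrightarrow>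
    \<bar>\<Sum>k\<le>K. (2 ^ k) powr (- (real CARD('n) + 2 * s)) * L\<eta> (2 ^ k * R) x\<bar>
      \<le> C * R powr (- 2 * s) * (1 + norm x / R) powr (- (real CARD('n) + 2 * s))"
proof -
  define d where "d = real CARD('n) + 2 * s"
  have d: "0 < d" using s by (simp add: d_def add_nonneg_pos)
  obtain C where C: "0 < C" and L: "\<And>x::real^'n. \<bar>frac_laplacian s bump_prod x\<bar> \<le> C * (1 + norm x) powr (- d)"
    using frac_laplacian_bump_prod_bounds[OF s, where 'n='n] unfolding d_def by metis
  define q where "q = 1 / (1 - 2 powr (- 2 * s))"
  have q: "0 < q" using s powr_less_one[of 2 "- 2 * s"] by (simp add: q_def)
  show ?thesis
  proof (rule that[of "C * q"], unfold d_def[symmetric])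
    show "0 < C * q" using C q by simp
    fix R :: real and K :: nat and x :: "real^'n" assume R: "0 < R"
    let ?y = "norm x / R"
    have "\<bar>L\<eta> (2 ^ k * R) x\<bar> \<le> (C * R powr (- 2 * s)) * ((2 ^ k) powr (- 2 * s) * (1 + ?y / 2 ^ k) powr (- d))" for k
    proof -
      have "norm ((1 / (2 ^ k * R)) *\<^sub>R x) = ?y / 2 ^ k" using R by (simp add: field_simps)
      moreover have "(2 ^ k * R) powr (- 2 * s) = (2 ^ k) powr (- 2 * s) * R powr (- 2 * s)" by (rule powr_mult)
      ultimately have "\<bar>L\<eta> (2 ^ k * R) x\<bar> \<le> ((2 ^ k) powr (- 2 * s) * R powr (- 2 * s)) * (C * (1 + ?y / 2 ^ k) powr (- d))"
        unfolding L\<eta>_def abs_mult using L[of "(1 / (2 ^ k * R)) *\<^sub>R x"] by (intro mult_mono) auto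
      then show ?thesis by (simp only: mult_ac)
    qed
    then have "\<bar>\<Sum>k\<le>K. (2 ^ k) powr (- d) * L\<eta> (2 ^ k * R) x\<bar>
        \<le> (\<Sum>k\<le>K. (2 ^ k) powr (- d) * ((C * R powr (- 2 * s)) * ((2 ^ k) powr (- 2 * s) * (1 + ?y / 2 ^ k) powr (- d))))"
      by (intro order_trans[OF sum_abs] sum_mono) (simp add: abs_mult mult_left_mono)
    also have "\<dots> = (C * R powr (- 2 * s)) * (\<Sum>k\<le>K. (2 ^ k) powr (- d) * ((2 ^ k) powr (- 2 * s) * (1 + ?y / 2 ^ k) powr (- d)))"
      unfolding sum_distrib_left by (simp only: mult.left_commute)
    also have "\<dots> \<le> (C * R powr (- 2 * s)) * (q * (1 + ?y) powr (- d))"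
      unfolding q_def using C s d R by (intro mult_left_mono dyadic_sum_decay(1)) auto
    finally show "\<bar>\<Sum>k\<le>K. (2 ^ k) powr (- d) * L\<eta> (2 ^ k * R) x\<bar> \<le> C * q * R powr (- 2 * s) * (1 + ?y) powr (- d)"
      by (simp only: mult_ac)
  qed
qed

definition "\<omega> R x = (1 + norm x / R) powr (- (real CARD('n) + 2 * s))" for R and x :: "real^'n"

text \<open>
  As \<open>K\<close> grows, this superposition of compactly supported bumps dominates a multiple of the
  weight \<open>\<omega> R\<close> on balls of radius \<open>2\<^sup>K R/2\<close>, while its fractional Laplacian stays below a multiple of \<open>\<omega> R\<close>.
\<close>
definition "\<Phi> R K x = (\<Sum>k\<le>K. (2 ^ k) powr (- (real CARD('n) + 2 * s)) * \<eta> (2 ^ k * R) x)" for R and K :: nat and x :: "real^'n"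

text \<open>By linearity, the excess belonging to the space factor
  \<open>\<Phi> R K\<close>.\<close>

definition "total_excess T R K z = (\<Sum>k\<le>K. (2 ^ k) powr (- (real CARD('n) + 2 * s)) * excess T (2 ^ k * R) z)" for T R :: real and K :: nat

lemma total_excess_le:
  obtains C where "0 < C"
    "\<And>T R K t x. 0 < T \<Longrightarrow> 0 < R \<Longrightarrow> (t, x) \<in> Q T \<Longrightarrow>
      total_excess T R K (t, x) \<le> C * T powr (- \<alpha> * (p / (p - 1))) * \<Phi> R K x + C * R powr (- 2 * s * (p / (p - 1))) * \<omega> R x
        + (if 2 ^ K * R / 2 < norm x then C * R powr (- 2 * s) * (\<bar>u (t, x)\<bar> * \<omega> R x) else 0)"
proof -
  define d where "d = real CARD('n) + 2 * s"
  have d: "0 < d" using s by (simp add: d_def add_nonneg_pos)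
  define p' where "p' = p / (p - 1)"
  obtain CD where CD: "0 < CD"
    and D0: "\<And>T t. 0 < T \<Longrightarrow> 0 < t \<Longrightarrow> t < T \<Longrightarrow> 0 \<le> time_deriv T t"
    and D: "\<And>T t. 0 < T \<Longrightarrow> 0 < t \<Longrightarrow> t < T \<Longrightarrow> time_deriv T t \<le> CD * T powr (- \<alpha>) * time_cutoff (t / T) powr (1 / p)"
    by (rule time_deriv_bounds) blast
  obtain CL where CL: "0 < CL" and L: "\<And>R K x. 0 < R \<Longrightarrow>
    \<bar>\<Sum>k\<le>K. (2 ^ k) powr (- d) * L\<eta> (2 ^ k * R) x\<bar> \<le> CL * R powr (- 2 * s) * \<omega> R x"
    unfolding d_def \<omega>_def by (rule L\<eta>_sum_bound) blast
  define c where "c = exp (- 4) ^ CARD('n) * 4 powr (- d)"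
  have c: "0 < c" by (simp add: c_def)
  have \<Phi>_ge: "c * \<omega> R x \<le> \<Phi> R K x" if "0 < R" "norm x \<le> 2 ^ K * R / 2" for R K x
    using dyadic_bump_sum_ge[OF d that] by (simp add: c_def \<omega>_def \<Phi>_def \<eta>_def d_def)
  define k1 where "k1 = (1 / 2) powr (- (1 / (p - 1)))"
  define k2 where "k2 = (c / 2) powr (- (1 / (p - 1)))"
  have k: "0 \<le> k1" "0 \<le> k2" by (simp_all add: k1_def k2_def)
  define C where "C = k1 * CD powr p' + k2 * CL powr p' + CL"
  have C: "k1 * CD powr p' \<le> C" "k2 * CL powr p' \<le> C" "CL \<le> C" "0 < C"
    using k CL by (auto simp: C_def add_nonneg_pos)
  show ?thesis
  proof (rule that[OF C(4)], unfold p'_def[symmetric])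
    fix T R :: real and K :: nat and t :: real and x :: "real^'n"
    assume T: "0 < T" and R: "0 < R" and z: "(t, x) \<in> Q T"
    then have t: "0 < t" "t < T" by auto
    define v where "v = time_cutoff (t / T)"
    define U where "U = \<bar>u (t, x)\<bar>"
    define y where "y = U * v powr (1 / p)"
    define S where "S = (\<Sum>k\<le>K. (2 ^ k) powr (- d) * L\<eta> (2 ^ k * R) x)"
    define A where "A = CD * T powr (- \<alpha>)"
    define B where "B = CL * R powr (- 2 * s)"
    have v: "0 \<le> v" "v \<le> 1" by (simp_all add: v_def time_cutoff_bounds)
    \<comment> \<open>The Laplacian term carries v rather than v^(1/p); as 0 \<le> v \<le> 1, it can
      be expressed in the same variable y.\<close>
    have vp: "v \<le> v powr (1 / p)" "v powr (1 / p) \<le> 1"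
    proof -
      show "v powr (1 / p) \<le> 1" using v p by (intro powr_le1) auto
      show "v \<le> v powr (1 / p)"
        using v p powr_mono'[of "1 / p" 1 v] by (cases "v = 0") auto
    qed
    have U: "0 \<le> U" and y: "0 \<le> y" and AB: "0 \<le> A" "0 \<le> B"
      using CD CL by (simp_all add: U_def y_def A_def B_def)
    have yp: "y powr p = U powr p * v"
      using p v by (simp add: y_def powr_mult powr_powr)
    have \<Phi>0: "0 \<le> \<Phi> R K x" unfolding \<Phi>_def by (intro sum_nonneg mult_nonneg_nonneg) (auto simp: \<eta>_bounds)
    have \<omega>0: "0 \<le> \<omega> R x" by (simp add: \<omega>_def)
    have Y1: "A * y \<le> 1 / 2 * y powr p + k1 * A powr p'"
      unfolding k1_def p'_def using p AB y by (intro young_with_small_constant) auto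
    have Y2: "B * y \<le> c / 2 * y powr p + k2 * B powr p'"
      unfolding k2_def p'_def using p AB y c by (intro young_with_small_constant) auto
    have A': "k1 * A powr p' \<le> C * T powr (- \<alpha> * p')"
      using C(1) by (simp add: A_def powr_mult powr_powr mult_right_mono flip: mult.assoc)
    have B': "k2 * B powr p' \<le> C * R powr (- 2 * s * p')"
      using C(2) by (simp add: B_def powr_mult powr_powr mult_right_mono flip: mult.assoc)
    have "total_excess T R K (t, x) = u (t, x) * (v * S) + u (t, x) * (time_deriv T t * \<Phi> R K x) - U powr p * (v * \<Phi> R K x)"
      unfolding total_excess_def excess_def S_def \<Phi>_def v_def U_def d_def
      by (simp add: sum_distrib_left sum.distrib sum_subtractf algebra_simps)
    moreover have "u (t, x) * (v * S) \<le> y * (B * \<omega> R x)"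
    proof -
      have "u (t, x) * (v * S) \<le> \<bar>u (t, x) * (v * S)\<bar>" by simp
      also have "\<dots> = U * v * \<bar>S\<bar>" using v by (simp add: U_def abs_mult)
      also have "\<dots> \<le> (U * v powr (1 / p)) * (B * \<omega> R x)"
        using L[OF R, where x=x and K=K] U vp v by (intro mult_mono mult_left_mono) (auto simp: S_def B_def)
      finally show ?thesis by (simp add: y_def)
    qed
    moreover have "u (t, x) * (time_deriv T t * \<Phi> R K x) \<le> A * y * \<Phi> R K x"
    proof -
      have "u (t, x) * (time_deriv T t * \<Phi> R K x) \<le> U * (time_deriv T t * \<Phi> R K x)"
        unfolding U_def using D0[OF T t] \<Phi>0 by (intro mult_right_mono) auto
      also have "\<dots> \<le> U * ((A * v powr (1 / p)) * \<Phi> R K x)"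
        using D[OF T t] U \<Phi>0 by (intro mult_left_mono mult_right_mono) (auto simp: A_def v_def)
      finally show ?thesis by (simp add: y_def mult_ac)
    qed
    moreover have "A * y * \<Phi> R K x \<le> 1 / 2 * y powr p * \<Phi> R K x + C * T powr (- \<alpha> * p') * \<Phi> R K x"
    proof -
      have "A * y * \<Phi> R K x \<le> (1 / 2 * y powr p + C * T powr (- \<alpha> * p')) * \<Phi> R K x"
        using Y1 A' \<Phi>0 by (intro mult_right_mono) auto
      then show ?thesis by (simp add: distrib_right)
    qed
    moreover have "y * (B * \<omega> R x) \<le> 1 / 2 * y powr p * \<Phi> R K x + C * R powr (- 2 * s * p') * \<omega> R x
        + (if 2 ^ K * R / 2 < norm x then C * R powr (- 2 * s) * (U * \<omega> R x) else 0)"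
    proof (cases "2 ^ K * R / 2 < norm x")
      case True
      have "y \<le> U" using vp U by (simp add: y_def mult_left_le)
      then have "y * (B * \<omega> R x) \<le> U * (C * R powr (- 2 * s) * \<omega> R x)"
        unfolding B_def using C(3) U \<omega>0 AB CL y by (intro mult_mono mult_right_mono mult_nonneg_nonneg) auto
      moreover have "0 \<le> 1 / 2 * y powr p * \<Phi> R K x" "0 \<le> C * R powr (- 2 * s * p') * \<omega> R x"
        using \<Phi>0 \<omega>0 C by auto
      ultimately show ?thesis using True by (simp add: mult_ac)
    next
      case False
      have "B * y * \<omega> R x \<le> (c / 2 * y powr p + C * R powr (- 2 * s * p')) * \<omega> R x"
        using Y2 B' \<omega>0 by (intro mult_right_mono) auto
      also have "\<dots> = 1 / 2 * y powr p * (c * \<omega> R x) + C * R powr (- 2 * s * p') * \<omega> R x"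
        by (simp add: algebra_simps)
      also have "1 / 2 * y powr p * (c * \<omega> R x) \<le> 1 / 2 * y powr p * \<Phi> R K x"
        using \<Phi>_ge[OF R, of x K] False by (intro mult_left_mono) auto
      finally show ?thesis using False by (simp add: mult_ac)
    qed
    moreover have "U powr p * (v * \<Phi> R K x) = y powr p * \<Phi> R K x" by (simp add: yp)
    ultimately show "total_excess T R K (t, x) \<le> C * T powr (- \<alpha> * p') * \<Phi> R K x + C * R powr (- 2 * s * p') * \<omega> R x
        + (if 2 ^ K * R / 2 < norm x then C * R powr (- 2 * s) * (\<bar>u (t, x)\<bar> * \<omega> R x) else 0)"
      unfolding U_def by linarith
  qed
qed

lemma \<omega>_integrable: "0 < R \<Longrightarrow> integrable lborel (\<omega> R)"
  and integral_\<omega>: "0 < R \<Longrightarrow> (LINT x|lborel. \<omega> R x) = R ^ CARD('n) * (LINT x|lborel. \<omega> 1 x)"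
proof -
  assume R: "0 < R"
  have "integrable lborel (\<lambda>x::real^'n. (1 + norm x) powr (- (real CARD('n) + 2 * s)))"
    using s by (intro integrable_one_plus_norm_powr) simp
  then have I: "integrable lborel (\<omega> 1)" unfolding \<omega>_def by simp
  have eq: "\<omega> R = (\<lambda>x. \<omega> 1 ((1 / R) *\<^sub>R x))"
    using R by (auto simp: \<omega>_def)
  show "integrable lborel (\<omega> R)" unfolding eq using integrable_lborel_dilation[OF R I] .
  show "(LINT x|lborel. \<omega> R x) = R ^ CARD('n) * (LINT x|lborel. \<omega> 1 x)"
    unfolding eq using integral_lborel_dilation[OF R I] by simp
qed

text \<open>The bump of scale k has mass proportional to (2^k R)^N, and its weight reduces this to
  R^N 2^(-2sk). The bound is uniform in K, as the limit K -> infinity requires.\<close>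

lemma \<Phi>_integrable: "0 < R \<Longrightarrow> integrable lborel (\<Phi> R K)"
  and integral_\<Phi>_le: "0 < R \<Longrightarrow> (LINT x|lborel. \<Phi> R K x)
    \<le> R ^ CARD('n) * (1 / (1 - 2 powr (- 2 * s)) * (LINT x|lborel. bump_prod (x :: real^'n)))"
proof -
  assume R: "0 < R"
  define d where "d = real CARD('n) + 2 * s"
  let ?I = "LINT x|lborel. bump_prod (x :: real^'n)"
  have I: "integrable lborel (\<eta> (2 ^ k * R))" and
    J: "(LINT x|lborel. \<eta> (2 ^ k * R) x) = (2 ^ k * R) ^ CARD('n) * ?I" for k :: nat
    using integrable_lborel_dilation[of "2 ^ k * R" "bump_prod :: real^'n \<Rightarrow> real"]
      integral_lborel_dilation[of "2 ^ k * R" "bump_prod :: real^'n \<Rightarrow> real"] R integrable_bump_prod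
    by (simp_all add: \<eta>_def[abs_def])
  show "integrable lborel (\<Phi> R K)"
    unfolding \<Phi>_def[abs_def] using I by (intro Bochner_Integration.integrable_sum integrable_mult_right)
  have h: "(2 ^ k) powr (- d) * ((2 ^ k * R) ^ CARD('n) * ?I) = (2 ^ k) powr (- 2 * s) * (R ^ CARD('n) * ?I)" for k :: nat
  proof -
    have "(2::real) ^ k = 2 powr real k" by (simp add: powr_realpow)
    then have "(2 ^ k) powr (- d) * (2 ^ k) ^ CARD('n) = (2::real) powr (real k * (- d)) * 2 powr (real CARD('n) * real k)"
      by (simp add: powr_powr powr_power)
    also have "\<dots> = 2 powr (real k * (- 2 * s))"
      by (simp add: d_def algebra_simps flip: powr_add)
    also have "\<dots> = (2 ^ k) powr (- 2 * s)" by (simp add: powr_powr flip: powr_realpow)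
    finally show ?thesis by (simp only: power_mult_distrib mult.assoc[symmetric])
  qed
  have "(LINT x|lborel. \<Phi> R K x) = (\<Sum>k\<le>K. (2 ^ k) powr (- d) * ((2 ^ k * R) ^ CARD('n) * ?I))"
    unfolding \<Phi>_def d_def[symmetric] using I by (simp add: J)
  also have "\<dots> = (\<Sum>k\<le>K. (2 ^ k) powr (- 2 * s) * (R ^ CARD('n) * ?I))"
    by (simp only: h)
  also have "\<dots> = (\<Sum>k\<le>K. (2 ^ k) powr (- 2 * s)) * (R ^ CARD('n) * ?I)" by (simp only: sum_distrib_right)
  also have "\<dots> \<le> 1 / (1 - 2 powr (- 2 * s)) * (R ^ CARD('n) * ?I)"
    using R dyadic_sum_decay(2)[OF s(1), of 1 0 K]
    by (intro mult_right_mono mult_nonneg_nonneg Bochner_Integration.integral_nonneg) (auto simp: bump_prod_bounds)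
  finally show "(LINT x|lborel. \<Phi> R K x) \<le> R ^ CARD('n) * (1 / (1 - 2 powr (- 2 * s)) * ?I)"
    by (simp only: mult.left_commute)
qed

lemma
  assumes T: "0 < T" and g: "integrable lborel g"
  shows set_integrable_Q_snd: "set_integrable lebesgue (Q T) (\<lambda>z. g (snd z))"
    and integral_Q_snd: "(LINT z:Q T|lebesgue. g (snd z)) = T * (LINT x|lborel. g x)"
proof -
  have f: "integrable lborel (indicat_real {0<..<T})"
    by (rule integrable_real_indicator) (use T in auto)
  have eq: "(\<lambda>z. indicat_real (Q T) z *\<^sub>R g (snd z)) = (\<lambda>(t, x). indicat_real {0<..<T} t * g x)"
    by (rule ext) (auto simp: indicator_def)
  show "set_integrable lebesgue (Q T) (\<lambda>z. g (snd z))"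
    unfolding set_integrable_def eq by (rule integrable_lborel_Times[OF f g])
  show "(LINT z:Q T|lebesgue. g (snd z)) = T * (LINT x|lborel. g x)"
    unfolding set_lebesgue_integral_def eq integral_lborel_Times[OF f g] using T by simp
qed

text \<open>For R \<ge> 1 the ratio of \<open>\<omega> R\<close> to \<open>\<omega> 1\<close> is at
  most R^(N+2s), since (1 + |x|)/(1 + |x|/R) \<le> R.\<close>

lemma weighted_u_integrable_scaled:
  assumes T: "0 < T" and R: "1 \<le> R"
  shows "set_integrable lebesgue (Q T) (\<lambda>z. \<bar>u z\<bar> * \<omega> R (snd z))"
proof -
  define d where "d = real CARD('n) + 2 * s"
  have d: "0 < d" using s by (simp add: d_def add_nonneg_pos)
  have R0: "0 < R" using R by simp
  let ?f = "\<lambda>z. indicator (Q T) z *\<^sub>R (case z of (t, x) \<Rightarrow> \<bar>u (t, x)\<bar> * (1 + norm x) powr (- d))"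
  have I: "integrable lebesgue ?f"
    using weighted_u_integrable[OF T] by (simp add: set_integrable_def d_def)
  let ?r = "\<lambda>z :: real \<times> (real^'n). ((1 + norm (snd z)) / (1 + norm (snd z) / R)) powr d"
  have r: "\<omega> R x = (1 + norm x) powr (- d) * ((1 + norm x) / (1 + norm x / R)) powr d" for x
  proof -
    have "1 + norm x \<noteq> 0" using norm_ge_zero[of x] by linarith
    then have "(1 + norm x) powr (- d) * (1 + norm x) powr d = 1" by (simp flip: powr_add)
    then show ?thesis
      unfolding \<omega>_def d_def[symmetric] powr_divide times_divide_eq_right powr_minus[of "1 + norm x / R"]
      by (simp add: inverse_eq_divide)
  qed
  have r_le: "?r z \<le> R powr d" and r0: "0 \<le> ?r z" for z
  proof -
    have "0 \<le> norm (snd z) / R" using R by simp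
    then have "0 < 1 + norm (snd z) / R" by linarith
    moreover have "1 + norm (snd z) \<le> R * (1 + norm (snd z) / R)" using R by (simp add: distrib_left)
    ultimately have "(1 + norm (snd z)) / (1 + norm (snd z) / R) \<le> R" by (simp add: divide_le_eq mult.commute)
    then show "?r z \<le> R powr d" using d R by (intro powr_mono2) (auto intro!: divide_nonneg_nonneg add_nonneg_nonneg)
  qed simp
  have rm: "?r \<in> borel_measurable lebesgue"
  proof (rule measurable_completion)
    have nz: "1 + norm x / R \<noteq> 0" "1 + norm x \<noteq> 0" for x :: "real^'n"
      using R0 divide_nonneg_pos[OF norm_ge_zero R0, of x] norm_ge_zero[of x] by linarith+
    have "continuous_on UNIV ?r"
      using R0 nz by (intro continuous_intros) auto
    then show "?r \<in> borel_measurable lborel" by (simp add: borel_measurable_continuous_onI)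
  qed
  have eq: "indicator (Q T) z *\<^sub>R (\<bar>u z\<bar> * \<omega> R (snd z)) = ?f z * ?r z" for z
    by (simp add: r case_prod_beta)
  show ?thesis
    unfolding set_integrable_def eq
  proof (rule Bochner_Integration.integrable_bound)
    show "integrable lebesgue (\<lambda>z. ?f z * R powr d)" using I by (rule integrable_mult_left)
    show "(\<lambda>z. ?f z * ?r z) \<in> borel_measurable lebesgue"
      using borel_measurable_integrable[OF I] rm by (rule borel_measurable_times)
    show "AE z in lebesgue. norm (?f z * ?r z) \<le> norm (?f z * R powr d)"
    proof (rule AE_I2)
      fix z :: "real \<times> (real^'n)"
      have "norm (?f z) * ?r z \<le> norm (?f z) * R powr d" by (rule mult_left_mono[OF r_le norm_ge_zero])
      then show "norm (?f z * ?r z) \<le> norm (?f z * R powr d)"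
        unfolding norm_mult by (simp only: real_norm_def abs_of_nonneg[OF powr_ge_zero])
    qed
  qed
qed

text \<open>Dominated convergence with majorant |u| \<omega>: at each point the integrand is 0 for
  all large K.\<close>

lemma tail_tendsto_0:
  assumes T: "0 < T" and R: "1 \<le> R"
  shows "set_integrable lebesgue (Q T) (\<lambda>z. if 2 ^ K * R / 2 < norm (snd z) then \<bar>u z\<bar> * \<omega> R (snd z) else 0)"
    and "(\<lambda>K. LINT z:Q T|lebesgue. (if 2 ^ K * R / 2 < norm (snd z) then \<bar>u z\<bar> * \<omega> R (snd z) else 0)) \<longlonglongrightarrow> 0"
proof -
  let ?f = "\<lambda>z. indicator (Q T) z *\<^sub>R (\<bar>u z\<bar> * \<omega> R (snd z))"
  let ?g = "\<lambda>K z. indicator (Q T) z *\<^sub>R (if 2 ^ K * R / 2 < norm (snd z) then \<bar>u z\<bar> * \<omega> R (snd z) else 0)"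
  have I: "integrable lebesgue ?f"
    using weighted_u_integrable_scaled[OF T R] by (simp add: set_integrable_def)
  have eq: "?g K z = ?f z * indicator {z. 2 ^ K * R / 2 < norm (snd z)} z" for K z
    by (simp add: indicator_def)
  have "open {z :: real \<times> (real^'n). 2 ^ K * R / 2 < norm (snd z)}" for K
    by (intro open_Collect_less continuous_intros)
  then have S: "{z :: real \<times> (real^'n). 2 ^ K * R / 2 < norm (snd z)} \<in> sets lebesgue" for K
    by (intro sets_completionI_sets) simp
  have m: "?g K \<in> borel_measurable lebesgue" for K
    unfolding eq by (rule borel_measurable_times[OF borel_measurable_integrable[OF I] borel_measurable_indicator[OF S]])
  have le: "norm (?g K z) \<le> norm (?f z)" for K z by simp
  show "set_integrable lebesgue (Q T) (\<lambda>z. if 2 ^ K * R / 2 < norm (snd z) then \<bar>u z\<bar> * \<omega> R (snd z) else 0)"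
    unfolding set_integrable_def by (rule Bochner_Integration.integrable_bound[OF I m AE_I2[OF le]])
  have "(\<lambda>K. LINT z|lebesgue. ?g K z) \<longlonglongrightarrow> (LINT z|(lebesgue :: (real \<times> (real^'n)) measure). 0)"
  proof (rule integral_dominated_convergence[where w="\<lambda>z. norm (?f z)"])
    show "integrable lebesgue (\<lambda>z. norm (?f z))" using I by (rule integrable_norm)
    show "AE z in lebesgue. norm (?g K z) \<le> norm (?f z)" for K using le by (rule AE_I2)
    show "AE z in lebesgue. (\<lambda>K. ?g K z) \<longlonglongrightarrow> 0"
    proof (rule AE_I2)
      fix z :: "real \<times> (real^'n)"
      have "filterlim (\<lambda>K. 2 ^ K * R / 2) at_top sequentially" using R by real_asymp
      then have "\<forall>\<^sub>F K in sequentially. norm (snd z) \<le> 2 ^ K * R / 2"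
        by (simp add: filterlim_at_top)
      then have "\<forall>\<^sub>F K in sequentially. ?g K z = 0" by eventually_elim simp
      then show "(\<lambda>K. ?g K z) \<longlonglongrightarrow> 0" by (rule tendsto_eventually)
    qed
  qed (use m in auto)
  then show "(\<lambda>K. LINT z:Q T|lebesgue. (if 2 ^ K * R / 2 < norm (snd z) then \<bar>u z\<bar> * \<omega> R (snd z) else 0)) \<longlonglongrightarrow> 0"
    by (simp add: set_lebesgue_integral_def)
qed

text \<open>No source is negative, so the sum of sources is at least its term k = 0, whose weight is
  1.\<close>

lemma source_le_total_excess:
  assumes "0 < T" "0 < R" and nonneg: "\<And>k. 0 \<le> source T (2 ^ k * R)"
  shows "set_integrable lebesgue (Q T) (total_excess T R K)"
    and "source T R \<le> (LINT z:Q T|lebesgue. total_excess T R K z)"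
proof -
  define a where "a k = (2 ^ k :: real) powr (- (real CARD('n) + 2 * s))" for k :: nat
  have I: "set_integrable lebesgue (Q T) (excess T (2 ^ k * R))"
    and le: "source T (2 ^ k * R) \<le> (LINT z:Q T|lebesgue. excess T (2 ^ k * R) z)" for k :: nat
    using weak_inequality(3,4)[of T "2 ^ k * R"] assms by auto
  have eq: "indicat_real (Q T) z *\<^sub>R total_excess T R K z = (\<Sum>k\<le>K. a k * (indicator (Q T) z *\<^sub>R excess T (2 ^ k * R) z))" for z
    by (simp add: total_excess_def a_def sum_distrib_left mult_ac)
  have I': "integrable lebesgue (\<lambda>z. a k * (indicator (Q T) z *\<^sub>R excess T (2 ^ k * R) z))" for k
    using I[of k] unfolding set_integrable_def by (rule integrable_mult_right)
  show "set_integrable lebesgue (Q T) (total_excess T R K)"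
    unfolding set_integrable_def eq using I' by (rule Bochner_Integration.integrable_sum)
  have "(LINT z:Q T|lebesgue. total_excess T R K z) = (\<Sum>k\<le>K. a k * (LINT z:Q T|lebesgue. excess T (2 ^ k * R) z))"
    unfolding set_lebesgue_integral_def eq by (subst Bochner_Integration.integral_sum[OF I']) simp
  moreover have "(\<Sum>k\<le>K. a k * source T (2 ^ k * R)) \<le> (\<Sum>k\<le>K. a k * (LINT z:Q T|lebesgue. excess T (2 ^ k * R) z))"
    using le by (intro sum_mono mult_left_mono) (auto simp: a_def)
  moreover have "a 0 * source T (2 ^ 0 * R) \<le> (\<Sum>k\<le>K. a k * source T (2 ^ k * R))"
    using nonneg by (intro member_le_sum[of 0 "{..K}" "\<lambda>k. a k * source T (2 ^ k * R)"]) (auto simp: a_def)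
  ultimately show "source T R \<le> (LINT z:Q T|lebesgue. total_excess T R K z)"
    by (simp add: a_def)
qed

lemma scale_inequality:
  obtains W R0 C where "0 < W" "0 < C" "1 \<le> R0"
    "\<And>T R. 0 < T \<Longrightarrow> R0 \<le> R \<Longrightarrow> W * T powr \<sigma>
      \<le> C * R ^ CARD('n) * (T powr (- \<alpha> * (p / (p - 1))) + R powr (- 2 * s * (p / (p - 1))))"
proof -
  define p' where "p' = p / (p - 1)"
  obtain W \<rho>0 where W: "0 < W" and \<rho>0: "0 < \<rho>0"
    and src: "\<And>T \<rho>. 0 < T \<Longrightarrow> \<rho>0 \<le> \<rho> \<Longrightarrow> W * T powr (\<sigma> + 1) \<le> source T \<rho>"
    by (rule source_ge) blast
  obtain C where C: "0 < C" and tot: "\<And>T R K t x. 0 < T \<Longrightarrow> 0 < R \<Longrightarrow> (t, x) \<in> Q T \<Longrightarrow>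
      total_excess T R K (t, x) \<le> C * T powr (- \<alpha> * p') * \<Phi> R K x + C * R powr (- 2 * s * p') * \<omega> R x
        + (if 2 ^ K * R / 2 < norm x then C * R powr (- 2 * s) * (\<bar>u (t, x)\<bar> * \<omega> R x) else 0)"
    unfolding p'_def by (rule total_excess_le) blast
  define I1 where "I1 = 1 / (1 - 2 powr (- 2 * s)) * (LINT x|lborel. bump_prod (x :: real^'n))"
  define I2 where "I2 = (LINT x|lborel. \<omega> 1 x)"
  define M where "M = max 1 (max I1 I2)"
  have M: "0 < M" "I1 \<le> M" "I2 \<le> M" by (auto simp: M_def)
  show ?thesis
  proof (rule that[of W "C * M" "max 1 \<rho>0"], unfold p'_def[symmetric])
    fix T R :: real assume T: "0 < T" and R: "max 1 \<rho>0 \<le> R"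
    then have R1: "1 \<le> R" and R\<rho>: "\<rho>0 \<le> R" and R0: "0 < R" by auto
    define A where "A = C * T powr (- \<alpha> * p')"
    define B where "B = C * R powr (- 2 * s * p')"
    define D where "D = C * R powr (- 2 * s)"
    have AB: "0 \<le> A" "0 \<le> B" using C by (auto simp: A_def B_def)
    let ?tail = "\<lambda>K z. if 2 ^ K * R / 2 < norm (snd z) then \<bar>u z\<bar> * \<omega> R (snd z) else 0"
    have "W * T powr (\<sigma> + 1) \<le> T * (R ^ CARD('n) * (A * M + B * M)) + D * (LINT z:Q T|lebesgue. ?tail K z)" for K
    proof -
      have "0 \<le> source T (2 ^ k * R)" for k :: nat
      proof -
        have "1 * R \<le> 2 ^ k * R" using R0 by (intro mult_right_mono) auto
        then have "W * T powr (\<sigma> + 1) \<le> source T (2 ^ k * R)" using R\<rho> by (intro src T) simp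
        then show ?thesis using W by (smt (verit) mult_nonneg_nonneg powr_ge_zero)
      qed
      note S = source_le_total_excess[OF T R0 this, of K]
      note I = set_integrable_Q_snd[OF T \<Phi>_integrable[OF R0, of K]] set_integrable_Q_snd[OF T \<omega>_integrable[OF R0]]
        tail_tendsto_0(1)[OF T R1, of K]
      have I': "set_integrable lebesgue (Q T) (\<lambda>z. A * \<Phi> R K (snd z))" "set_integrable lebesgue (Q T) (\<lambda>z. B * \<omega> R (snd z))"
        "set_integrable lebesgue (Q T) (\<lambda>z. D * ?tail K z)"
        using I by (intro set_integrable_mult_right; simp)+
      have "W * T powr (\<sigma> + 1) \<le> source T R" by (rule src[OF T R\<rho>])
      also have "\<dots> \<le> (LINT z:Q T|lebesgue. total_excess T R K z)" by (rule S(2))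
      also have "\<dots> \<le> (LINT z:Q T|lebesgue. A * \<Phi> R K (snd z) + B * \<omega> R (snd z) + D * ?tail K z)"
      proof (rule set_integral_mono[OF S(1)])
        show "set_integrable lebesgue (Q T) (\<lambda>z. A * \<Phi> R K (snd z) + B * \<omega> R (snd z) + D * ?tail K z)"
          by (intro set_integral_add I')
        fix z :: "real \<times> (real^'n)" assume "z \<in> Q T"
        then have "(fst z, snd z) \<in> Q T" by simp
        from tot[OF T R0 this, of K]
        show "total_excess T R K z \<le> A * \<Phi> R K (snd z) + B * \<omega> R (snd z) + D * ?tail K z"
          by (simp add: A_def B_def D_def split: if_splits)
      qed
      also have "\<dots> = A * (LINT z:Q T|lebesgue. \<Phi> R K (snd z)) + B * (LINT z:Q T|lebesgue. \<omega> R (snd z)) + D * (LINT z:Q T|lebesgue. ?tail K z)"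
        by (simp only: set_integral_add I' set_integral_mult_right)
      also have "\<dots> = T * (A * (LINT x|lborel. \<Phi> R K x) + B * (R ^ CARD('n) * I2)) + D * (LINT z:Q T|lebesgue. ?tail K z)"
        by (simp add: integral_Q_snd[OF T \<Phi>_integrable[OF R0]] integral_Q_snd[OF T \<omega>_integrable[OF R0]] integral_\<omega>[OF R0] I2_def algebra_simps)
      also have "\<dots> \<le> T * (A * (R ^ CARD('n) * M) + B * (R ^ CARD('n) * M)) + D * (LINT z:Q T|lebesgue. ?tail K z)"
      proof -
        have "(LINT x|lborel. \<Phi> R K x) \<le> R ^ CARD('n) * M"
          using integral_\<Phi>_le[OF R0, of K] M R0 unfolding I1_def[symmetric]
          by (elim order_trans) (intro mult_left_mono, auto)
        moreover have "R ^ CARD('n) * I2 \<le> R ^ CARD('n) * M" using M R0 by (intro mult_left_mono) auto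
        ultimately have "A * (LINT x|lborel. \<Phi> R K x) + B * (R ^ CARD('n) * I2) \<le> A * (R ^ CARD('n) * M) + B * (R ^ CARD('n) * M)"
          using AB by (meson add_mono mult_left_mono)
        from mult_left_mono[OF this less_imp_le[OF T]] show ?thesis by (rule add_right_mono)
      qed
      finally show ?thesis by (simp add: algebra_simps)
    qed
    \<comment> \<open>Here K tends to infinity with T and R fixed; only the tail depends on
      K.\<close>
    moreover have "(\<lambda>K. T * (R ^ CARD('n) * (A * M + B * M)) + D * (LINT z:Q T|lebesgue. ?tail K z))
        \<longlonglongrightarrow> T * (R ^ CARD('n) * (A * M + B * M)) + D * 0"
      by (intro tendsto_intros tail_tendsto_0(2)[OF T R1])
    ultimately have "W * T powr (\<sigma> + 1) \<le> T * (R ^ CARD('n) * (A * M + B * M)) + D * 0"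
      by (intro LIMSEQ_le_const) auto
    then have "T * (W * T powr \<sigma>) \<le> T * (C * M * R ^ CARD('n) * (T powr (- \<alpha> * p') + R powr (- 2 * s * p')))"
      using T by (simp add: powr_add A_def B_def algebra_simps)
    then show "W * T powr \<sigma> \<le> C * M * R ^ CARD('n) * (T powr (- \<alpha> * p') + R powr (- 2 * s * p'))"
      using T by simp
  qed (use W C M in auto)
qed

lemma source_exponent_le:
  shows "\<sigma> \<le> real CARD('n) * \<alpha> / (2 * s) - \<alpha> * (p / (p - 1))"
    and "\<sigma> \<le> 0"
proof -
  define p' where "p' = p / (p - 1)"
  have p': "0 < p'" using p by (simp add: p'_def)
  obtain W R0 C where W: "0 < W" and C: "0 < C" and R0: "1 \<le> R0" and
    ineq: "\<And>T R. 0 < T \<Longrightarrow> R0 \<le> R \<Longrightarrow> W * T powr \<sigma> \<le> C * R ^ CARD('n) * (T powr (- \<alpha> * p') + R powr (- 2 * s * p'))"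
    unfolding p'_def by (rule scale_inequality) blast
  have powr_at_top: "filterlim (\<lambda>T. T powr e) at_top at_top" if "0 < e" for e :: real
    using that by real_asymp
  show "\<sigma> \<le> 0"
  proof (rule ccontr)
    assume "\<not> \<sigma> \<le> 0"
    then have \<sigma>: "0 < \<sigma>" by simp
    \<comment> \<open>The right side at R = R0, with T^(-\<alpha> p') replaced by its bound 1 for T
      \<ge> 1.\<close>
    let ?B = "C * R0 ^ CARD('n) * (1 + R0 powr (- 2 * s * p'))"
    have "\<forall>\<^sub>F T in at_top. ?B / W < T powr \<sigma>"
      using filterlim_at_top_dense[THEN iffD1, OF powr_at_top[OF \<sigma>]] by blast
    then have "\<forall>\<^sub>F T in at_top. ?B / W < T powr \<sigma> \<and> 1 \<le> T"
      using eventually_ge_at_top[of 1] by (rule eventually_conj)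
    then obtain T where T: "?B / W < T powr \<sigma>" "1 \<le> T"
      by (auto dest: eventually_happens simp: eventually_at_top_linorder)
    have "T powr (- \<alpha> * p') \<le> 1" using T \<alpha> p' powr_mono2'[of "- \<alpha> * p'" 1 T] by simp
    then have "C * R0 ^ CARD('n) * (T powr (- \<alpha> * p') + R0 powr (- 2 * s * p')) \<le> ?B"
      using C R0 by (intro mult_left_mono) auto
    with ineq[of T R0] T have "W * T powr \<sigma> \<le> ?B" by linarith
    with T(1) W show False by (simp add: divide_less_eq mult.commute)
  qed
  show "\<sigma> \<le> real CARD('n) * \<alpha> / (2 * s) - \<alpha> * (p / (p - 1))"
  proof (rule ccontr)
    let ?e = "real CARD('n) * \<alpha> / (2 * s) - \<alpha> * p'"
    assume "\<not> ?thesis"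
    then have e: "0 < \<sigma> - ?e" by (simp add: p'_def)
    have a: "0 < \<alpha> / (2 * s)" using \<alpha> s by simp
    have "\<forall>\<^sub>F T in at_top. 2 * C / W < T powr (\<sigma> - ?e)"
      using filterlim_at_top_dense[THEN iffD1, OF powr_at_top[OF e]] by blast
    moreover have "\<forall>\<^sub>F T in at_top. R0 \<le> T powr (\<alpha> / (2 * s))"
      using filterlim_at_top[THEN iffD1, OF powr_at_top[OF a]] by blast
    ultimately have "\<forall>\<^sub>F T in at_top. 2 * C / W < T powr (\<sigma> - ?e) \<and> R0 \<le> T powr (\<alpha> / (2 * s)) \<and> 1 \<le> T"
      using eventually_ge_at_top[of 1] by (intro eventually_conj)
    then obtain T where T: "2 * C / W < T powr (\<sigma> - ?e)" "R0 \<le> T powr (\<alpha> / (2 * s))" "1 \<le> T"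
      by (auto dest: eventually_happens simp: eventually_at_top_linorder)
    \<comment> \<open>This choice balances the two error terms: R^(-2s p') = T^(-\<alpha>
      p').\<close>
    let ?R = "T powr (\<alpha> / (2 * s))"
    have "?R ^ CARD('n) = T powr (real CARD('n) * \<alpha> / (2 * s))"
      using T(3) by (simp add: powr_power)
    moreover have "?R powr (- 2 * s * p') = T powr (- \<alpha> * p')"
      using s by (simp add: powr_powr)
    ultimately have "W * T powr \<sigma> \<le> C * T powr (real CARD('n) * \<alpha> / (2 * s)) * (2 * T powr (- \<alpha> * p'))"
      using ineq[of T ?R] T by simp
    also have "\<dots> = 2 * C * T powr ?e"
      by (simp add: diff_conv_add_uminus powr_add del: add_uminus_conv_diff)
    finally have "W * (T powr (\<sigma> - ?e) * T powr ?e) \<le> 2 * C * T powr ?e"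
      by (simp flip: powr_add)
    then have "W * T powr (\<sigma> - ?e) \<le> 2 * C" using T(3) by (simp flip: mult.assoc)
    with T(1) W show False by (simp add: divide_less_eq mult.commute)
  qed
qed

end

theorem theorem1p3:
  fixes \<alpha> s p \<sigma> :: real
    and w u0 :: "real ^ 'n \<Rightarrow> real"
  assumes "0 < \<alpha>" "\<alpha> < 1"
    and "0 < s" "s < 1"
    and "continuous_on UNIV w" "(w \<longlongrightarrow> 0) at_infinity"
    and "integrable lebesgue w" "(LINT x|lebesgue. w x) > 0"
    and "L1_loc u0" "AE x in lebesgue. 0 \<le> u0 x"
  shows "(- \<alpha> < \<sigma> \<and> \<sigma> \<le> 0 \<and> 2 * s < real CARD('n) \<and> 1 < p \<and>
            p < (real CARD('n) * \<alpha> - 2 * s * \<sigma>) / (real CARD('n) * \<alpha> - 2 * s * (\<alpha> + \<sigma>))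
          \<longrightarrow> \<not> (\<exists>u. global_weak_solution \<alpha> s p \<sigma> w u0 u)) \<and>
         (0 < \<sigma> \<and> 1 < p \<longrightarrow> \<not> (\<exists>u. global_weak_solution \<alpha> s p \<sigma> w u0 u))"
proof (intro conjI impI notI; elim conjE exE)
  fix u
  assume sigma: "- \<alpha> < \<sigma>" "\<sigma> \<le> 0" and N: "2 * s < real CARD('n)" and p1: "1 < p"
    and crit: "p < (real CARD('n) * \<alpha> - 2 * s * \<sigma>) / (real CARD('n) * \<alpha> - 2 * s * (\<alpha> + \<sigma>))"
    and solution: "global_weak_solution \<alpha> s p \<sigma> w u0 u"
  interpret weak_solution \<alpha> s p \<sigma> w u0 u
    using assms sigma p1 solution by unfold_locales auto
  let ?A = "real CARD('n) * \<alpha> - 2 * s * \<sigma>"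
  have "0 < (real CARD('n) - 2 * s) * \<alpha>" using N assms(1) by simp
  moreover have "0 \<le> s * (- \<sigma>)" using assms(3) sigma(2) by (intro mult_nonneg_nonneg) auto
  \<comment> \<open>The denominator of the critical exponent is positive because 2s < N and \<sigma>
    \<le> 0, so the bound on p can be multiplied out.\<close>
  ultimately have D: "0 < ?A - 2 * s * \<alpha>" by (simp add: algebra_simps)
  have "p < ?A / (?A - 2 * s * \<alpha>)" using crit by (simp add: algebra_simps)
  then have "p * (?A - 2 * s * \<alpha>) < ?A" using D by (simp add: pos_less_divide_eq)
  then have "(p - 1) * ?A < 2 * s * \<alpha> * p" by (simp add: algebra_simps)
  moreover have "(p - 1) * ?A \<ge> 2 * s * \<alpha> * p"
  proof -
    \<comment> \<open>A free variable for the numerator keeps it atomic while the fractions are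
      cleared.\<close>
    have "2 * s * \<alpha> * p \<le> (p - 1) * A" if "\<alpha> * (p / (p - 1)) \<le> A / (2 * s)" for A
      using that assms(3) p1 by (simp add: field_simps)
    moreover have "\<alpha> * (p / (p - 1)) \<le> ?A / (2 * s)"
      using source_exponent_le(1) assms(3) by (simp add: diff_divide_distrib)
    ultimately show ?thesis .
  qed
  ultimately show False by linarith
next
  fix u
  assume sigma: "0 < \<sigma>" and p1: "1 < p" and solution: "global_weak_solution \<alpha> s p \<sigma> w u0 u"
  interpret weak_solution \<alpha> s p \<sigma> w u0 u
    using assms sigma p1 solution by unfold_locales auto
  show False using source_exponent_le(2) sigma by simp
qed

end
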